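(* Under the clutter noise model with mixing weight $0<\pi\le 1$, there is a constant $C>0$, not depending on $n$, such that $$\inf_{\hat M}\ \sup_{Q\in\mathcal{Q}}\ \mathbb{E}_{Q^n}\big[H(\hat M,M)\big]\ \ge\ C\left(\frac{1}{n\pi}\right)^{2/d},$$ where the infimum is over all estimators $\hat M=\hat M(Y_1,\dots,Y_n)$ based on an i.i.d. sample $Y_1,\dots,Y_n\sim Q$.
   Context: Fix integers $1\le d<D$, a constant $\kappa>0$ and a compact set $\mathcal{K}\subset\mathbb{R}^D$ with nonempty interior. For sets $A,B\subset\mathbb{R}^D$ the Hausdorff distance is $H(A,B)=\inf\{\varepsilon: A\subset B\oplus\varepsilon \text{ and } B\subset A\oplus\varepsilon\}$, where $A\oplus\varepsilon=\bigcup_{x\in A}B_D(x,\varepsilon)$ and $B_D(x,\varepsilon)$ is the open Euclidean ball of radius $\varepsilon$ centered at $x$. For a manifold $M\subset\mathbb{R}^D$, $\Delta(M)$ (the reach, or condition number) is the largest $r$ such that each point of $M\oplus r$ has a unique projection onto $M$. $\mathcal{M}(\kappa)$ is the set of all $d$-dimensional smooth Riemannian submanifolds (without boundary) embedded in $\mathbb{R}^D$ with $\Delta(M)\ge\kappa$. Let $\mathcal{M}=\{M\in\mathcal{M}(\kappa): M\subset\mathcal{K}\}$. Fix constants $0<b(\mathcal{M})\le B(\mathcal{M})<\infty$ that may depend on the class $\mathcal{M}$ but not on the particular $M$. For $M\in\mathcal{M}$, $\mathcal{G}(M)$ is the set of probability distributions $G$ supported on $M$ having a density $g$ with respect to the uniform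 distribution on $M$ with $b(\mathcal{M})\le\inf_{y\in M}g(y)\le\sup_{y\in M}g(y)\le B(\mathcal{M})$. Clutter noise model: $0<\pi\le1$ is fixed, $U$ is the uniform distribution on $\mathcal{K}$, the observations are i.i.d. $Y_1,\dots,Y_n\sim Q=(1-\pi)U+\pi G$, and $\mathcal{Q}=\{(1-\pi)U+\pi G: G\in\mathcal{G}(M),\ M\in\mathcal{M}\}$. In the risk, $M$ denotes the manifold supporting the component $G$ of $Q$, and $Q^n$ is the $n$-fold product measure.
   Formalization: The formal statement also assumes b(M) ≤ 1 ≤ B(M) (otherwise no such density exists) and that some manifold in the class has reach strictly larger than κ and meets the interior of K; without such conditions the class may be empty or a single manifold, and the bound fails. *)

theory Defs
  imports "HOL-Probability.Probability"
begin

section \<open>Tubes, Hausdorff distance and reach\<close>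

definition tube :: "'a::metric_space set \<Rightarrow> real \<Rightarrow> 'a set"
  where "tube A \<epsilon> = (\<Union>x\<in>A. ball x \<epsilon>)"

text \<open>The value is \<open>\<infinity>\<close> when no \<open>\<epsilon>\<close> is admissible, e.g. when exactly one of the sets is empty.\<close>

definition hausdorff_distance :: "'a::metric_space set \<Rightarrow> 'a set \<Rightarrow> ennreal"
  where "hausdorff_distance A B =
    Inf {ennreal \<epsilon> |\<epsilon>. 0 < \<epsilon> \<and> A \<subseteq> tube B \<epsilon> \<and> B \<subseteq> tube A \<epsilon>}"

text \<open>Extended-real valued, since every radius is admissible e.g. for an affine subspace. The
  admissible radii are downward closed, and the tubes are open, so a finite supremum is a maximum.\<close>

definition reach :: "'a::metric_space set \<Rightarrow> ereal"
  where "reach M =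
    (SUP r\<in>{r. 0 \<le> r \<and> (\<forall>x\<in>tube M r. \<exists>!y. y \<in> M \<and> (\<forall>z\<in>M. dist x y \<le> dist x z))}. ereal r)"


section \<open>Smooth submanifolds\<close>

text \<open>\<open>ck_on k f S\<close>, for open \<open>S\<close>: \<open>f\<close> has all iterated directional derivatives up to
  order \<open>k\<close> on \<open>S\<close>, those of order below \<open>k\<close> are Frechet differentiable, and those of order
  \<open>k\<close> are continuous.\<close>

fun ck_on :: "nat \<Rightarrow> ('a::real_normed_vector \<Rightarrow> 'b::real_normed_vector) \<Rightarrow> 'a set \<Rightarrow> bool"
  where
    "ck_on 0 f S \<longleftrightarrow> continuous_on S f"
  | "ck_on (Suc k) f S \<longleftrightarrow> (\<forall>x\<in>S. f differentiable (at x)) \<and>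
       (\<forall>v. ck_on k (\<lambda>x. frechet_derivative f (at x) v) S)"

definition smooth_on :: "'a::real_normed_vector set \<Rightarrow> ('a \<Rightarrow> 'b::real_normed_vector) \<Rightarrow> bool"
  where "smooth_on S f \<longleftrightarrow> (\<forall>k. ck_on k f S)"

text \<open>Embedded submanifolds without boundary, by slice charts of the ambient space. Neither
  connectedness nor compactness is required.\<close>

definition smooth_submanifold :: "nat \<Rightarrow> 'a::euclidean_space set \<Rightarrow> bool"
  where "smooth_submanifold d M \<longleftrightarrow>
    (\<forall>x\<in>M. \<exists>(U :: 'a set) (V :: 'a set) \<phi> \<psi> S.
       open U \<and> open V \<and> x \<in> U \<and> homeomorphism U V \<phi> \<psi> \<and> smooth_on U \<phi> \<and> smooth_on V \<psi> \<and>
       subspace S \<and> dim S = d \<and> \<phi> ` (U \<inter> M) = V \<inter> S)"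

definition manifolds :: "nat \<Rightarrow> real \<Rightarrow> 'a::euclidean_space set set"
  where "manifolds d \<kappa> = {M. M \<noteq> {} \<and> smooth_submanifold d M \<and> ereal \<kappa> \<le> reach M}"

definition manifolds_in :: "nat \<Rightarrow> real \<Rightarrow> 'a::euclidean_space set \<Rightarrow> 'a set set"
  where "manifolds_in d \<kappa> K = {M \<in> manifolds d \<kappa>. M \<subseteq> K}"


section \<open>Hausdorff measure\<close>

text \<open>The \<open>d\<close>-dimensional Hausdorff measure (for \<open>d \<ge> 1\<close>), without the customary
  normalising constant. On a \<open>d\<close>-dimensional submanifold it is a constant multiple of the
  Riemannian volume, so the normalised restrictions of the two measures coincide.\<close>

definition hausdorff_content :: "nat \<Rightarrow> real \<Rightarrow> 'a::metric_space set \<Rightarrow> ennreal"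
  where "hausdorff_content d \<delta> A =
    Inf {(\<Sum>i. ennreal (diameter (C i) ^ d)) |C :: nat \<Rightarrow> 'a set.
      A \<subseteq> (\<Union>i. C i) \<and> (\<forall>i. bounded (C i) \<and> diameter (C i) \<le> \<delta>)}"

definition hausdorff_outer :: "nat \<Rightarrow> 'a::metric_space set \<Rightarrow> ennreal"
  where "hausdorff_outer d A = (SUP \<delta>\<in>{0<..}. hausdorff_content d \<delta> A)"

definition hausdorff_measure :: "nat \<Rightarrow> 'a::metric_space measure"
  where "hausdorff_measure d = measure_of UNIV (sets borel) (hausdorff_outer d)"

lemma space_hausdorff_measure [simp]: "space (hausdorff_measure d) = UNIV"
  by (simp add: hausdorff_measure_def)

lemma sets_hausdorff_measure [simp, measurable_cong]: "sets (hausdorff_measure d) = sets borel"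
  using sets.sigma_sets_eq[of borel] by (simp add: hausdorff_measure_def)

lemma hausdorff_content_mono:
  "A \<subseteq> B \<Longrightarrow> hausdorff_content d \<delta> A \<le> hausdorff_content d \<delta> B"
  unfolding hausdorff_content_def by (rule Inf_superset_mono) blast

lemma hausdorff_content_antimono:
  "\<delta> \<le> \<delta>' \<Longrightarrow> hausdorff_content d \<delta>' A \<le> hausdorff_content d \<delta> A"
  unfolding hausdorff_content_def by (rule Inf_superset_mono) (blast intro: order_trans)

lemma hausdorff_content_le:
  assumes "A \<subseteq> (\<Union>i. C i)" "\<And>i. bounded (C i)" "\<And>i. diameter (C i) \<le> \<delta>"
  shows "hausdorff_content d \<delta> A \<le> (\<Sum>i. ennreal (diameter (C i) ^ d))"
  unfolding hausdorff_content_def using assms by (intro Inf_lower) blast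

lemma hausdorff_content_subadditive:
  fixes A :: "nat \<Rightarrow> 'a::metric_space set"
  shows "hausdorff_content d \<delta> (\<Union>i. A i) \<le> (\<Sum>i. hausdorff_content d \<delta> (A i))"
proof (rule ennreal_le_epsilon)
  fix e :: real assume e: "0 < e"
    and fin: "(\<Sum>i. hausdorff_content d \<delta> (A i)) < top"
  have fin_i: "hausdorff_content d \<delta> (A i) < top" for i
    using fin ennreal_suminf_lessD by blast
  have "\<exists>C. A i \<subseteq> (\<Union>j. C j) \<and> (\<forall>j. bounded (C j) \<and> diameter (C j) \<le> \<delta>) \<and>
      (\<Sum>j. ennreal (diameter (C j) ^ d)) < hausdorff_content d \<delta> (A i) + ennreal (e * (1/2) ^ Suc i)" for i
  proof -
    have "hausdorff_content d \<delta> (A i) + 0 < hausdorff_content d \<delta> (A i) + ennreal (e * (1/2) ^ Suc i)"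
      using fin_i[of i] e by (intro ennreal_add_left_cancel_less[THEN iffD2]) auto
    then have "Inf {(\<Sum>i. ennreal (diameter (C i) ^ d)) |C :: nat \<Rightarrow> 'a set.
        A i \<subseteq> (\<Union>i. C i) \<and> (\<forall>i. bounded (C i) \<and> diameter (C i) \<le> \<delta>)}
        < hausdorff_content d \<delta> (A i) + ennreal (e * (1/2) ^ Suc i)"
      by (simp only: hausdorff_content_def add_0_right)
    then show ?thesis
      unfolding Inf_less_iff by blast
  qed
  then have "\<forall>i. \<exists>C. A i \<subseteq> (\<Union>j. C j) \<and> (\<forall>j. bounded (C j) \<and> diameter (C j) \<le> \<delta>) \<and>
      (\<Sum>j. ennreal (diameter (C j) ^ d)) < hausdorff_content d \<delta> (A i) + ennreal (e * (1/2) ^ Suc i)"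
    by blast
  from choice[OF this] obtain C where C: "\<And>i. A i \<subseteq> (\<Union>j. C i j)"
      "\<And>i j. bounded (C i j)" "\<And>i j. diameter (C i j) \<le> \<delta>"
    and C': "\<And>i. (\<Sum>j. ennreal (diameter (C i j) ^ d)) < hausdorff_content d \<delta> (A i) + ennreal (e * (1/2) ^ Suc i)"
    by blast
  define E where "E k = (case prod_decode k of (i, j) \<Rightarrow> C i j)" for k
  have "(\<Union>i. A i) \<subseteq> (\<Union>k. E k)"
  proof
    fix x assume "x \<in> (\<Union>i. A i)"
    then obtain i j where "x \<in> C i j" using C(1) by blast
    then have "x \<in> E (prod_encode (i, j))" by (simp add: E_def)
    then show "x \<in> (\<Union>k. E k)" by blast
  qed
  then have "hausdorff_content d \<delta> (\<Union>i. A i) \<le> (\<Sum>k. ennreal (diameter (E k) ^ d))"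
    by (rule hausdorff_content_le) (auto simp: E_def C split: prod.split)
  also have "\<dots> = (\<Sum>k. (\<lambda>(i, j). ennreal (diameter (C i j) ^ d)) (prod_decode k))"
    by (intro suminf_cong) (auto simp: E_def split: prod.split)
  also have "\<dots> = (\<Sum>i. \<Sum>j. ennreal (diameter (C i j) ^ d))"
    by (rule suminf_ennreal_2dimen) simp
  also have "\<dots> \<le> (\<Sum>i. hausdorff_content d \<delta> (A i) + ennreal (e * (1/2) ^ Suc i))"
    using C' by (intro suminf_le) (auto intro: less_imp_le)
  also have "\<dots> = (\<Sum>i. hausdorff_content d \<delta> (A i)) + (\<Sum>i. ennreal (e * (1/2) ^ Suc i))"
    by (rule suminf_add[symmetric]) auto
  also have "(\<Sum>i. ennreal (e * (1/2) ^ Suc i)) = ennreal e"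
    using sums_mult[OF power_half_series, of e] e
    by (intro suminf_ennreal_eq) auto
  finally show "hausdorff_content d \<delta> (\<Union>i. A i) \<le> (\<Sum>i. hausdorff_content d \<delta> (A i)) + ennreal e" .
qed

lemma hausdorff_outer_mono: "A \<subseteq> B \<Longrightarrow> hausdorff_outer d A \<le> hausdorff_outer d B"
  unfolding hausdorff_outer_def by (intro SUP_mono) (metis hausdorff_content_mono)

lemma hausdorff_outer_subadditive:
  "hausdorff_outer d (\<Union>i. A i) \<le> (\<Sum>i. hausdorff_outer d (A i))" for A :: "nat \<Rightarrow> _"
  unfolding hausdorff_outer_def
proof (rule SUP_least)
  fix \<delta> :: real assume "\<delta> \<in> {0<..}"
  then have "(\<Sum>i. hausdorff_content d \<delta> (A i)) \<le> (\<Sum>i. SUP \<delta>\<in>{0<..}. hausdorff_content d \<delta> (A i))"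
    by (intro suminf_le SUP_upper) auto
  with hausdorff_content_subadditive
  show "hausdorff_content d \<delta> (\<Union>i. A i) \<le> (\<Sum>i. SUP \<delta>\<in>{0<..}. hausdorff_content d \<delta> (A i))"
    by (rule order_trans)
qed

lemma hausdorff_outer_empty: "0 < d \<Longrightarrow> hausdorff_outer d {} = 0"
proof -
  assume "0 < d"
  then have "hausdorff_content d \<delta> {} \<le> 0" if "0 < \<delta>" for \<delta>
    using hausdorff_content_le[of "{}" "\<lambda>_. {}" \<delta> d] that by (simp add: power_0_left)
  then have "hausdorff_outer d {} \<le> 0"
    unfolding hausdorff_outer_def by (intro SUP_least) simp
  then show ?thesis by simp
qed

lemma hausdorff_outer_metric:
  assumes d: "0 < d" and e: "0 < e" and sep: "\<And>x y. x \<in> A \<Longrightarrow> y \<in> B \<Longrightarrow> e \<le> dist x y"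
  shows "hausdorff_outer d A + hausdorff_outer d B \<le> hausdorff_outer d (A \<union> B)"
proof -
  have small: "hausdorff_content d \<delta> A + hausdorff_content d \<delta> B \<le> hausdorff_content d \<delta> (A \<union> B)"
    if \<delta>: "0 < \<delta>" "\<delta> < e" for \<delta>
    unfolding hausdorff_content_def[of d \<delta> "A \<union> B"]
  proof (rule Inf_greatest, clarify)
    fix C :: "nat \<Rightarrow> 'a set"
    assume C: "A \<union> B \<subseteq> (\<Union>i. C i)" "\<forall>i. bounded (C i) \<and> diameter (C i) \<le> \<delta>"
    define CA where "CA i = (if C i \<inter> A = {} then {} else C i)" for i
    define CB where "CB i = (if C i \<inter> A = {} then C i else {})" for i
    have disj: "C i \<inter> A = {} \<or> C i \<inter> B = {}" for i
    proof (rule ccontr)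
      assume "\<not> ?thesis"
      then obtain x y where xy: "x \<in> C i" "x \<in> A" "y \<in> C i" "y \<in> B" by blast
      then have "dist x y \<le> diameter (C i)" by (intro diameter_bounded_bound) (simp_all add: C(2))
      also have "\<dots> \<le> \<delta>" using C(2) by blast
      finally have "dist x y \<le> \<delta>" .
      with sep[OF xy(2) xy(4)] \<delta> show False by simp
    qed
    have "A \<subseteq> (\<Union>i. CA i)"
    proof
      fix x assume "x \<in> A"
      then obtain i where "x \<in> C i" using C(1) by blast
      with \<open>x \<in> A\<close> have "x \<in> CA i" by (auto simp: CA_def)
      then show "x \<in> (\<Union>i. CA i)" by blast
    qed
    then have 1: "hausdorff_content d \<delta> A \<le> (\<Sum>i. ennreal (diameter (CA i) ^ d))"
      by (rule hausdorff_content_le) (use C \<delta> in \<open>auto simp: CA_def\<close>)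
    have "B \<subseteq> (\<Union>i. CB i)"
    proof
      fix x assume "x \<in> B"
      then obtain i where "x \<in> C i" using C(1) by blast
      with \<open>x \<in> B\<close> disj[of i] have "x \<in> CB i" by (auto simp: CB_def)
      then show "x \<in> (\<Union>i. CB i)" by blast
    qed
    then have 2: "hausdorff_content d \<delta> B \<le> (\<Sum>i. ennreal (diameter (CB i) ^ d))"
      by (rule hausdorff_content_le) (use C \<delta> in \<open>auto simp: CB_def\<close>)
    have "hausdorff_content d \<delta> A + hausdorff_content d \<delta> B
        \<le> (\<Sum>i. ennreal (diameter (CA i) ^ d)) + (\<Sum>i. ennreal (diameter (CB i) ^ d))"
      by (rule add_mono[OF 1 2])
    also have "\<dots> = (\<Sum>i. ennreal (diameter (CA i) ^ d) + ennreal (diameter (CB i) ^ d))"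
      by (rule suminf_add) auto
    also have "\<dots> = (\<Sum>i. ennreal (diameter (C i) ^ d))"
      using d by (intro suminf_cong) (simp add: CA_def CB_def power_0_left)
    finally show "hausdorff_content d \<delta> A + hausdorff_content d \<delta> B
        \<le> (\<Sum>i. ennreal (diameter (C i) ^ d))" .
  qed
  have "hausdorff_content d i A + hausdorff_content d j B \<le> hausdorff_outer d (A \<union> B)"
    if "0 < i" "0 < j" for i j
  proof -
    define \<delta> where "\<delta> = min (min i j) (e/2)"
    have \<delta>: "0 < \<delta>" "\<delta> < e" "\<delta> \<le> i" "\<delta> \<le> j" using that e by (auto simp: \<delta>_def)
    have "hausdorff_content d i A + hausdorff_content d j B
        \<le> hausdorff_content d \<delta> A + hausdorff_content d \<delta> B"
      by (intro add_mono hausdorff_content_antimono \<delta>)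
    also have "\<dots> \<le> hausdorff_content d \<delta> (A \<union> B)" by (rule small[OF \<delta>(1,2)])
    also have "\<dots> \<le> hausdorff_outer d (A \<union> B)"
      unfolding hausdorff_outer_def using \<delta> by (intro SUP_upper) auto
    finally show ?thesis .
  qed
  then have "hausdorff_content d i A + hausdorff_outer d B \<le> hausdorff_outer d (A \<union> B)"
    if "0 < i" for i
    unfolding hausdorff_outer_def[of d B]
    using that by (subst ennreal_SUP_add_right) (auto intro!: SUP_least)
  then show ?thesis
    unfolding hausdorff_outer_def[of d A]
    by (subst ennreal_SUP_add_left[symmetric]) (auto intro!: SUP_least)
qed

lemma hausdorff_outer_subadditive2:
  assumes "0 < d" shows "hausdorff_outer d (A \<union> B) \<le> hausdorff_outer d A + hausdorff_outer d B"
proof -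
  define F where "F i = (if i = 0 then A else if i = Suc 0 then B else {})" for i :: nat
  have "A \<union> B = F 0 \<union> F (Suc 0)" by (simp add: F_def)
  also have "\<dots> = (\<Union>i. F i)" by (intro equalityI subsetI) (auto simp: F_def split: if_split_asm)
  finally have "hausdorff_outer d (A \<union> B) \<le> (\<Sum>i. hausdorff_outer d (F i))"
    by (simp only: hausdorff_outer_subadditive)
  also have "\<dots> = (\<Sum>i<2. hausdorff_outer d (F i))"
    by (rule suminf_finite) (auto simp: F_def hausdorff_outer_empty assms)
  finally show ?thesis by (simp add: F_def numeral_2_eq_2)
qed

lemma hausdorff_outer_closed:
  fixes C A :: "'a::metric_space set"
  assumes d: "0 < d" and C: "closed C"
  shows "hausdorff_outer d (A \<inter> C) + hausdorff_outer d (A - C) = hausdorff_outer d A"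
proof (cases "C = {} \<or> hausdorff_outer d A = top")
  case True
  have "hausdorff_outer d A \<le> hausdorff_outer d (A \<inter> C) + hausdorff_outer d (A - C)"
    using hausdorff_outer_subadditive2[OF d, of "A \<inter> C" "A - C"] by (simp add: Int_Diff_Un)
  then show ?thesis using True d by (auto simp: hausdorff_outer_empty top_unique)
next
  case False
  then have ne: "C \<noteq> {}" and fin: "hausdorff_outer d A < top" by (auto simp: less_top)
  let ?H = "hausdorff_outer d :: 'a set \<Rightarrow> ennreal"
  define r where "r n = 1 / real (Suc n)" for n
  have r: "0 < r n" "r (Suc n) < r n" "r (Suc (Suc n)) < r (Suc n)" for n
    by (auto simp: r_def divide_simps)
  have r_anti: "r n \<le> r m" if "m \<le> n" for m n
    using that by (auto simp: r_def divide_simps)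
  define P where "P n = {x \<in> A. r n \<le> infdist x C}" for n
  define R where "R n = {x \<in> A. r (Suc n) \<le> infdist x C \<and> infdist x C < r n}" for n
  have infdist_le: "infdist x C \<le> dist x y + infdist y C" for x y
    using infdist_triangle[of x C y] by (simp add: add.commute)
  have P: "?H (A \<inter> C) + ?H (P n) \<le> ?H A" for n
  proof -
    have "?H (A \<inter> C) + ?H (P n) \<le> ?H ((A \<inter> C) \<union> P n)"
    proof (rule hausdorff_outer_metric[OF d r(1)[of n]])
      fix x y assume "x \<in> A \<inter> C" "y \<in> P n"
      then show "r n \<le> dist x y"
        using infdist_le[of y x] infdist_zero[of x C] by (auto simp: P_def dist_commute)
    qed
    also have "\<dots> \<le> ?H A" by (rule hausdorff_outer_mono) (auto simp: P_def)
    finally show ?thesis .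
  qed
  have alternate: "(\<Sum>k<n. ?H (R (2 * k + c))) \<le> ?H A" for n c
  proof -
    have "(\<Sum>k<n. ?H (R (2 * k + c))) \<le> ?H (\<Union>k<n. R (2 * k + c))"
    proof (induction n)
      case (Suc n)
      have "(\<Sum>k<Suc n. ?H (R (2 * k + c))) \<le> ?H (\<Union>k<n. R (2 * k + c)) + ?H (R (2 * n + c))"
        using Suc by (simp add: add_right_mono)
      also have "\<dots> \<le> ?H ((\<Union>k<n. R (2 * k + c)) \<union> R (2 * n + c))"
      proof (cases n)
        case 0
        then show ?thesis by (simp add: hausdorff_outer_empty d)
      next
        case (Suc m)
        show ?thesis
        proof (rule hausdorff_outer_metric[OF d])
          show "0 < r (2 * m + c + 1) - r (2 * m + c + 2)" using r(2)[of "2 * m + c + 1"] by simp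
          fix x y assume x: "x \<in> (\<Union>k<n. R (2 * k + c))" and y: "y \<in> R (2 * n + c)"
          from x obtain k where k: "k < n" "x \<in> R (2 * k + c)" by blast
          then have "r (2 * m + c + 1) \<le> infdist x C"
            using r_anti[of "Suc (2 * k + c)" "2 * m + c + 1"] Suc by (auto simp: R_def)
          moreover have "infdist y C < r (2 * m + c + 2)" using y Suc by (simp add: R_def)
          ultimately show "r (2 * m + c + 1) - r (2 * m + c + 2) \<le> dist x y"
            using infdist_le[of x y] by linarith
        qed
      qed
      also have "(\<Union>k<n. R (2 * k + c)) \<union> R (2 * n + c) = (\<Union>k<Suc n. R (2 * k + c))"
        by (auto simp: lessThan_Suc)
      finally show ?case .
    qed simp
    also have "\<dots> \<le> ?H A" by (rule hausdorff_outer_mono) (auto simp: R_def)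
    finally show ?thesis .
  qed
  have "(\<Sum>k. ?H (R k)) \<le> ?H A + ?H A"
  proof (rule suminf_le_const)
    fix n
    have "(\<Sum>k<n. ?H (R k)) \<le> (\<Sum>k<2 * n. ?H (R k))"
      by (rule sum_mono2) auto
    also have "\<dots> = (\<Sum>k<n. ?H (R (2 * k + 0))) + (\<Sum>k<n. ?H (R (2 * k + 1)))"
      by (induction n) (auto simp: algebra_simps)
    also have "\<dots> \<le> ?H A + ?H A" by (intro add_mono alternate)
    finally show "(\<Sum>k<n. ?H (R k)) \<le> ?H A + ?H A" .
  qed simp
  then have fin_sum: "(\<Sum>k. ?H (R k)) \<noteq> top" using fin by (auto simp: top_unique)
  have tail: "(\<lambda>n. \<Sum>k. ?H (R (k + n))) \<longlonglongrightarrow> 0"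
  proof -
    define h where "h k = enn2real (?H (R k))" for k
    have fk: "?H (R k) < top" for k
      using fin_sum ennreal_suminf_lessD[of "\<lambda>k. ?H (R k)" top k] by (auto simp: less_top)
    then have hk: "?H (R k) = ennreal (h k)" "0 \<le> h k" for k by (auto simp: h_def)
    have sm: "summable h"
      by (rule summable_suminf_not_top[OF hk(2)]) (use fin_sum in \<open>simp only: hk(1)[symmetric] not_False_eq_True\<close>)
    have "(\<lambda>n. ennreal (\<Sum>k. h (k + n))) \<longlonglongrightarrow> ennreal 0"
      by (intro tendsto_ennrealI suminf_exist_split2 sm)
    moreover have "(\<Sum>k. ?H (R (k + n))) = ennreal (\<Sum>k. h (k + n))" for n
      unfolding hk(1) by (rule suminf_ennreal2[OF hk(2)]) (simp add: sm summable_iff_shift)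
    ultimately show ?thesis by (simp only: ennreal_0)
  qed
  have split: "?H (A - C) \<le> ?H (P n) + (\<Sum>k. ?H (R (k + n)))" for n
  proof -
    have "A - C \<subseteq> P n \<union> (\<Union>k. R (k + n))"
    proof
      fix x assume x: "x \<in> A - C"
      then have pos: "0 < infdist x C" using C ne by (simp add: infdist_pos_not_in_closed)
      then obtain m where "r m < infdist x C"
        using reals_Archimedean by (auto simp: r_def inverse_eq_divide)
      then have ex: "\<exists>m. r m \<le> infdist x C" using less_imp_le by blast
      define m where "m = (LEAST m. r m \<le> infdist x C)"
      have m: "r m \<le> infdist x C" unfolding m_def by (rule LeastI_ex[OF ex])
      show "x \<in> P n \<union> (\<Union>k. R (k + n))"
      proof (cases "m \<le> n")
        case True
        then have "x \<in> P n" using m r_anti[of m n] x by (auto simp: P_def)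
        then show ?thesis ..
      next
        case False
        then obtain j where j: "m = Suc j" "n \<le> j" by (cases m) auto
        then have "infdist x C < r j" using not_less_Least[of j "\<lambda>m. r m \<le> infdist x C"]
          by (auto simp: m_def[symmetric])
        then have "x \<in> R (j - n + n)" using m j x by (auto simp: R_def)
        then show ?thesis by blast
      qed
    qed
    then have "?H (A - C) \<le> ?H (P n \<union> (\<Union>k. R (k + n)))" by (rule hausdorff_outer_mono)
    also have "\<dots> \<le> ?H (P n) + ?H (\<Union>k. R (k + n))" by (rule hausdorff_outer_subadditive2[OF d])
    also have "\<dots> \<le> ?H (P n) + (\<Sum>k. ?H (R (k + n)))"
      by (intro add_left_mono hausdorff_outer_subadditive)
    finally show ?thesis .
  qed
  have le: "?H (A \<inter> C) + ?H (A - C) \<le> ?H A + (\<Sum>k. ?H (R (k + n)))" for n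
    using add_mono[OF P[of n] order_refl] add_left_mono[OF split[of n], of "?H (A \<inter> C)"]
    by (metis (no_types, lifting) add.assoc order_trans)
  have "?H (A \<inter> C) + ?H (A - C) \<le> ?H A + 0"
    by (rule LIMSEQ_le_const[OF tendsto_add[OF tendsto_const tail]]) (use le in blast)
  moreover have "?H A \<le> ?H (A \<inter> C) + ?H (A - C)"
    using hausdorff_outer_subadditive2[OF d, of "A \<inter> C" "A - C"] by (simp add: Int_Diff_Un)
  ultimately show ?thesis by simp
qed

lemma emeasure_hausdorff_measure:
  fixes A :: "'a::metric_space set"
  assumes d: "0 < d" and A: "A \<in> sets borel"
  shows "emeasure (hausdorff_measure d) A = hausdorff_outer d A"
proof -
  let ?H = "hausdorff_outer d :: 'a set \<Rightarrow> ennreal" and ?L = "lambda_system UNIV UNIV (hausdorff_outer d :: 'a set \<Rightarrow> ennreal)"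
  interpret P: sigma_algebra "UNIV :: 'a set" "UNIV :: 'a set set"
    using sigma_algebra_Pow[of "UNIV :: 'a set"] by simp
  have "outer_measure_space UNIV ?H"
    by (auto simp: outer_measure_space_def positive_def increasing_def countably_subadditive_def
        hausdorff_outer_empty d hausdorff_outer_mono hausdorff_outer_subadditive)
  then have ms: "measure_space UNIV ?L ?H" by (rule P.caratheodory_lemma)
  then interpret L: sigma_algebra UNIV ?L by (simp add: measure_space_def)
  have "C \<in> ?L" if "closed C" for C
    using hausdorff_outer_closed[OF d that]
    by (simp add: lambda_system_def Int_commute Diff_eq flip: Compl_eq_Diff_UNIV)
  then have "sigma_sets UNIV {C :: 'a set. closed C} \<subseteq> ?L"
    by (intro L.sigma_sets_subset) auto
  then have "sets borel \<subseteq> ?L"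
    by (simp add: borel_eq_closed sets_measure_of)
  moreover have "sigma_algebra UNIV (sets (borel :: 'a measure))"
    using sets.sigma_algebra_axioms[of "borel :: 'a measure"] by simp
  ultimately have "measure_space UNIV (sets borel) ?H"
    by (intro measure_down[OF ms])
  then have "sigma_algebra UNIV (sets (borel :: 'a measure))" "positive (sets borel) ?H"
    "countably_additive (sets borel) ?H"
    by (simp_all only: measure_space_def)
  then show ?thesis
    unfolding hausdorff_measure_def by (rule emeasure_measure_of_sigma) (rule A)
qed


section \<open>The clutter noise model\<close>

definition manifold_distributions ::
    "nat \<Rightarrow> real \<Rightarrow> real \<Rightarrow> 'a::euclidean_space set \<Rightarrow> 'a measure set"
  where "manifold_distributions d b B M =
    {G. prob_space G \<and>
        (\<exists>g :: 'a \<Rightarrow> real. g \<in> borel_measurable borel \<and> (\<forall>y\<in>M. b \<le> g y \<and> g y \<le> B) \<and>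
           G = density (uniform_measure (hausdorff_measure d) M) (\<lambda>y. ennreal (g y)))}"

definition clutter_mixture ::
    "real \<Rightarrow> 'a::euclidean_space set \<Rightarrow> 'a measure \<Rightarrow> 'a measure"
  where "clutter_mixture \<pi> K G = measure_of UNIV (sets borel)
    (\<lambda>A. ennreal (1 - \<pi>) * emeasure (uniform_measure lborel K) A + ennreal \<pi> * emeasure G A)"

lemma space_clutter_mixture [simp]: "space (clutter_mixture \<pi> K G) = UNIV"
  by (simp add: clutter_mixture_def)

lemma sets_clutter_mixture [simp, measurable_cong]: "sets (clutter_mixture \<pi> K G) = sets borel"
  using sets.sigma_sets_eq[of borel] by (simp add: clutter_mixture_def)

lemma emeasure_clutter_mixture:
  fixes G :: "'a::euclidean_space measure"
  assumes G: "sets G = sets borel" and A: "A \<in> sets borel"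
  shows "emeasure (clutter_mixture \<pi> K G) A =
    ennreal (1 - \<pi>) * emeasure (uniform_measure lborel K) A + ennreal \<pi> * emeasure G A"
proof (rule emeasure_measure_of[OF clutter_mixture_def])
  show "A \<in> sets (clutter_mixture \<pi> K G)" using A by simp
  let ?f = "\<lambda>A. ennreal (1 - \<pi>) * emeasure (uniform_measure lborel K) A + ennreal \<pi> * emeasure G A"
  show "positive (sets (clutter_mixture \<pi> K G)) ?f" by (simp add: positive_def)
  show "countably_additive (sets (clutter_mixture \<pi> K G)) ?f"
  proof (rule countably_additiveI)
    fix F :: "nat \<Rightarrow> 'a set"
    assume F: "range F \<subseteq> sets (clutter_mixture \<pi> K G)" "disjoint_family F"
    have U: "(\<Sum>i. emeasure (uniform_measure lborel K) (F i)) = emeasure (uniform_measure lborel K) (\<Union>i. F i)"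
      and S: "(\<Sum>i. emeasure G (F i)) = emeasure G (\<Union>i. F i)"
      using F G by (auto intro!: suminf_emeasure)
    have "(\<Sum>i. ?f (F i)) = (\<Sum>i. ennreal (1 - \<pi>) * emeasure (uniform_measure lborel K) (F i))
        + (\<Sum>i. ennreal \<pi> * emeasure G (F i))"
      by (rule suminf_add[symmetric]) (rule summableI)+
    then show "(\<Sum>i. ?f (F i)) = ?f (\<Union>i. F i)"
      by (simp only: ennreal_suminf_cmult U S)
  qed
qed simp

text \<open>Every law of the model is paired with the manifold supporting its signal component.\<close>

definition clutter_model ::
    "nat \<Rightarrow> real \<Rightarrow> 'a::euclidean_space set \<Rightarrow> real \<Rightarrow> real \<Rightarrow> real \<Rightarrow> ('a set \<times> 'a measure) set"
  where "clutter_model d \<kappa> K b B \<pi> =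
    {(M, clutter_mixture \<pi> K G) |M G. M \<in> manifolds_in d \<kappa> K \<and> G \<in> manifold_distributions d b B M}"

text \<open>An estimator is an arbitrary set-valued function of the sample, subject only to
  measurability of its loss, which makes the expectation in the risk meaningful.\<close>

definition estimators ::
    "nat \<Rightarrow> real \<Rightarrow> 'a::euclidean_space set \<Rightarrow> nat \<Rightarrow> ((nat \<Rightarrow> 'a) \<Rightarrow> 'a set) set"
  where "estimators d \<kappa> K n =
    {Mh. \<forall>M\<in>manifolds_in d \<kappa> K.
       (\<lambda>y. hausdorff_distance (Mh y) M) \<in> borel_measurable (Pi\<^sub>M {..<n} (\<lambda>_. borel))}"

definition risk :: "nat \<Rightarrow> ((nat \<Rightarrow> 'a) \<Rightarrow> 'a set) \<Rightarrow> 'a::euclidean_space set \<Rightarrow> 'a measure \<Rightarrow> ennreal"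
  where "risk n Mh M Q = (\<integral>\<^sup>+ y. hausdorff_distance (Mh y) M \<partial>(Pi\<^sub>M {..<n} (\<lambda>_. Q)))"

end

theory Submission
  imports Defs
begin

text \<open>Le Cam's two-point method. Let \<open>p\<close> be a point of \<open>M\<close> in the interior of \<open>K\<close> which is the
  projection of a point off \<open>M\<close>, and let \<open>e\<close> be the direction pointing away from that point. The
  ambient diffeomorphism \<open>x \<mapsto> x + h x e\<close>, with a bump \<open>h\<close> of width \<open>\<delta>\<close> and height of order
  \<open>\<delta>\<^sup>2\<close> at \<open>p\<close>, moves \<open>M\<close> away from \<open>p\<close> by a multiple of \<open>\<delta>\<^sup>2\<close>. It is close to the identity in
  \<open>C\<^sup>2\<close>, uniformly in \<open>\<delta>\<close>, if the constant in the height is small. By Federer's characterisation of the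
  reach by proximal normals it therefore costs only a little reach, and \<open>\<kappa> < reach M\<close> leaves room for
  that. The uniform laws on the two manifolds agree up to mass of order \<open>\<delta>\<^sup>d\<close>, so with
  \<open>\<delta>\<close> of order \<open>n\<close> to the power \<open>-1/d\<close> the two product measures share mass at least
  \<open>1/2\<close>.\<close>

section \<open>Calculus of continuously differentiable functions\<close>

text \<open>The perturbation acts on the ambient space instead of on graphs over tangent spaces: an
  ambient diffeomorphism composes with slice charts, and the reach estimate asks of it only a small
  gradient and a quadratic Taylor remainder. The remainder also fixes the rate. Second derivatives
  below a constant on a ball of radius \<open>\<delta>\<close> force a height of order
  \<open>\<delta>\<^sup>2\<close>, whence the exponent 2/d. The direction of motion has to be a
  proximal normal, for otherwise another piece of the moved manifold could slide back over
  \<open>p\<close>. Such normals exist because \<open>M\<close> has no interior. No area formula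
  enters. Masses are compared by subadditivity and Lipschitz maps, so the image of the small piece
  of \<open>M\<close> is only known to have at most 2^d times the mass bound of that piece. This
  suffices, since it is again of order \<open>\<delta> ^ d\<close>. Instead of total variation, a
  common minorant \<open>N\<close> of the two laws is used: \<open>N \<le> Q\<close> passes to
  products by Fubini, and both losses can then be integrated against one and the same
  measure.\<close>

lemma has_derivative_imp_frechet:
  "(f has_derivative f') (at x) \<Longrightarrow> frechet_derivative f (at x) = f'"
  by (rule frechet_derivative_at[symmetric])

lemma ck_on_Suc_derivative:
  assumes "ck_on (Suc k) f S" "x \<in> S"
  shows "(f has_derivative frechet_derivative f (at x)) (at x)"
  using assms frechet_derivative_works[of f "at x"] by simp

lemma ck_on_cong:
  assumes "open S" "\<And>x. x \<in> S \<Longrightarrow> f x = g x" "ck_on k f S"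
  shows "ck_on k g S"
  using assms(2,3)
proof (induction k arbitrary: f g)
  case 0
  then show ?case using continuous_on_cong[of S S f g] by simp
next
  case (Suc k)
  have D: "(g has_derivative frechet_derivative f (at x)) (at x)" if "x \<in> S" for x
    by (rule has_derivative_transform_within_open[OF ck_on_Suc_derivative[OF Suc.prems(2) that]
          assms(1) that Suc.prems(1)])
  show ?case
    unfolding ck_on.simps
  proof (intro conjI ballI allI)
    fix x assume "x \<in> S"
    then show "g differentiable at x" using D differentiableI by blast
  next
    fix v
    show "ck_on k (\<lambda>x. frechet_derivative g (at x) v) S"
      by (rule Suc.IH[of "\<lambda>x. frechet_derivative f (at x) v"])
         (use Suc.prems has_derivative_imp_frechet[OF D] in \<open>auto\<close>)
  qed
qed

text \<open>Replaces \<open>frechet_derivative\<close> by any explicit derivative formula; the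
  inductive closure proofs below go through it.\<close>

lemma ck_on_SucI:
  assumes "open S" "\<And>x. x \<in> S \<Longrightarrow> (f has_derivative f' x) (at x)" "\<And>v. ck_on k (\<lambda>x. f' x v) S"
  shows "ck_on (Suc k) f S"
  unfolding ck_on.simps
proof (intro conjI ballI allI)
  fix x assume "x \<in> S"
  then show "f differentiable at x" using assms(2) differentiableI by blast
next
  fix v
  show "ck_on k (\<lambda>x. frechet_derivative f (at x) v) S"
    by (rule ck_on_cong[OF assms(1) _ assms(3)[of v]])
       (use fun_cong[OF has_derivative_imp_frechet[OF assms(2)]] in \<open>blast intro: sym\<close>)
qed

lemma ck_on_SucD: "ck_on (Suc k) f S \<Longrightarrow> ck_on k f S"
proof (induction k arbitrary: f)
  case 0
  then show ?case
    by (simp add: continuous_at_imp_continuous_on differentiable_imp_continuous_within)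
next
  case (Suc k)
  have "ck_on (Suc k) (\<lambda>x. frechet_derivative f (at x) v) S" for v
    using Suc.prems unfolding ck_on.simps(2)[of "Suc k" f] by blast
  then have "ck_on k (\<lambda>x. frechet_derivative f (at x) v) S" for v
    by (rule Suc.IH)
  moreover have "\<forall>x\<in>S. f differentiable (at x)"
    using Suc.prems unfolding ck_on.simps(2)[of "Suc k" f] by blast
  ultimately show ?case by simp
qed

lemma ck_on_subset: "ck_on k f S \<Longrightarrow> T \<subseteq> S \<Longrightarrow> ck_on k f T"
proof (induction k arbitrary: f)
  case 0
  then show ?case by (auto intro: continuous_on_subset)
next
  case (Suc k)
  then show ?case by auto
qed

lemma ck_on_const: "open S \<Longrightarrow> ck_on k (\<lambda>x. c) S"
proof (induction k arbitrary: c)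
  case (Suc k)
  show ?case
    by (rule ck_on_SucI[where f' = "\<lambda>x v. 0"]) (use Suc in auto)
qed simp

lemma ck_on_bounded_linear:
  assumes L: "bounded_linear L" and S: "open S"
  shows "ck_on k f S \<Longrightarrow> ck_on k (\<lambda>x. L (f x)) S"
proof (induction k arbitrary: f)
  case 0
  then show ?case using L by (auto intro: bounded_linear.continuous_on)
next
  case (Suc k)
  show ?case
  proof (rule ck_on_SucI[OF S])
    fix x assume "x \<in> S"
    then show "((\<lambda>x. L (f x)) has_derivative (\<lambda>v. L (frechet_derivative f (at x) v))) (at x)"
      using Suc.prems by (intro bounded_linear.has_derivative[OF L] ck_on_Suc_derivative)
  next
    fix v
    show "ck_on k (\<lambda>x. L (frechet_derivative f (at x) v)) S"
      using Suc by auto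
  qed
qed

lemma ck_on_ident: "open S \<Longrightarrow> ck_on k (\<lambda>x. x) S"
  by (cases k) (auto intro!: ck_on_SucI[where f' = "\<lambda>x v. v"] ck_on_const)

lemma ck_on_add:
  assumes S: "open S"
  shows "ck_on k f S \<Longrightarrow> ck_on k g S \<Longrightarrow> ck_on k (\<lambda>x. f x + g x) S"
proof (induction k arbitrary: f g)
  case 0
  then show ?case by (auto intro: continuous_intros)
next
  case (Suc k)
  show ?case
  proof (rule ck_on_SucI[OF S])
    fix x assume "x \<in> S"
    then show "((\<lambda>x. f x + g x) has_derivative
        (\<lambda>v. frechet_derivative f (at x) v + frechet_derivative g (at x) v)) (at x)"
      using Suc.prems by (intro has_derivative_add ck_on_Suc_derivative)
  next
    fix v
    show "ck_on k (\<lambda>x. frechet_derivative f (at x) v + frechet_derivative g (at x) v) S"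
      using Suc by auto
  qed
qed

lemma ck_on_sum:
  assumes S: "open S" and "finite I" "\<And>i. i \<in> I \<Longrightarrow> ck_on k (f i) S"
  shows "ck_on k (\<lambda>x. \<Sum>i\<in>I. f i x) S"
  using assms(2,3)
  by (induction I rule: finite_induct) (auto intro: ck_on_const ck_on_add S)

lemma ck_on_scaleR:
  assumes S: "open S"
  shows "ck_on k f S \<Longrightarrow> ck_on k g S \<Longrightarrow> ck_on k (\<lambda>x. f x *\<^sub>R g x) S"
proof (induction k arbitrary: f g)
  case 0
  then show ?case by (auto intro: continuous_intros)
next
  case (Suc k)
  show ?case
  proof (rule ck_on_SucI[OF S])
    fix x assume "x \<in> S"
    then show "((\<lambda>x. f x *\<^sub>R g x) has_derivative
        (\<lambda>v. f x *\<^sub>R frechet_derivative g (at x) v + frechet_derivative f (at x) v *\<^sub>R g x)) (at x)"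
      using Suc.prems by (intro has_derivative_scaleR ck_on_Suc_derivative)
  next
    fix v
    have "ck_on k f S" "ck_on k g S" using Suc.prems by (blast dest: ck_on_SucD)+
    then show "ck_on k (\<lambda>x. f x *\<^sub>R frechet_derivative g (at x) v
        + frechet_derivative f (at x) v *\<^sub>R g x) S"
      using Suc.prems by (intro ck_on_add S Suc.IH) auto
  qed
qed

lemma ck_on_compose:
  fixes g :: "'a::real_normed_vector \<Rightarrow> 'b::euclidean_space" and f :: "'b \<Rightarrow> 'c::real_normed_vector"
  assumes S: "open S" and T: "g ` S \<subseteq> T"
  shows "ck_on k f T \<Longrightarrow> ck_on k g S \<Longrightarrow> ck_on k (\<lambda>x. f (g x)) S"
proof (induction k arbitrary: f)
  case 0
  then show ?case using T by (auto intro: continuous_on_compose2)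
next
  case (Suc k)
  let ?F = "\<lambda>x. frechet_derivative f (at x)" and ?G = "\<lambda>x. frechet_derivative g (at x)"
  show ?case
  proof (rule ck_on_SucI[OF S])
    fix x assume x: "x \<in> S"
    have f: "(f has_derivative ?F (g x)) (at (g x))"
      using Suc.prems T x by (intro ck_on_Suc_derivative) auto
    have g: "(g has_derivative ?G x) (at x)"
      using Suc.prems x by (intro ck_on_Suc_derivative) auto
    have lin: "linear (?F (g x))" using f has_derivative_linear by blast
    \<comment> \<open>The chain rule differentiates \<open>f\<close> in the direction
      \<open>?G x v\<close>, which varies with \<open>x\<close>, whereas \<open>ck_on\<close> speaks
      of fixed directions. Expanding over \<open>Basis\<close> leaves fixed directions with scalar
      coefficients, to which sums and products of order \<open>k\<close> apply.\<close>
    have "?F (g x) (?G x v) = (\<Sum>b\<in>Basis. (?G x v \<bullet> b) *\<^sub>R ?F (g x) b)" for v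
    proof -
      have "?F (g x) (?G x v) = ?F (g x) (\<Sum>b\<in>Basis. (?G x v \<bullet> b) *\<^sub>R b)"
        by (simp add: euclidean_representation)
      also have "\<dots> = (\<Sum>b\<in>Basis. (?G x v \<bullet> b) *\<^sub>R ?F (g x) b)"
        using lin by (simp add: linear_sum linear_scale)
      finally show ?thesis .
    qed
    then show "((\<lambda>x. f (g x)) has_derivative
        (\<lambda>v. \<Sum>b\<in>Basis. (?G x v \<bullet> b) *\<^sub>R ?F (g x) b)) (at x)"
      using has_derivative_compose[OF g f] by simp
  next
    fix v
    have g: "ck_on k g S" using Suc.prems by (blast dest: ck_on_SucD)
    show "ck_on k (\<lambda>x. \<Sum>b\<in>Basis. (?G x v \<bullet> b) *\<^sub>R ?F (g x) b) S"
    proof (intro ck_on_sum S finite_Basis ck_on_scaleR)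
      fix b :: 'b
      show "ck_on k (\<lambda>x. ?G x v \<bullet> b) S"
        by (rule ck_on_bounded_linear[OF bounded_linear_inner_left S]) (use Suc.prems in auto)
      show "ck_on k (\<lambda>x. ?F (g x) b) S"
        using Suc.IH[of "\<lambda>y. ?F y b"] Suc.prems(1) g by auto
    qed
  qed
qed

lemma ck_on_inverse: "ck_on k (inverse :: real \<Rightarrow> real) (- {0})"
proof (induction k)
  case 0
  then show ?case by (auto intro: continuous_intros)
next
  case (Suc k)
  show ?case
  proof (rule ck_on_SucI)
    fix x :: real assume "x \<in> - {0}"
    then show "(inverse has_derivative (\<lambda>v. - (inverse x * v * inverse x))) (at x)"
      by (intro has_derivative_inverse') auto
  next
    fix v :: real
    have "ck_on k (\<lambda>x::real. inverse x *\<^sub>R (inverse x *\<^sub>R (- v))) (- {0})"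
      by (intro ck_on_scaleR Suc ck_on_const) auto
    then show "ck_on k (\<lambda>x. - (inverse x * v * inverse x)) (- {0::real})"
      by (simp add: mult_ac)
  qed auto
qed

text \<open>\<open>ck_on\<close> gives continuity one direction at a time; by linearity the finitely
  many basis directions control every \<open>v\<close>. The summand 1 in \<open>L\<close> makes the
  constant positive.\<close>

lemma ck_on_derivative_bounded:
  fixes f :: "'a::euclidean_space \<Rightarrow> 'b::real_normed_vector"
  assumes f: "ck_on (Suc 0) f S" and C: "compact C" "C \<subseteq> S"
  shows "\<exists>L>0. \<forall>x\<in>C. \<forall>v. norm (frechet_derivative f (at x) v) \<le> L * norm v"
proof -
  let ?F = "\<lambda>x. frechet_derivative f (at x)"
  have "\<exists>B. \<forall>x\<in>C. norm (?F x b) \<le> B" for b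
  proof -
    have "continuous_on C (\<lambda>x. ?F x b)"
      using f C by (auto intro: continuous_on_subset)
    then have "bounded ((\<lambda>x. ?F x b) ` C)"
      by (intro compact_imp_bounded compact_continuous_image C)
    then show ?thesis by (auto simp: bounded_iff)
  qed
  then obtain B where B: "\<And>b x. x \<in> C \<Longrightarrow> norm (?F x b) \<le> B b" by metis
  define L where "L = (\<Sum>b\<in>(Basis::'a set). \<bar>B b\<bar>) + 1"
  have "norm (?F x v) \<le> L * norm v" if x: "x \<in> C" for x v
  proof -
    have lin: "linear (?F x)"
      using ck_on_Suc_derivative[OF f, of x] C x has_derivative_linear by blast
    have "?F x v = ?F x (\<Sum>b\<in>Basis. (v \<bullet> b) *\<^sub>R b)" by (simp add: euclidean_representation)
    also have "\<dots> = (\<Sum>b\<in>Basis. (v \<bullet> b) *\<^sub>R ?F x b)"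
      using lin by (simp add: linear_sum linear_scale)
    also have "norm \<dots> \<le> (\<Sum>b\<in>Basis. norm v * \<bar>B b\<bar>)"
    proof (rule sum_norm_le)
      fix b :: 'a assume b: "b \<in> Basis"
      have "norm ((v \<bullet> b) *\<^sub>R ?F x b) = \<bar>v \<bullet> b\<bar> * norm (?F x b)" by simp
      also have "\<dots> \<le> norm v * \<bar>B b\<bar>"
        using B[OF x, of b] b by (intro mult_mono Basis_le_norm) auto
      finally show "norm ((v \<bullet> b) *\<^sub>R ?F x b) \<le> norm v * \<bar>B b\<bar>" .
    qed
    also have "\<dots> = (\<Sum>b\<in>(Basis::'a set). \<bar>B b\<bar>) * norm v" by (simp add: sum_distrib_left mult.commute)
    also have "\<dots> \<le> L * norm v" unfolding L_def by (intro mult_right_mono) auto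
    finally show ?thesis .
  qed
  moreover have "L > 0" unfolding L_def by (smt (verit) sum_nonneg abs_ge_zero)
  ultimately show ?thesis by blast
qed

section \<open>The flat exponential and the bump function\<close>

definition exp_flat :: "real poly \<Rightarrow> real \<Rightarrow> real"
  where "exp_flat p s = (if 0 < s then poly p (1 / s) * exp (- (1 / s)) else 0)"

lemma poly_exp_tendsto_0: "((\<lambda>x::real. poly p x * exp (- x)) \<longlongrightarrow> 0) at_top"
proof -
  have "((\<lambda>x. \<Sum>i\<le>degree p. coeff p i * (x ^ i / exp x)) \<longlongrightarrow> (\<Sum>i\<le>degree p. coeff p i * 0)) at_top"
    by (intro tendsto_sum tendsto_mult tendsto_const tendsto_power_div_exp_0)
  then show ?thesis
    by (simp add: poly_altdef sum_distrib_right exp_minus divide_inverse mult.assoc)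
qed

text \<open>Differentiating p(1/s) exp(-1/s) gives q(1/s) exp(-1/s) with q = X^2 (p - p'). Allowing
  all polynomials closes the family under differentiation, so one induction yields smoothness of
  every order.\<close>

lemma exp_flat_has_derivative:
  "(exp_flat p has_real_derivative exp_flat ([:0, 0, 1:] * (p - pderiv p)) s) (at s)"
proof (cases s "0::real" rule: linorder_cases)
  case less
  have "((\<lambda>_. 0) has_real_derivative exp_flat ([:0, 0, 1:] * (p - pderiv p)) s) (at s)"
    using less by (simp add: exp_flat_def)
  then show ?thesis
    by (rule DERIV_cong_ev[THEN iffD1, rotated -1])
       (use less in \<open>auto simp: exp_flat_def eventually_nhds intro!: exI[of _ "{..<0}"]\<close>)
next
  case greater
  have "((\<lambda>s. poly p (1 / s) * exp (- (1 / s))) has_real_derivative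
      exp_flat ([:0, 0, 1:] * (p - pderiv p)) s) (at s)"
    using greater
    by (auto intro!: derivative_eq_intros poly_DERIV[THEN DERIV_chain2]
        simp: exp_flat_def field_simps power2_eq_square)
  then show ?thesis
    by (rule DERIV_cong_ev[THEN iffD1, rotated -1])
       (use greater in \<open>auto simp: exp_flat_def eventually_nhds intro!: exI[of _ "{0<..}"]\<close>)
next
  case equal
  \<comment> \<open>Dividing by \<open>h\<close> multiplies p(1/h) by 1/h, that is, replaces
    \<open>p\<close> by \<open>pCons 0 p\<close>; the exponential still wins.\<close>
  have "((\<lambda>h. exp_flat p h / h) \<longlongrightarrow> 0) (at_right 0)"
  proof (rule Lim_transform_eventually)
    show "((\<lambda>h. poly (pCons 0 p) (1 / h) * exp (- (1 / h))) \<longlongrightarrow> 0) (at_right (0::real))"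
      by (rule filterlim_compose[OF poly_exp_tendsto_0])
         (simp add: filterlim_inverse_at_top_right flip: inverse_eq_divide)
    show "\<forall>\<^sub>F h in at_right 0. poly (pCons 0 p) (1 / h) * exp (- (1 / h)) = exp_flat p h / h"
      by (auto simp: eventually_at_filter exp_flat_def)
  qed
  moreover have "((\<lambda>h. exp_flat p h / h) \<longlongrightarrow> 0) (at_left 0)"
    by (rule Lim_transform_eventually[OF tendsto_const])
       (auto simp: eventually_at_filter exp_flat_def)
  ultimately have "((\<lambda>h. exp_flat p h / h) \<longlongrightarrow> 0) (at 0)"
    by (simp add: filterlim_at_split)
  then show ?thesis
    by (simp add: equal DERIV_def exp_flat_def)
qed

lemma ck_on_exp_flat: "ck_on k (exp_flat p) UNIV"
proof (induction k arbitrary: p)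
  case 0
  then show ?case
    using exp_flat_has_derivative by (auto intro!: DERIV_continuous_on)
next
  case (Suc k)
  show ?case
  proof (rule ck_on_SucI)
    show "(exp_flat p has_derivative (\<lambda>v. v *\<^sub>R exp_flat ([:0, 0, 1:] * (p - pderiv p)) x)) (at x)" for x
      using exp_flat_has_derivative[of p x] by (simp add: has_field_derivative_def mult_commute_abs)
    show "ck_on k (\<lambda>x. v *\<^sub>R exp_flat ([:0, 0, 1:] * (p - pderiv p)) x) UNIV" for v
      by (intro ck_on_scaleR ck_on_const Suc) auto
  qed auto
qed

text \<open>The standard mollifier exp(-1/(1 - |x|^2)) on the unit ball. The squared norm is smooth
  at the origin as well.\<close>

definition bump :: "'a::euclidean_space \<Rightarrow> real"
  where "bump x = exp_flat 1 (1 - x \<bullet> x)"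

lemma bump_0: "bump 0 > 0" and bump_nonneg: "bump x \<ge> 0"
  by (auto simp: bump_def exp_flat_def)

lemma bump_le: "bump x \<le> bump 0"
proof (cases "x \<bullet> x < 1")
  case True
  then have "1 \<le> 1 / (1 - x \<bullet> x)" by (simp add: field_simps)
  then show ?thesis using True by (simp add: bump_def exp_flat_def)
qed (simp add: bump_def exp_flat_def)

lemma bump_eq_0: "1 \<le> norm x \<Longrightarrow> bump x = 0"
  using one_le_power[of "norm x" 2]
  by (simp add: bump_def exp_flat_def power2_norm_eq_inner)

lemma ck_on_bump: "ck_on k (bump :: 'a::euclidean_space \<Rightarrow> real) UNIV"
proof -
  have sq: "(\<Sum>b\<in>Basis. (x \<bullet> b) *\<^sub>R (x \<bullet> b)) = x \<bullet> x" for x :: 'a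
    by (subst (3) euclidean_inner) simp
  have "ck_on k (\<lambda>x::'a. \<Sum>b\<in>Basis. (x \<bullet> b) *\<^sub>R (x \<bullet> b)) UNIV"
    by (intro ck_on_sum ck_on_scaleR ck_on_bounded_linear[OF bounded_linear_inner_left] ck_on_ident) auto
  then have "ck_on k (\<lambda>x::'a. x \<bullet> x) UNIV" by (simp only: sq)
  then have "ck_on k (\<lambda>x::'a. 1 + (-1) *\<^sub>R (x \<bullet> x)) UNIV"
    by (intro ck_on_add ck_on_const ck_on_scaleR) auto
  then have "ck_on k (\<lambda>x::'a. exp_flat 1 (1 + (-1) *\<^sub>R (x \<bullet> x))) UNIV"
    by (rule ck_on_compose[where T = UNIV and f = "exp_flat 1" and k = k, rotated -1])
       (auto intro: ck_on_exp_flat)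
  then show ?thesis by (simp add: bump_def[abs_def])
qed


section \<open>Smooth perturbations of the identity\<close>

lemma frechet_derivative_0_outside:
  fixes f :: "'a::euclidean_space \<Rightarrow> real"
  assumes "\<And>x. 1 < norm x \<Longrightarrow> f x = 0" "1 < norm x"
  shows "frechet_derivative f (at x) v = 0"
proof -
  have "(f has_derivative (\<lambda>v. 0)) (at x)"
    by (rule has_derivative_transform_within_open[of "\<lambda>x. 0" _ _ _ "- cball 0 1"])
       (use assms in auto)
  then show ?thesis by (simp add: has_derivative_imp_frechet)
qed

text \<open>The derivative is bounded on the closed unit ball by compactness and vanishes outside;
  the mean value inequality on the whole space does the rest.\<close>

lemma ck_on_compact_support_lipschitz:
  fixes f :: "'a::euclidean_space \<Rightarrow> real"
  assumes f: "ck_on (Suc 0) f UNIV" and supp: "\<And>x. 1 < norm x \<Longrightarrow> f x = 0"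
  obtains L where "0 < L" "\<And>x v. \<bar>frechet_derivative f (at x) v\<bar> \<le> L * norm v"
    "\<And>x y. \<bar>f y - f x\<bar> \<le> L * norm (y - x)"
proof -
  obtain L where L: "0 < L" "\<And>x v. x \<in> cball 0 1 \<Longrightarrow> norm (frechet_derivative f (at x) v) \<le> L * norm v"
    using ck_on_derivative_bounded[OF f, of "cball 0 1"] by auto
  have bound: "\<bar>frechet_derivative f (at x) v\<bar> \<le> L * norm v" for x v
  proof (cases "x \<in> cball 0 1")
    case False
    then have "frechet_derivative f (at x) v = 0"
      by (intro frechet_derivative_0_outside supp) auto
    then show ?thesis using L(1) by simp
  qed (use L(2) in simp)
  have "\<bar>f y - f x\<bar> \<le> L * norm (y - x)" for x y
  proof -
    have "onorm (frechet_derivative f (at x)) \<le> L" for x using bound by (intro onorm_le) auto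
    then show ?thesis
      using differentiable_bound[of UNIV f "\<lambda>x. frechet_derivative f (at x)" L y x]
        ck_on_Suc_derivative[OF f] by simp
  qed
  with L(1) bound that show ?thesis by blast
qed

text \<open>Each \<open>frechet_derivative f (at x) b\<close> is, as a function of \<open>x\<close>,
  again C^1 and supported in the unit ball, so the preceding lemma makes it Lipschitz. A Lipschitz
  derivative gives the quadratic remainder, and one \<open>P\<close> serves all three
  bounds.\<close>

lemma compact_support_taylor:
  fixes f :: "'a::euclidean_space \<Rightarrow> real"
  assumes f: "ck_on (Suc (Suc 0)) f UNIV" and supp: "\<And>x. 1 < norm x \<Longrightarrow> f x = 0"
  obtains P where "0 < P" "\<And>x v. \<bar>frechet_derivative f (at x) v\<bar> \<le> P * norm v"
    "\<And>x y. \<bar>f y - f x\<bar> \<le> P * norm (y - x)"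
    "\<And>x y. \<bar>f y - f x - frechet_derivative f (at x) (y - x)\<bar> \<le> P * (norm (y - x))\<^sup>2"
proof -
  let ?F = "\<lambda>x. frechet_derivative f (at x)"
  obtain L where L: "0 < L" "\<And>x v. \<bar>?F x v\<bar> \<le> L * norm v" "\<And>x y. \<bar>f y - f x\<bar> \<le> L * norm (y - x)"
    using ck_on_compact_support_lipschitz[OF ck_on_SucD[OF f] supp] by blast
  have "\<exists>B>0. \<forall>x y. \<bar>?F y b - ?F x b\<bar> \<le> B * norm (y - x)" for b
  proof -
    have "ck_on (Suc 0) (\<lambda>x. ?F x b) UNIV" using f unfolding ck_on.simps(2)[of "Suc 0"] by blast
    then obtain B where "0 < B" "\<And>x y. \<bar>?F y b - ?F x b\<bar> \<le> B * norm (y - x)"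
      by (rule ck_on_compact_support_lipschitz) (auto intro: frechet_derivative_0_outside[OF supp])
    then show ?thesis by blast
  qed
  then obtain B where B: "\<And>b. 0 < B b" "\<And>b x y. \<bar>?F y b - ?F x b\<bar> \<le> B b * norm (y - x)"
    by metis
  have der: "(f has_derivative ?F x) (at x)" for x
    by (rule ck_on_Suc_derivative[OF f]) simp
  define Q where "Q = (\<Sum>b\<in>(Basis::'a set). B b)"
  have Q: "0 \<le> Q" unfolding Q_def using B(1) by (intro sum_nonneg) (auto intro: less_imp_le)
  have F_lip: "\<bar>?F y v - ?F x v\<bar> \<le> Q * norm (y - x) * norm v" for x y v
  proof -
    have rep: "?F x v = (\<Sum>b\<in>Basis. (v \<bullet> b) *\<^sub>R ?F x b)" for x
    proof -
      have "linear (?F x)" using der has_derivative_linear by blast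
      then have "?F x (\<Sum>b\<in>Basis. (v \<bullet> b) *\<^sub>R b) = (\<Sum>b\<in>Basis. (v \<bullet> b) *\<^sub>R ?F x b)"
        by (simp add: linear_sum linear_scale)
      then show ?thesis by (simp add: euclidean_representation)
    qed
    have "\<bar>?F y v - ?F x v\<bar> = \<bar>\<Sum>b\<in>Basis. (v \<bullet> b) * (?F y b - ?F x b)\<bar>"
      unfolding rep[of x] rep[of y] by (simp add: sum_subtractf right_diff_distrib)
    also have "\<dots> \<le> (\<Sum>b\<in>Basis. \<bar>v \<bullet> b\<bar> * \<bar>?F y b - ?F x b\<bar>)"
      by (rule order_trans[OF sum_abs]) (simp add: abs_mult)
    also have "\<dots> \<le> (\<Sum>b\<in>Basis. norm v * (B b * norm (y - x)))"
      by (intro sum_mono mult_mono B(2) Basis_le_norm) auto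
    also have "\<dots> = Q * norm (y - x) * norm v"
      by (simp add: Q_def sum_distrib_left sum_distrib_right mult_ac)
    finally show ?thesis .
  qed
  have taylor: "\<bar>f y - f x - ?F x (y - x)\<bar> \<le> Q * (norm (y - x))\<^sup>2" for x y
  proof -
    have "norm (f y - f x - ?F x (y - x)) \<le> norm (y - x) * (Q * norm (y - x))"
    proof (rule differentiable_bound_linearization[where S = "cball x (norm (y - x))"])
      fix t :: real assume "t \<in> {0..1}"
      then show "x + t *\<^sub>R (y - x) \<in> cball x (norm (y - x))"
        by (auto simp: dist_norm mult_left_le_one_le)
    next
      fix z assume z: "z \<in> cball x (norm (y - x))"
      show "onorm (?F z - ?F x) \<le> Q * norm (y - x)"
      proof (rule onorm_le)
        fix v :: 'a
        have "Q * norm (z - x) * norm v \<le> Q * norm (y - x) * norm v"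
          using z Q by (intro mult_right_mono mult_left_mono) (auto simp: dist_norm norm_minus_commute)
        then show "norm ((?F z - ?F x) v) \<le> Q * norm (y - x) * norm v"
          using F_lip[of z v x] by simp
      qed
      show "(f has_derivative ?F z) (at z within cball x (norm (y - x)))"
        by (rule has_derivative_at_withinI[OF der])
    qed auto
    then show ?thesis by (simp add: power2_eq_square mult_ac)
  qed
  show ?thesis
  proof (rule that[of "max L Q"])
    show "0 < max L Q" using L(1) by simp
    show "\<bar>?F x v\<bar> \<le> max L Q * norm v" for x v
      using L(2)[of x v] by (rule order_trans) (intro mult_right_mono, auto)
    show "\<bar>f y - f x\<bar> \<le> max L Q * norm (y - x)" for x y
      using L(3)[of y x] by (rule order_trans) (intro mult_right_mono, auto)
    show "\<bar>f y - f x - ?F x (y - x)\<bar> \<le> max L Q * (norm (y - x))\<^sup>2" for x y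
      using taylor[of y x] by (rule order_trans) (intro mult_right_mono, auto)
  qed
qed

definition scaled_bump :: "real \<Rightarrow> real \<Rightarrow> 'a::euclidean_space \<Rightarrow> 'a \<Rightarrow> real"
  where "scaled_bump c \<delta> p x = c * \<delta>\<^sup>2 * bump ((1 / \<delta>) *\<^sub>R (x - p))"

lemma ck_on_scaled_bump: "ck_on k (scaled_bump c \<delta> p) UNIV"
proof -
  have "ck_on k (\<lambda>x. (1 / \<delta>) *\<^sub>R (x + (- p))) UNIV"
    by (intro ck_on_scaleR ck_on_add ck_on_const ck_on_ident) auto
  then have "ck_on k (\<lambda>x. bump ((1 / \<delta>) *\<^sub>R (x + (- p)))) UNIV"
    by (rule ck_on_compose[where T = UNIV and f = bump and k = k, rotated -1])
       (auto intro: ck_on_bump)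
  then have "ck_on k (\<lambda>x. (c * \<delta>\<^sup>2) *\<^sub>R bump ((1 / \<delta>) *\<^sub>R (x + (- p)))) UNIV"
    by (intro ck_on_scaleR ck_on_const) auto
  then show ?thesis by (simp add: scaled_bump_def[abs_def])
qed

lemma scaled_bump_eq_0: "0 < \<delta> \<Longrightarrow> \<delta> \<le> dist x p \<Longrightarrow> scaled_bump c \<delta> p x = 0"
  by (simp add: scaled_bump_def bump_eq_0 dist_norm)

lemma scaled_bump_nonneg: "0 \<le> c \<Longrightarrow> 0 \<le> scaled_bump c \<delta> p x"
  by (simp add: scaled_bump_def bump_nonneg)

lemma scaled_bump_le:
  fixes p :: "'a::euclidean_space"
  shows "0 \<le> c \<Longrightarrow> scaled_bump c \<delta> p x \<le> c * \<delta>\<^sup>2 * bump (0 :: 'a)"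
  unfolding scaled_bump_def by (intro mult_left_mono bump_le) auto

lemma scaled_bump_center:
  fixes p :: "'a::euclidean_space"
  shows "scaled_bump c \<delta> p p = c * \<delta>\<^sup>2 * bump (0 :: 'a)"
  by (simp add: scaled_bump_def)

text \<open>Smallness of \<open>h\<close> in C^{1,1}, in the form in which the reach estimate
  consumes it. First and second order bounds scale differently under dilation; a single \<epsilon>
  can serve both because only widths up to 1 occur.\<close>

definition gradient_bound :: "real \<Rightarrow> ('a::euclidean_space \<Rightarrow> real) \<Rightarrow> ('a \<Rightarrow> 'a) \<Rightarrow> bool"
  where "gradient_bound \<epsilon> h G \<longleftrightarrow> (\<forall>x. (h has_derivative (\<lambda>v. G x \<bullet> v)) (at x)) \<and>
    (\<forall>x. norm (G x) \<le> \<epsilon>) \<and> (\<forall>x y. \<bar>h y - h x\<bar> \<le> \<epsilon> * norm (y - x)) \<and>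
    (\<forall>x y. \<bar>h y - h x - G x \<bullet> (y - x)\<bar> \<le> \<epsilon> * (norm (y - x))\<^sup>2)"

text \<open>The scaling makes the second derivatives of order \<open>c\<close>, uniformly in the width \<open>\<delta>\<close>.\<close>

lemma scaled_bump_gradient_bound:
  obtains P where "0 < P"
    "\<And>c \<delta> (p::'a::euclidean_space). 0 < c \<Longrightarrow> 0 < \<delta> \<Longrightarrow> \<delta> \<le> 1 \<Longrightarrow>
       \<exists>G. gradient_bound (c * P) (scaled_bump c \<delta> p) G"
proof -
  let ?F = "\<lambda>x::'a. frechet_derivative bump (at x)"
  have supp: "bump x = 0" if "1 < norm x" for x :: 'a using that by (simp add: bump_eq_0)
  obtain P where P: "0 < P" "\<And>x v. \<bar>?F x v\<bar> \<le> P * norm v"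
    "\<And>x y :: 'a. \<bar>bump y - bump x\<bar> \<le> P * norm (y - x)"
    "\<And>x y. \<bar>bump y - bump x - ?F x (y - x)\<bar> \<le> P * (norm (y - x))\<^sup>2"
    using compact_support_taylor[OF ck_on_bump supp] by blast
  have "\<exists>G. gradient_bound (c * P) (scaled_bump c \<delta> p) G"
    if c: "0 < c" and \<delta>: "0 < \<delta>" "\<delta> \<le> 1" for c \<delta> and p :: 'a
  proof -
    define s where "s x = (1 / \<delta>) *\<^sub>R (x - p)" for x
    define G where "G x = (c * \<delta>) *\<^sub>R (\<Sum>b\<in>Basis. ?F (s x) b *\<^sub>R b)" for x
    have derF: "(bump has_derivative ?F x) (at x)" for x :: 'a
      by (rule ck_on_Suc_derivative[OF ck_on_bump[of "Suc 0"]]) simp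
    have linF: "linear (?F x)" for x
      using derF has_derivative_linear by blast
    have G_eq: "G x \<bullet> v = (c * \<delta>) * ?F (s x) v" for x v
    proof -
      have "?F (s x) v = ?F (s x) (\<Sum>b\<in>Basis. (v \<bullet> b) *\<^sub>R b)" by (simp add: euclidean_representation)
      also have "\<dots> = (\<Sum>b\<in>Basis. (v \<bullet> b) * ?F (s x) b)"
        using linF[of "s x"] by (simp add: linear_sum linear_scale)
      finally have *: "?F (s x) v = (\<Sum>b\<in>Basis. (v \<bullet> b) * ?F (s x) b)" .
      show ?thesis
        unfolding * by (simp add: G_def inner_sum_left sum_distrib_left inner_commute[of v] mult_ac)
    qed
    have s_diff: "s y - s x = (1 / \<delta>) *\<^sub>R (y - x)" for x y
      by (simp add: s_def algebra_simps)
    have F_s: "?F (s x) (s y - s x) = (1 / \<delta>) * ?F (s x) (y - x)" for x y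
      unfolding s_diff using linF[of "s x"] by (simp add: linear_scale)
    have h: "scaled_bump c \<delta> p x = c * \<delta>\<^sup>2 * bump (s x)" for x
      by (simp add: scaled_bump_def s_def)
    have 1: "(scaled_bump c \<delta> p has_derivative (\<lambda>v. G x \<bullet> v)) (at x)" for x
    proof -
      have "(s has_derivative (\<lambda>v. (1 / \<delta>) *\<^sub>R v)) (at x)"
        unfolding s_def[abs_def] by (auto intro!: derivative_eq_intros)
      then have "((\<lambda>x. bump (s x)) has_derivative (\<lambda>v. ?F (s x) ((1 / \<delta>) *\<^sub>R v))) (at x)"
        by (rule has_derivative_compose[OF _ derF])
      then have "((\<lambda>x. c * \<delta>\<^sup>2 * bump (s x)) has_derivative
          (\<lambda>v. c * \<delta>\<^sup>2 * ?F (s x) ((1 / \<delta>) *\<^sub>R v))) (at x)"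
        by (rule has_derivative_mult_right)
      moreover have "c * \<delta>\<^sup>2 * ?F (s x) ((1 / \<delta>) *\<^sub>R v) = G x \<bullet> v" for v
        using linF[of "s x"] \<delta> by (simp add: G_eq linear_scale power2_eq_square)
      ultimately show ?thesis by (simp add: h[abs_def])
    qed
    \<comment> \<open>The first order bounds come out with the extra factor \<open>\<delta>\<close>;
      \<open>\<delta> \<le> 1\<close> merges them with the second order constant.\<close>
    have c\<delta>: "c * \<delta> * P \<le> c * P" using c \<delta> P(1) by (simp add: mult_left_le)
    have 2: "norm (G x) \<le> c * P" for x
    proof -
      \<comment> \<open>Testing the gradient against itself turns a bound on directional derivatives
        into one on the norm.\<close>
      have "norm (G x) * norm (G x) = c * \<delta> * ?F (s x) (G x)"
        using G_eq[of x "G x"] by (simp add: power2_norm_eq_inner flip: power2_eq_square)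
      also have "\<dots> \<le> c * \<delta> * (P * norm (G x))"
        using P(2)[of "s x" "G x"] c \<delta> by (intro mult_left_mono) auto
      finally have "norm (G x) * norm (G x) \<le> (c * \<delta> * P) * norm (G x)" by (simp add: mult_ac)
      then have "norm (G x) \<le> c * \<delta> * P"
        using c \<delta> P(1) by (cases "G x = 0") auto
      with c\<delta> show ?thesis by simp
    qed
    have 3: "\<bar>scaled_bump c \<delta> p y - scaled_bump c \<delta> p x\<bar> \<le> c * P * norm (y - x)" for x y
    proof -
      have "\<bar>scaled_bump c \<delta> p y - scaled_bump c \<delta> p x\<bar> = c * \<delta>\<^sup>2 * \<bar>bump (s y) - bump (s x)\<bar>"
        unfolding h using c by (simp add: abs_mult flip: right_diff_distrib)
      also have "\<dots> \<le> c * \<delta>\<^sup>2 * (P * norm (s y - s x))"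
        using P(3) c by (intro mult_left_mono) auto
      also have "\<dots> = (c * \<delta> * P) * norm (y - x)"
        using \<delta> by (simp add: s_diff power2_eq_square)
      also have "\<dots> \<le> c * P * norm (y - x)"
        by (intro mult_right_mono c\<delta>) auto
      finally show ?thesis .
    qed
    have 4: "\<bar>scaled_bump c \<delta> p y - scaled_bump c \<delta> p x - G x \<bullet> (y - x)\<bar> \<le> c * P * (norm (y - x))\<^sup>2" for x y
    proof -
      have "c * \<delta>\<^sup>2 * ?F (s x) (s y - s x) = G x \<bullet> (y - x)"
        unfolding F_s G_eq using \<delta> by (simp add: power2_eq_square)
      then have "scaled_bump c \<delta> p y - scaled_bump c \<delta> p x - G x \<bullet> (y - x) =
          c * \<delta>\<^sup>2 * (bump (s y) - bump (s x) - ?F (s x) (s y - s x))"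
        by (simp add: h right_diff_distrib)
      then have "\<bar>scaled_bump c \<delta> p y - scaled_bump c \<delta> p x - G x \<bullet> (y - x)\<bar> =
          c * \<delta>\<^sup>2 * \<bar>bump (s y) - bump (s x) - ?F (s x) (s y - s x)\<bar>"
        using c by (simp add: abs_mult)
      also have "\<dots> \<le> c * \<delta>\<^sup>2 * (P * (norm (s y - s x))\<^sup>2)"
        using P(4) c by (intro mult_left_mono) auto
      also have "\<dots> = c * P * (norm (y - x))\<^sup>2"
        using \<delta> by (simp add: s_diff power_mult_distrib power_divide)
      finally show ?thesis .
    qed
    show ?thesis using 1 2 3 4 unfolding gradient_bound_def by blast
  qed
  with P(1) that show ?thesis by blast
qed

section \<open>Pushing space along a fixed direction\<close>

definition push :: "('a \<Rightarrow> real) \<Rightarrow> 'a \<Rightarrow> 'a \<Rightarrow> 'a::real_vector"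
  where "push h e x = x + h x *\<^sub>R e"

lemma push_dist:
  assumes G: "gradient_bound \<epsilon> h G" and e: "norm e = 1"
  shows "norm (push h e y - push h e x) \<le> (1 + \<epsilon>) * norm (y - x)"
    and "(1 - \<epsilon>) * norm (y - x) \<le> norm (push h e y - push h e x)"
proof -
  have eq: "push h e y - push h e x = (y - x) + (h y - h x) *\<^sub>R e"
    by (simp add: push_def algebra_simps)
  have "norm ((h y - h x) *\<^sub>R e) \<le> \<epsilon> * norm (y - x)"
    using G e unfolding gradient_bound_def by simp
  then show "norm (push h e y - push h e x) \<le> (1 + \<epsilon>) * norm (y - x)"
    "(1 - \<epsilon>) * norm (y - x) \<le> norm (push h e y - push h e x)"
    unfolding eq using norm_triangle_ineq[of "y - x" "(h y - h x) *\<^sub>R e"]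
      norm_diff_ineq[of "y - x" "(h y - h x) *\<^sub>R e"]
    by (simp_all add: algebra_simps)
qed

text \<open>The inverse derivative is given by the Sherman-Morrison formula, so smoothness of the
  inverse follows by bootstrapping.\<close>

lemma push_diffeomorphism:
  fixes e :: "'a::euclidean_space"
  assumes G: "gradient_bound \<epsilon> h G" and \<epsilon>: "\<epsilon> < 1" and e: "norm e = 1" and h: "smooth_on UNIV h"
  obtains g where "\<And>x. g (push h e x) = x" "\<And>y. push h e (g y) = y"
    "smooth_on UNIV (push h e)" "smooth_on UNIV g"
proof -
  let ?\<Phi> = "push h e"
  have \<epsilon>0: "0 \<le> \<epsilon>" using G norm_ge_zero unfolding gradient_bound_def by (meson order_trans)
  have inj: "inj ?\<Phi>"
  proof (rule injI)
    fix x y assume "?\<Phi> x = ?\<Phi> y"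
    then have "(1 - \<epsilon>) * norm (x - y) \<le> 0" using push_dist(2)[OF G e, of x y] by simp
    then show "x = y" using \<epsilon> by (simp add: mult_le_0_iff)
  qed
  have surj: "\<exists>x. ?\<Phi> x = y" for y
  proof -
    \<comment> \<open>The equation \<open>push h e x = y\<close> is a fixed point equation for a
      contraction with factor \<epsilon>.\<close>
    have "\<exists>!x. y - h x *\<^sub>R e = x"
    proof (rule banach_fix_type[OF \<epsilon>0 \<epsilon>])
      show "\<forall>x z. dist (y - h x *\<^sub>R e) (y - h z *\<^sub>R e) \<le> \<epsilon> * dist x z"
      proof (intro allI)
        fix x z
        have "dist (y - h x *\<^sub>R e) (y - h z *\<^sub>R e) = norm ((h z - h x) *\<^sub>R e)"
          by (simp add: dist_norm algebra_simps)
        also have "\<dots> \<le> \<epsilon> * dist x z"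
          using G e unfolding gradient_bound_def by (simp add: dist_norm norm_minus_commute)
        finally show "dist (y - h x *\<^sub>R e) (y - h z *\<^sub>R e) \<le> \<epsilon> * dist x z" .
      qed
    qed
    then obtain x where "y - h x *\<^sub>R e = x" by blast
    then have "?\<Phi> x = y" unfolding push_def by (metis diff_add_cancel)
    then show ?thesis ..
  qed
  define g where "g = inv ?\<Phi>"
  have g\<Phi>: "g (?\<Phi> x) = x" for x unfolding g_def using inj by (rule inv_f_f)
  have \<Phi>g: "?\<Phi> (g y) = y" for y unfolding g_def using surj by (metis f_inv_into_f rangeI)
  have g_lip: "norm (g y - g x) \<le> (1 / (1 - \<epsilon>)) * norm (y - x)" for x y
    using push_dist(2)[OF G e, of "g y" "g x"] \<epsilon> by (simp add: \<Phi>g field_simps)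
  have g_cont: "continuous_on UNIV g"
    by (rule lipschitz_on_continuous_on[of "1 / (1 - \<epsilon>)"])
       (use g_lip \<epsilon> in \<open>auto intro!: lipschitz_onI simp: dist_norm\<close>)
  have derh: "(h has_derivative (\<lambda>v. G x \<bullet> v)) (at x)" for x
    using G unfolding gradient_bound_def by blast
  have pos: "0 < 1 + G x \<bullet> e" for x
  proof -
    have "\<bar>G x \<bullet> e\<bar> \<le> norm (G x) * norm e" by (rule Cauchy_Schwarz_ineq2)
    also have "\<dots> \<le> \<epsilon>" using G e unfolding gradient_bound_def by simp
    finally show ?thesis using \<epsilon> by linarith
  qed
  have smooth_\<Phi>: "ck_on k ?\<Phi> UNIV" for k
    unfolding push_def[abs_def] using h
    by (intro ck_on_add ck_on_ident ck_on_scaleR ck_on_const) (auto simp: smooth_on_def)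
  have der\<Phi>: "(?\<Phi> has_derivative (\<lambda>v. v + (G x \<bullet> v) *\<^sub>R e)) (at x)" for x
    unfolding push_def[abs_def] using derh[of x] by (auto intro!: derivative_eq_intros)
  \<comment> \<open>This is v - (G.v) / (1 + G.e) e with \<open>G\<close> taken at
    \<open>g y\<close>, spelled with sums and \<open>scaleR\<close> so that the closure rules of
    \<open>ck_on\<close> match it literally.\<close>
  have derg: "(g has_derivative (\<lambda>v. v + ((-1) *\<^sub>R ((G (g y) \<bullet> v) *\<^sub>R inverse (1 + G (g y) \<bullet> e))) *\<^sub>R e)) (at y)" for y
  proof (rule has_derivative_inverse_basic[where T = UNIV, OF der\<Phi>])
    show "bounded_linear (\<lambda>v. v + ((-1) *\<^sub>R ((G (g y) \<bullet> v) *\<^sub>R inverse (1 + G (g y) \<bullet> e))) *\<^sub>R e)"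
      by (rule linear_conv_bounded_linear[THEN iffD1], rule linearI)
         (auto simp: inner_add_right algebra_simps)
    show "(\<lambda>v. v + ((-1) *\<^sub>R ((G (g y) \<bullet> v) *\<^sub>R inverse (1 + G (g y) \<bullet> e))) *\<^sub>R e) \<circ>
        (\<lambda>v. v + (G (g y) \<bullet> v) *\<^sub>R e) = id"
    proof
      fix v
      let ?a = "G (g y) \<bullet> v" and ?b = "G (g y) \<bullet> e"
      have "(?a + ?a * ?b) * inverse (1 + ?b) = ?a"
        using pos[of "g y"] by (simp add: field_simps)
      then show "((\<lambda>v. v + ((-1) *\<^sub>R ((G (g y) \<bullet> v) *\<^sub>R inverse (1 + G (g y) \<bullet> e))) *\<^sub>R e) \<circ>
        (\<lambda>v. v + (G (g y) \<bullet> v) *\<^sub>R e)) v = id v"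
        by (simp add: inner_add_right)
    qed
    show "continuous (at y) g" using g_cont by (simp add: continuous_on_eq_continuous_at)
  qed (auto simp: \<Phi>g)
  have Gk: "ck_on k (\<lambda>x. G x \<bullet> v) UNIV" for k v
  proof -
    have "ck_on (Suc k) h UNIV" using h unfolding smooth_on_def by blast
    then have "ck_on k (\<lambda>x. frechet_derivative h (at x) v) UNIV" by simp
    then show ?thesis by (simp add: has_derivative_imp_frechet[OF derh])
  qed
  have smooth_g: "ck_on k g UNIV" for k
  proof (induction k)
    case 0
    then show ?case using g_cont by simp
  next
    case (Suc k)
    have Gg: "ck_on k (\<lambda>y. G (g y) \<bullet> v) UNIV" for v
      by (rule ck_on_compose[where T = UNIV and f = "\<lambda>x. G x \<bullet> v"]) (use Gk Suc in auto)
    have nz: "1 + G (g y) \<bullet> e \<noteq> 0" for y using pos[of "g y"] by simp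
    from Gg have "ck_on k (\<lambda>y. 1 + G (g y) \<bullet> e) UNIV"
      by (intro ck_on_add ck_on_const) auto
    then have inv: "ck_on k (\<lambda>y. inverse (1 + G (g y) \<bullet> e)) UNIV"
      by (rule ck_on_compose[where T = "- {0}" and f = inverse and k = k, rotated -1])
         (auto intro: ck_on_inverse simp: nz)
    show ?case
      by (rule ck_on_SucI[OF _ derg])
         (intro ck_on_add ck_on_scaleR ck_on_const Gg inv open_UNIV)+
  qed
  show ?thesis
    by (rule that[OF g\<Phi> \<Phi>g]) (use smooth_\<Phi> smooth_g in \<open>auto simp: smooth_on_def\<close>)
qed

lemma smooth_submanifold_image:
  fixes M :: "'a::euclidean_space set" and f g :: "'a \<Rightarrow> 'a"
  assumes M: "smooth_submanifold d M"
    and gf: "\<And>x. g (f x) = x" and fg: "\<And>y. f (g y) = y"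
    and f: "smooth_on UNIV f" and g: "smooth_on UNIV g"
  shows "smooth_submanifold d (f ` M)"
  unfolding smooth_submanifold_def
proof
  have cf: "continuous_on UNIV f" and cg: "continuous_on UNIV g"
    using f g unfolding smooth_on_def by (metis ck_on.simps(1))+
  fix y assume "y \<in> f ` M"
  then obtain x where x: "x \<in> M" "y = f x" by blast
  from bspec[OF M[unfolded smooth_submanifold_def] x(1)] obtain U V :: "'a set" and \<phi> \<psi> S where UV: "open U" "open V" "x \<in> U" "homeomorphism U V \<phi> \<psi>"
    "smooth_on U \<phi>" "smooth_on V \<psi>" "subspace S" "dim S = d" "\<phi> ` (U \<inter> M) = V \<inter> S"
    by (elim exE conjE) (rule that; assumption)
  have fU: "f ` U = g -` U" using gf fg by (auto simp: image_iff) (metis)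
  have op: "open (f ` U)" unfolding fU using UV(1) cg
    by (simp add: continuous_on_open_vimage[OF open_UNIV])
  have hom: "homeomorphism (f ` U) V (\<phi> \<circ> g) (f \<circ> \<psi>)"
  proof -
    have "homeomorphism (f ` U) U g f"
      using gf fg by (intro homeomorphismI)
        (auto intro: continuous_on_subset[OF cf] continuous_on_subset[OF cg])
    then show ?thesis using UV(4) by (rule homeomorphism_compose)
  qed
  have sm1: "smooth_on (f ` U) (\<phi> \<circ> g)"
    unfolding smooth_on_def
  proof
    fix k
    show "ck_on k (\<phi> \<circ> g) (f ` U)"
      unfolding o_def
    proof (rule ck_on_compose[OF op, of g U k \<phi>])
      show "g ` f ` U \<subseteq> U" by (auto simp: gf)
      show "ck_on k \<phi> U" using UV(5) unfolding smooth_on_def by blast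
      show "ck_on k g (f ` U)" using g ck_on_subset unfolding smooth_on_def by blast
    qed
  qed
  have sm2: "smooth_on V (f \<circ> \<psi>)"
    unfolding smooth_on_def
  proof
    fix k
    show "ck_on k (f \<circ> \<psi>) V"
      unfolding o_def
    proof (rule ck_on_compose[OF UV(2), of \<psi> UNIV k f])
      show "ck_on k f UNIV" "ck_on k \<psi> V" using UV(6) f unfolding smooth_on_def by blast+
    qed simp
  qed
  have "(\<phi> \<circ> g) ` (f ` U \<inter> f ` M) = \<phi> ` (U \<inter> M)"
  proof -
    have "f ` U \<inter> f ` M = f ` (U \<inter> M)" 
      by (rule image_Int[symmetric]) (rule inj_on_inverseI[of _ g], rule gf)
    then show ?thesis by (simp add: image_comp gf o_def)
  qed
  with UV(9) have im: "(\<phi> \<circ> g) ` (f ` U \<inter> f ` M) = V \<inter> S" by simp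
  show "\<exists>(U :: 'a set) (V :: 'a set) \<phi> \<psi> S. open U \<and> open V \<and> y \<in> U \<and> homeomorphism U V \<phi> \<psi> \<and> smooth_on U \<phi> \<and>
      smooth_on V \<psi> \<and> subspace S \<and> dim S = d \<and> \<phi> ` (U \<inter> f ` M) = V \<inter> S"
    using op UV(2) imageI[OF UV(3), of f, folded x(2)] hom sm1 sm2 UV(7,8) im
    by - (rule exI[of _ "f ` U"], rule exI[of _ V], rule exI[of _ "\<phi> \<circ> g"],
        rule exI[of _ "f \<circ> \<psi>"], rule exI[of _ S], blast)
qed


section \<open>Reach and proximal normals\<close>

definition unique_projection :: "real \<Rightarrow> 'a::metric_space set \<Rightarrow> bool"
  where "unique_projection r M \<longleftrightarrow>
    (\<forall>x\<in>tube M r. \<exists>!y. y \<in> M \<and> (\<forall>z\<in>M. dist x y \<le> dist x z))"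

text \<open>A limit point of \<open>M\<close> lies in the tube and has distance 0 from
  \<open>M\<close>, so its projection can only be the point itself. This supplies compactness of
  \<open>M\<close> inside \<open>K\<close> and Borel measurability of both manifolds.\<close>

lemma unique_projection_imp_closed:
  assumes "unique_projection r M" "0 < r"
  shows "closed M"
  unfolding closure_subset_eq[symmetric]
proof
  fix x assume x: "x \<in> closure M"
  with \<open>0 < r\<close> obtain y where "y \<in> M" "dist y x < r" unfolding closure_approachable by blast
  then have "x \<in> tube M r" by (auto simp: tube_def)
  then obtain y where y: "y \<in> M" "\<And>z. z \<in> M \<Longrightarrow> dist x y \<le> dist x z"
    using assms(1) unfolding unique_projection_def by blast
  have "dist x y \<le> e" if "0 < e" for e
    using x y(2) that unfolding closure_approachable by (metis dist_commute less_imp_le order_trans)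
  then have "dist x y \<le> 0" by (rule field_le_epsilon[of _ 0, simplified])
  then show "x \<in> M" using y by simp
qed

lemma norm_diff_square:
  fixes u w :: "'a::real_inner"
  shows "(norm (u - w))\<^sup>2 = (norm u)\<^sup>2 - 2 * (w \<bullet> u) + (norm w)\<^sup>2"
  by (simp add: power2_norm_eq_inner inner_diff_left inner_diff_right inner_commute[of u w])

text \<open>Squaring makes nearest-point comparisons linear in \<open>t\<close>. The length of
  \<open>u\<close> is arbitrary, so the equivalence serves unit normals with variable
  \<open>t\<close> as well as a raw difference of points with \<open>t = 1\<close>.\<close>

lemma closer_iff_proximal:
  fixes a u y :: "'a::real_inner"
  shows "dist (a + t *\<^sub>R u) a \<le> dist (a + t *\<^sub>R u) y \<longleftrightarrow>
    2 * t * ((y - a) \<bullet> u) \<le> (norm (y - a))\<^sup>2"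
proof -
  have "dist (a + t *\<^sub>R u) a \<le> dist (a + t *\<^sub>R u) y \<longleftrightarrow>
      (norm (t *\<^sub>R u))\<^sup>2 \<le> (norm (t *\<^sub>R u - (y - a)))\<^sup>2"
  proof -
    have "a + t *\<^sub>R u - a = t *\<^sub>R u" "a + t *\<^sub>R u - y = t *\<^sub>R u - (y - a)" by simp_all
    then show ?thesis unfolding dist_norm by (simp only: power_mono_iff[OF norm_ge_zero norm_ge_zero pos2])
  qed
  also have "(norm (t *\<^sub>R u - (y - a)))\<^sup>2 = (norm (t *\<^sub>R u))\<^sup>2 - 2 * t * ((y - a) \<bullet> u) + (norm (y - a))\<^sup>2"
    unfolding norm_diff_square[of "t *\<^sub>R u" "y - a"] by simp
  finally show ?thesis by simp
qed

text \<open>Federer's extension of normals up to the reach. If the largest \<open>\<tau>\<close> such that \<open>a\<close> is nearest to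
  \<open>a + \<tau> u\<close> were smaller than \<open>r\<close>, pushing a small ball around that point away from \<open>M\<close> would have a
  Brouwer fixed point, namely \<open>a + (\<tau> + \<epsilon>) u\<close>, and its nearest point would still be \<open>a\<close>.\<close>

lemma proximal_normal_extends:
  fixes M :: "'a::euclidean_space set"
  assumes M: "compact M" and uniq: "unique_projection r M"
    and a: "a \<in> M" and u: "norm u = 1" and t0: "0 < t0" "t0 \<le> r"
    and prox: "\<And>y. y \<in> M \<Longrightarrow> 2 * t0 * ((y - a) \<bullet> u) \<le> (norm (y - a))\<^sup>2"
    and y: "y \<in> M"
  shows "2 * r * ((y - a) \<bullet> u) \<le> (norm (y - a))\<^sup>2"
proof -
  define T where "T = {t. t \<le> r \<and> (\<forall>y\<in>M. 2 * t * ((y - a) \<bullet> u) \<le> (norm (y - a))\<^sup>2)}"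
  have t0T: "t0 \<in> T" using t0 prox by (auto simp: T_def)
  have bdd: "bdd_above T" unfolding T_def by (auto intro: bdd_aboveI[of _ r])
  have clo: "closed T"
  proof -
    have "T = {..r} \<inter> (\<Inter>y\<in>M. {t. 2 * t * ((y - a) \<bullet> u) \<le> (norm (y - a))\<^sup>2})"
      unfolding T_def by auto
    moreover have "closed {t. 2 * t * ((y - a) \<bullet> u) \<le> (norm (y - a))\<^sup>2}" for y
      by (intro closed_Collect_le continuous_intros)
    ultimately show ?thesis by auto
  qed
  define \<tau> where "\<tau> = Sup T"
  have \<tau>T: "\<tau> \<in> T" unfolding \<tau>_def using closed_contains_Sup[OF _ bdd clo] t0T by blast
  have \<tau>_ge: "t \<le> \<tau>" if "t \<in> T" for t unfolding \<tau>_def by (rule cSup_upper[OF that bdd])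
  have \<tau>0: "0 < \<tau>" using \<tau>_ge[OF t0T] t0 by simp
  have "\<tau> = r"
  proof (rule ccontr)
    assume "\<tau> \<noteq> r"
    then have \<tau>r: "\<tau> < r" using \<tau>T by (simp add: T_def)
    define x0 where "x0 = a + \<tau> *\<^sub>R u"
    have x0a: "dist x0 a = \<tau>" using u \<tau>0 by (simp add: x0_def dist_norm)
    have x0_near: "dist x0 a \<le> dist x0 z" if "z \<in> M" for z
      unfolding x0_def closer_iff_proximal using \<tau>T that by (simp add: T_def)
    \<comment> \<open>The first bound keeps the ball at distance at least \<open>2 * e\<close> from
      \<open>M\<close>, the second keeps it inside the tube of radius \<open>r\<close>, where
      projections are unique.\<close>
    define e where "e = min (\<tau> / 3) ((r - \<tau>) / 2)"
    have e: "0 < e" "3 * e \<le> \<tau>" "\<tau> + e < r" using \<tau>0 \<tau>r by (auto simp: e_def min_def field_simps)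
    let ?B = "cball x0 e"
    have tube: "x \<in> tube M r" if "x \<in> ?B" for x
    proof -
      have "dist a x < r" using that x0a e dist_triangle[of a x x0] by (simp add: dist_commute)
      then show ?thesis using a by (auto simp: tube_def)
    qed
    define p where "p x = (THE y. y \<in> M \<and> (\<forall>z\<in>M. dist x y \<le> dist x z))" for x
    have p: "p x \<in> M" "\<And>z. z \<in> M \<Longrightarrow> dist x (p x) \<le> dist x z"
      and p_eq: "\<And>y. y \<in> M \<Longrightarrow> (\<And>z. z \<in> M \<Longrightarrow> dist x y \<le> dist x z) \<Longrightarrow> p x = y" if "x \<in> ?B" for x
    proof -
      have ex1: "\<exists>!y. y \<in> M \<and> (\<forall>z\<in>M. dist x y \<le> dist x z)"
        using uniq tube[OF that] unfolding unique_projection_def by blast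
      from theI'[OF ex1] show "p x \<in> M" "\<And>z. z \<in> M \<Longrightarrow> dist x (p x) \<le> dist x z"
        unfolding p_def by blast+
      show "\<And>y. y \<in> M \<Longrightarrow> (\<And>z. z \<in> M \<Longrightarrow> dist x y \<le> dist x z) \<Longrightarrow> p x = y"
        unfolding p_def by (rule the1_equality[OF ex1]) blast
    qed
    have far: "2 * e \<le> dist x (p x)" if "x \<in> ?B" for x
    proof -
      have "\<tau> \<le> dist x0 (p x)" using x0_near[OF p(1)[OF that]] x0a by simp
      also have "\<dots> \<le> dist x0 x + dist x (p x)" by (rule dist_triangle)
      finally show ?thesis using that e by simp
    qed
    \<comment> \<open>By uniqueness the graph of the projection is the closed set of nearest pairs,
      and a map into the compact set \<open>M\<close> with closed graph is continuous.\<close>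
    have cont_p: "continuous_on ?B p"
    proof (rule continuous_from_closed_graph[OF M])
      show "p \<in> ?B \<rightarrow> M" using p by auto
      have "(\<lambda>x. (x, p x)) ` ?B = {w \<in> ?B \<times> M. \<forall>z\<in>M. dist (fst w) (snd w) \<le> dist (fst w) z}"
      proof (intro equalityI subsetI)
        fix w assume "w \<in> {w \<in> ?B \<times> M. \<forall>z\<in>M. dist (fst w) (snd w) \<le> dist (fst w) z}"
        then have w: "fst w \<in> ?B" "snd w \<in> M" "\<And>z. z \<in> M \<Longrightarrow> dist (fst w) (snd w) \<le> dist (fst w) z"
          by auto
        then have "p (fst w) = snd w" by (intro p_eq) auto
        then have "w = (fst w, p (fst w))" by simp
        then show "w \<in> (\<lambda>x. (x, p x)) ` ?B" using w(1) by (rule image_eqI)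
      qed (use p in auto)
      also have "\<dots> = (?B \<times> M) \<inter> (\<Inter>z\<in>M. {w. dist (fst w) (snd w) \<le> dist (fst w) z})" by auto
      also have "closed \<dots>"
        using M by (intro closed_Int closed_INT ballI closed_Times closed_Collect_le continuous_intros)
          (auto simp: compact_imp_closed)
      finally show "closed ((\<lambda>x. (x, p x)) ` ?B)" .
    qed
    \<comment> \<open>\<open>f x\<close> lies on the sphere of radius \<open>e\<close> about
      \<open>x0\<close>, in the direction from the nearest point towards \<open>x\<close>;
      \<open>far\<close> keeps the denominator away from 0.\<close>
    define f where "f x = x0 + (e / dist x (p x)) *\<^sub>R (x - p x)" for x
    have nz: "dist x (p x) \<noteq> 0" if "x \<in> ?B" for x using far[OF that] e by linarith
    have "continuous_on ?B f"
      unfolding f_def[abs_def] using nz by (intro continuous_intros cont_p) blast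
    moreover have "f \<in> ?B \<rightarrow> ?B"
      using nz e by (auto simp: f_def dist_norm)
    ultimately obtain x where x: "x \<in> ?B" "f x = x"
      using brouwer[of ?B f] e by (auto simp: less_imp_le)
    define \<rho> where "\<rho> = dist x (p x)"
    have \<rho>: "2 * e \<le> \<rho>" "\<rho> = norm (x - p x)" using far[OF x(1)] by (auto simp: \<rho>_def dist_norm)
    define v where "v = (1 / \<rho>) *\<^sub>R (x - p x)"
    have v: "norm v = 1" "x - p x = \<rho> *\<^sub>R v" using \<rho> e by (auto simp: v_def)
    have x_eq: "x = x0 + e *\<^sub>R v" using x(2) by (simp add: f_def v_def \<rho>_def)
    then have x0_eq: "x0 = p x + (\<rho> - e) *\<^sub>R v" using v(2) by (simp add: algebra_simps)
    \<comment> \<open>\<open>x0\<close> lies on the segment from \<open>p x\<close> to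
      \<open>x\<close>, so the point nearest to \<open>x\<close> is nearest to \<open>x0\<close>
      too.\<close>
    have "p x0 = p x"
    proof (rule p_eq)
      show "x0 \<in> ?B" using e by simp
      show "p x \<in> M" using p(1) x(1) by blast
      fix z assume "z \<in> M"
      have "dist x0 (p x) = \<rho> - e" 
        using v(1) \<rho>(1) e by (subst x0_eq) (simp add: dist_norm)
      also have "\<dots> \<le> dist x z - e" using p(2)[OF x(1) \<open>z \<in> M\<close>] by (simp add: \<rho>_def)
      also have "dist x z \<le> dist x x0 + dist x0 z" by (rule dist_triangle)
      also have "dist x x0 = e" using v(1) e by (subst x_eq) (simp add: dist_norm)
      finally show "dist x0 (p x) \<le> dist x0 z" by simp
    qed
    moreover have "p x0 = a"
      by (rule p_eq) (use e a x0_near in auto)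
    ultimately have pxa: "p x = a" by simp
    \<comment> \<open>Both sides are \<open>x0 - a\<close>. Equal lengths give
      \<open>\<rho> - e = \<tau>\<close>, and then the unit directions agree.\<close>
    have scaled: "\<tau> *\<^sub>R u = (\<rho> - e) *\<^sub>R v" using x0_eq x0_def pxa by simp
    then have "norm (\<tau> *\<^sub>R u) = norm ((\<rho> - e) *\<^sub>R v)" by simp
    then have "\<rho> - e = \<tau>" using u v(1) \<tau>0 \<rho>(1) e by simp
    with scaled have "\<tau> *\<^sub>R u = \<tau> *\<^sub>R v" by simp
    then have "u = v" using \<tau>0 by simp
    then have "x = a + (\<tau> + e) *\<^sub>R u" using x_eq by (simp add: x0_def algebra_simps)
    then have "2 * (\<tau> + e) * ((z - a) \<bullet> u) \<le> (norm (z - a))\<^sup>2" if "z \<in> M" for z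
      using p(2)[OF x(1) that] pxa closer_iff_proximal[of a "\<tau> + e" u z] by simp
    then have "\<tau> + e \<in> T" using e by (simp add: T_def)
    then show False using \<tau>_ge e by fastforce
  qed
  with \<tau>T y show ?thesis by (simp add: T_def)
qed

lemma le_reachI:
  assumes "0 \<le> \<kappa>" "unique_projection \<kappa> M"
  shows "ereal \<kappa> \<le> reach M"
  unfolding reach_def using assms by (intro SUP_upper) (simp add: unique_projection_def)

lemma less_reachE:
  assumes "ereal \<kappa> < reach M"
  obtains r where "\<kappa> < r" "unique_projection r M"
  using assms unfolding reach_def less_SUP_iff unique_projection_def by auto

text \<open>Pulls the two competing projections in the image back to \<open>M\<close>: the first gives a proximal
  normal of \<open>M\<close>, which extends up to \<open>r\<close> and then contradicts the second.\<close>

lemma unique_projection_push: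
  fixes M :: "'a::euclidean_space set"
  assumes M: "compact M" and uniq: "unique_projection r M"
    and G: "gradient_bound \<epsilon> h G" and \<epsilon>: "\<epsilon> < 1" and e: "norm e = 1"
    and \<kappa>: "0 < \<kappa>" "(1 + \<epsilon>) * \<kappa> \<le> r * ((1 - \<epsilon>)\<^sup>2 - 2 * \<epsilon> * \<kappa>)" and r: "0 < r"
  shows "unique_projection \<kappa> (push h e ` M)"
  unfolding unique_projection_def
proof
  let ?\<Phi> = "push h e"
  have \<epsilon>0: "0 \<le> \<epsilon>" using G norm_ge_zero unfolding gradient_bound_def by (meson order_trans)
  have Gx: "norm (G x) \<le> \<epsilon>" and taylor: "\<bar>h y - h x - G x \<bullet> (y - x)\<bar> \<le> \<epsilon> * (norm (y - x))\<^sup>2"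
    and hx: "isCont h x" for x y
    using G unfolding gradient_bound_def by (auto intro: has_derivative_continuous)
  have cont: "continuous_on M ?\<Phi>"
    unfolding push_def[abs_def]
    by (intro continuous_intros continuous_at_imp_continuous_on) (use hx in auto)
  have cpt: "compact (?\<Phi> ` M)" using cont M by (rule compact_continuous_image)
  fix z assume "z \<in> tube (?\<Phi> ` M) \<kappa>"
  then obtain x where x: "x \<in> M" "dist (?\<Phi> x) z < \<kappa>" by (auto simp: tube_def)
  then obtain c where c: "c \<in> ?\<Phi> ` M" "\<And>w. w \<in> ?\<Phi> ` M \<Longrightarrow> dist z c \<le> dist z w"
    using distance_attains_inf[OF compact_imp_closed[OF cpt], of z] by blast
  show "\<exists>!y. y \<in> ?\<Phi> ` M \<and> (\<forall>w\<in>?\<Phi> ` M. dist z y \<le> dist z w)"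
  proof (rule ex1I[of _ c])
    show "c \<in> ?\<Phi> ` M \<and> (\<forall>w\<in>?\<Phi> ` M. dist z c \<le> dist z w)" using c by blast
    fix q assume q: "q \<in> ?\<Phi> ` M \<and> (\<forall>w\<in>?\<Phi> ` M. dist z q \<le> dist z w)"
    show "q = c"
    proof (rule ccontr)
      assume qc: "q \<noteq> c"
      obtain a where a: "a \<in> M" "c = ?\<Phi> a" using c(1) by blast
      obtain b where b: "b \<in> M" "q = ?\<Phi> b" using q by blast
      define u where "u = z - c"
      define s where "s = norm u"
      have s_lt: "s < \<kappa>" using c(2)[of "?\<Phi> x"] x by (simp add: s_def u_def dist_norm norm_minus_commute)
      have eq: "dist z q = dist z c" using c q by (metis order_antisym)
      have s0: "0 < s" using eq qc by (auto simp: s_def u_def)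
      \<comment> \<open>The transpose of the derivative of \<open>push h e\<close> at
        \<open>a\<close>, applied to \<open>u\<close>: this is how a normal of the image pulls back
        to \<open>M\<close>.\<close>
      define u' where "u' = u + (u \<bullet> e) *\<^sub>R G a"
      have ue: "\<bar>u \<bullet> e\<bar> \<le> s" using Cauchy_Schwarz_ineq2[of u e] e by (simp add: s_def)
      have "norm ((u \<bullet> e) *\<^sub>R G a) \<le> s * \<epsilon>"
        using ue Gx[of a] by (simp add: mult_mono)
      then have u'_le: "norm u' \<le> (1 + \<epsilon>) * s" and u'_ge: "(1 - \<epsilon>) * s \<le> norm u'"
        unfolding u'_def using norm_triangle_ineq[of u "(u \<bullet> e) *\<^sub>R G a"]
          norm_diff_ineq[of u "(u \<bullet> e) *\<^sub>R G a"] by (simp_all add: s_def algebra_simps)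
      have u'0: "0 < norm u'" using u'_ge \<epsilon> s0 by (smt (verit) mult_pos_pos)
      \<comment> \<open>By the choice of \<open>u'\<close> the first order terms cancel, and only
        the Taylor remainder of \<open>h\<close> is left.\<close>
      have pull: "\<bar>(?\<Phi> y - c) \<bullet> u - (y - a) \<bullet> u'\<bar> \<le> s * \<epsilon> * (norm (y - a))\<^sup>2" for y
      proof -
        have "(?\<Phi> y - c) \<bullet> u - (y - a) \<bullet> u' = (u \<bullet> e) * (h y - h a - G a \<bullet> (y - a))"
        proof -
          have "?\<Phi> y - c = (y - a) + (h y - h a) *\<^sub>R e"
            unfolding a(2) push_def by (simp add: algebra_simps)
          then have "(?\<Phi> y - c) \<bullet> u = (y - a) \<bullet> u + (h y - h a) * (u \<bullet> e)"
            by (simp add: inner_add_left inner_commute[of e u])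
          moreover have "(y - a) \<bullet> u' = (y - a) \<bullet> u + (u \<bullet> e) * (G a \<bullet> (y - a))"
            by (simp add: u'_def inner_add_right inner_commute[of "y - a" "G a"])
          ultimately show ?thesis
            by (simp only: right_diff_distrib mult.commute[of "h y - h a"])
        qed
        then have "\<bar>(?\<Phi> y - c) \<bullet> u - (y - a) \<bullet> u'\<bar> = \<bar>u \<bullet> e\<bar> * \<bar>h y - h a - G a \<bullet> (y - a)\<bar>"
          by (simp add: abs_mult)
        also have "\<dots> \<le> s * (\<epsilon> * (norm (y - a))\<^sup>2)"
          using ue taylor s0 by (intro mult_mono) auto
        finally show ?thesis by (simp add: mult.assoc)
      qed
      define w where "w = (1 / norm u') *\<^sub>R u'"
      have w: "norm w = 1" using u'0 by (simp add: w_def)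
      have w_inner: "v \<bullet> u' = norm u' * (v \<bullet> w)" for v using u'0 by (simp add: w_def)
      \<comment> \<open>The square of the Lipschitz constant plus twice the error in
        \<open>pull\<close>. Its size is immaterial: \<open>proximal_normal_extends\<close> wants
        only some positive starting radius, here \<open>norm u' / C\<close> cut off at
        \<open>r\<close>.\<close>
      define C where "C = (1 + \<epsilon>)\<^sup>2 + 2 * s * \<epsilon>"
      have C: "0 < C" unfolding C_def using \<epsilon>0 s0 by (intro add_pos_nonneg) auto
      have near: "2 * ((y - a) \<bullet> u') \<le> C * (norm (y - a))\<^sup>2" if "y \<in> M" for y
      proof -
        have "2 * ((?\<Phi> y - c) \<bullet> u) \<le> (norm (?\<Phi> y - c))\<^sup>2"
          using c(2)[of "?\<Phi> y"] that closer_iff_proximal[of c 1 u "?\<Phi> y"] by (simp add: u_def)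
        also have "\<dots> \<le> ((1 + \<epsilon>) * norm (y - a))\<^sup>2"
          unfolding a(2) using push_dist(1)[OF G e] by (intro power_mono) auto
        finally have "2 * ((?\<Phi> y - c) \<bullet> u) \<le> (1 + \<epsilon>)\<^sup>2 * (norm (y - a))\<^sup>2" by (simp add: power_mult_distrib)
        moreover have "2 * ((y - a) \<bullet> u') \<le> 2 * ((?\<Phi> y - c) \<bullet> u) + 2 * s * \<epsilon> * (norm (y - a))\<^sup>2"
          using pull[of y] by (simp add: abs_le_iff)
        ultimately show ?thesis unfolding C_def by (simp add: algebra_simps)
      qed
      define t0 where "t0 = min r (norm u' / C)"
      have t0: "0 < t0" "t0 \<le> r" using r u'0 C by (auto simp: t0_def)
      have "2 * r * ((b - a) \<bullet> w) \<le> (norm (b - a))\<^sup>2"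
      proof (rule proximal_normal_extends[OF M uniq a(1) w t0 _ b(1)])
        fix y assume y: "y \<in> M"
        show "2 * t0 * ((y - a) \<bullet> w) \<le> (norm (y - a))\<^sup>2"
        proof (cases "0 \<le> (y - a) \<bullet> w")
          case True
          have "2 * t0 * ((y - a) \<bullet> w) \<le> 2 * (norm u' / C) * ((y - a) \<bullet> w)"
            using True by (intro mult_right_mono) (auto simp: t0_def)
          also have "\<dots> = (2 * ((y - a) \<bullet> u')) / C" by (simp add: w_inner)
          also have "\<dots> \<le> (norm (y - a))\<^sup>2" using near[OF y] C by (simp add: field_simps)
          finally show ?thesis .
        next
          case False
          then have "2 * t0 * ((y - a) \<bullet> w) \<le> 0" using t0 by (intro mult_nonneg_nonpos) auto
          also have "0 \<le> (norm (y - a))\<^sup>2" by simp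
          finally show ?thesis .
        qed
      qed
      then have "norm u' * (2 * r * ((b - a) \<bullet> w)) \<le> norm u' * (norm (b - a))\<^sup>2"
        by (rule mult_left_mono) simp
      then have "2 * r * ((b - a) \<bullet> u') \<le> norm u' * (norm (b - a))\<^sup>2"
        unfolding w_inner by (simp only: mult_ac)
      also have "\<dots> \<le> (1 + \<epsilon>) * s * (norm (b - a))\<^sup>2" by (intro mult_right_mono u'_le) simp
      finally have up: "2 * r * ((b - a) \<bullet> u') \<le> (1 + \<epsilon>) * s * (norm (b - a))\<^sup>2" .
      \<comment> \<open>\<open>q\<close> is as close to \<open>z\<close> as \<open>c\<close> is, so
        expanding the square reverses the proximal inequality at \<open>q\<close>.\<close>
      have "(norm (q - c))\<^sup>2 \<le> 2 * ((q - c) \<bullet> u)"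
      proof -
        have "norm (u - (q - c)) = norm u"
          using eq by (simp add: u_def dist_norm)
        then show ?thesis using norm_diff_square[of u "q - c"] by simp
      qed
      moreover have "((1 - \<epsilon>) * norm (b - a))\<^sup>2 \<le> (norm (q - c))\<^sup>2"
        unfolding a(2) b(2) using push_dist(2)[OF G e] \<epsilon> by (intro power_mono) auto
      moreover have "2 * ((q - c) \<bullet> u) \<le> 2 * ((b - a) \<bullet> u') + 2 * s * \<epsilon> * (norm (b - a))\<^sup>2"
        unfolding b(2) using pull[of b] by (simp add: abs_le_iff)
      ultimately have "((1 - \<epsilon>)\<^sup>2 - 2 * s * \<epsilon>) * (norm (b - a))\<^sup>2 \<le> 2 * ((b - a) \<bullet> u')"
        unfolding power_mult_distrib left_diff_distrib[of "(1 - \<epsilon>)\<^sup>2"] by linarith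
      then have "r * (((1 - \<epsilon>)\<^sup>2 - 2 * s * \<epsilon>) * (norm (b - a))\<^sup>2) \<le> r * (2 * ((b - a) \<bullet> u'))"
        using r by (intro mult_left_mono) auto
      with up have "(r * ((1 - \<epsilon>)\<^sup>2 - 2 * s * \<epsilon>)) * (norm (b - a))\<^sup>2 \<le> ((1 + \<epsilon>) * s) * (norm (b - a))\<^sup>2"
        by (simp add: mult_ac)
      moreover have "0 < (norm (b - a))\<^sup>2" using qc a b by auto
      \<comment> \<open>The normal of radius \<open>r\<close> bounds the pulled-back product from
        above, equidistance bounds it from below. Together they force this inequality, which
        contradicts the curvature assumption because \<open>s < \<kappa>\<close> is strict.\<close>
      ultimately have "r * ((1 - \<epsilon>)\<^sup>2 - 2 * s * \<epsilon>) \<le> (1 + \<epsilon>) * s" by (rule mult_right_le_imp_le)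
      moreover have "r * ((1 - \<epsilon>)\<^sup>2 - 2 * \<epsilon> * \<kappa>) \<le> r * ((1 - \<epsilon>)\<^sup>2 - 2 * s * \<epsilon>)"
        using r mult_left_mono[of s \<kappa> \<epsilon>] \<epsilon>0 s_lt by (intro mult_left_mono) (simp_all add: mult.commute)
      moreover have "(1 + \<epsilon>) * s < (1 + \<epsilon>) * \<kappa>" using s_lt \<epsilon>0 by simp
      ultimately show False using \<kappa> by linarith
    qed
  qed
qed


section \<open>Hausdorff measure of discs\<close>

lemma diameter_image_le:
  fixes f :: "'a::real_normed_vector \<Rightarrow> 'b::real_normed_vector"
  assumes "bounded C" "0 \<le> L" and lip: "\<And>x y. x \<in> C \<Longrightarrow> y \<in> C \<Longrightarrow> norm (f x - f y) \<le> L * norm (x - y)"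
  shows "bounded (f ` C)" "diameter (f ` C) \<le> L * diameter C"
proof -
  have *: "norm (f x - f y) \<le> L * diameter C" if "x \<in> C" "y \<in> C" for x y
  proof -
    have "norm (x - y) \<le> diameter C"
      using diameter_bounded_bound[OF assms(1) that] by (simp add: dist_norm)
    then show ?thesis using lip[OF that] \<open>0 \<le> L\<close> by (meson mult_left_mono order_trans)
  qed
  show "bounded (f ` C)"
  proof (cases "C = {}")
    case False
    then obtain x where "x \<in> C" by blast
    then show ?thesis
      unfolding bounded_def using * by (intro exI[of _ "f x"] exI[of _ "L * diameter C"]) (auto simp: dist_norm)
  qed simp
  show "diameter (f ` C) \<le> L * diameter C"
    by (rule diameter_le) (use * \<open>0 \<le> L\<close> diameter_ge_0[OF assms(1)] in auto)
qed

text \<open>\<open>f\<close> is controlled on \<open>A\<close> only, so covering sets are first cut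
  down to \<open>A\<close>. The mesh changes from \<open>\<delta>\<close> to
  \<open>L * \<delta>\<close>, which the supremum over all meshes absorbs.\<close>

lemma hausdorff_outer_lipschitz:
  fixes f :: "'a::real_normed_vector \<Rightarrow> 'b::real_normed_vector"
  assumes d: "0 < d" and L: "0 < L"
    and lip: "\<And>x y. x \<in> A \<Longrightarrow> y \<in> A \<Longrightarrow> norm (f x - f y) \<le> L * norm (x - y)"
  shows "hausdorff_outer d (f ` A) \<le> ennreal (L ^ d) * hausdorff_outer d A"
proof -
  let ?c = "ennreal (L ^ d)"
  have c: "?c > 0" "?c \<noteq> top" using L by auto
  have content: "hausdorff_content d (L * \<delta>) (f ` A) \<le> ?c * hausdorff_content d \<delta> A" for \<delta>
  proof -
    \<comment> \<open>Dividing first leaves a bare infimum on the right, so that it is enough to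
      treat one cover at a time.\<close>
    have "hausdorff_content d (L * \<delta>) (f ` A) / ?c \<le> hausdorff_content d \<delta> A"
      unfolding hausdorff_content_def[of d \<delta> A]
    proof (rule Inf_greatest, clarify)
      fix C :: "nat \<Rightarrow> 'a set"
      assume C: "A \<subseteq> (\<Union>i. C i)" "\<forall>i. bounded (C i) \<and> diameter (C i) \<le> \<delta>"
      define E where "E i = f ` (A \<inter> C i)" for i
      have AC: "bounded (A \<inter> C i)" for i using C(2) by (blast intro: bounded_subset)
      have "diameter (A \<inter> C i) \<le> diameter (C i)" for i
        using C(2) by (intro diameter_subset) auto
      then have "L * diameter (A \<inter> C i) \<le> L * diameter (C i)" for i
        using L by (intro mult_left_mono) auto
      moreover have E: "bounded (E i)" "diameter (E i) \<le> L * diameter (A \<inter> C i)" for i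
        unfolding E_def using diameter_image_le[OF AC[of i], of L f] L lip by auto
      ultimately have E': "diameter (E i) \<le> L * diameter (C i)" for i
        using order_trans by blast
      have "hausdorff_content d (L * \<delta>) (f ` A) \<le> (\<Sum>i. ennreal (diameter (E i) ^ d))"
      proof (rule hausdorff_content_le)
        show "f ` A \<subseteq> (\<Union>i. E i)" using C(1) by (fastforce simp: E_def)
        show "diameter (E i) \<le> L * \<delta>" for i
          using E'[of i] C(2) L by (meson mult_left_mono less_imp_le order_trans)
      qed (rule E)
      also have "\<dots> \<le> (\<Sum>i. ?c * ennreal (diameter (C i) ^ d))"
      proof (intro suminf_le)
        fix i
        have "diameter (E i) ^ d \<le> (L * diameter (C i)) ^ d"
          using E' E by (intro power_mono diameter_ge_0) auto
        also have "\<dots> = L ^ d * diameter (C i) ^ d" by (rule power_mult_distrib)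
        finally show "ennreal (diameter (E i) ^ d) \<le> ?c * ennreal (diameter (C i) ^ d)"
          using L by (simp add: ennreal_mult'[symmetric] ennreal_leI)
      qed auto
      also have "\<dots> = ?c * (\<Sum>i. ennreal (diameter (C i) ^ d))" by (rule ennreal_suminf_cmult)
      finally show "hausdorff_content d (L * \<delta>) (f ` A) / ?c \<le> (\<Sum>i. ennreal (diameter (C i) ^ d))"
        by (rule divide_le_posI_ennreal[OF c(1)])
    qed
    then have "?c * (hausdorff_content d (L * \<delta>) (f ` A) / ?c) \<le> ?c * hausdorff_content d \<delta> A"
      by (rule mult_left_mono) simp
    also have "?c * (hausdorff_content d (L * \<delta>) (f ` A) / ?c) = hausdorff_content d (L * \<delta>) (f ` A)"
      unfolding ennreal_times_divide mult.commute[of ?c]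
      by (rule mult_divide_eq_ennreal) (use c L in auto)
    finally show ?thesis .
  qed
  show ?thesis
    unfolding hausdorff_outer_def[of d "f ` A"]
  proof (rule SUP_least)
    fix \<delta> :: real assume \<delta>: "\<delta> \<in> {0<..}"
    have "hausdorff_content d \<delta> (f ` A) \<le> ?c * hausdorff_content d (\<delta> / L) A"
      using content[of "\<delta> / L"] L by simp
    also have "\<dots> \<le> ?c * hausdorff_outer d A"
      unfolding hausdorff_outer_def using \<delta> L by (intro mult_left_mono SUP_upper) auto
    finally show "hausdorff_content d \<delta> (f ` A) \<le> ?c * hausdorff_outer d A" .
  qed
qed

lemma hausdorff_content_finite_cover:
  assumes d: "0 < d" and I: "finite I" and A: "A \<subseteq> (\<Union>i\<in>I. C i)"
    and C: "\<And>i. i \<in> I \<Longrightarrow> bounded (C i)" "\<And>i. i \<in> I \<Longrightarrow> diameter (C i) \<le> \<delta>" and \<delta>: "0 \<le> \<delta>"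
  shows "hausdorff_content d \<delta> A \<le> (\<Sum>i\<in>I. ennreal (diameter (C i) ^ d))"
proof -
  obtain h where h: "bij_betw h {0..<card I} I" using ex_bij_betw_nat_finite[OF I] by blast
  \<comment> \<open>Padding with empty sets costs nothing: they have diameter 0, and
    \<open>0 ^ d = 0\<close> because \<open>d\<close> is positive.\<close>
  define E where "E i = (if i < card I then C (h i) else {})" for i
  have hI: "h i \<in> I" if "i < card I" for i using h that by (auto simp: bij_betw_def)
  have "A \<subseteq> (\<Union>i. E i)"
  proof
    fix x assume "x \<in> A"
    then obtain i where i: "i \<in> I" "x \<in> C i" using A by blast
    then obtain j where "j < card I" "h j = i" using h unfolding bij_betw_def by (metis atLeastLessThan_iff imageE)
    then have "x \<in> E j" using i by (simp add: E_def)
    then show "x \<in> (\<Union>i. E i)" by blast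
  qed
  then have "hausdorff_content d \<delta> A \<le> (\<Sum>i. ennreal (diameter (E i) ^ d))"
    by (rule hausdorff_content_le) (use C hI \<delta> in \<open>auto simp: E_def\<close>)
  also have "\<dots> = (\<Sum>i\<in>{0..<card I}. ennreal (diameter (E i) ^ d))"
    by (rule suminf_finite) (auto simp: E_def d power_0_left)
  also have "\<dots> = (\<Sum>i\<in>{0..<card I}. ennreal (diameter (C (h i)) ^ d))"
    by (intro sum.cong) (auto simp: E_def)
  also have "\<dots> = (\<Sum>i\<in>I. ennreal (diameter (C i) ^ d))"
    by (rule sum.reindex_bij_betw[OF h])
  finally show ?thesis .
qed

lemma norm_le_coordinate_span:
  fixes x :: "'a::euclidean_space"
  assumes B: "B \<subseteq> Basis" and x: "\<And>b. b \<in> Basis - B \<Longrightarrow> x \<bullet> b = 0"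
    and s: "\<And>b. b \<in> B \<Longrightarrow> \<bar>x \<bullet> b\<bar> \<le> s"
  shows "norm x \<le> real (card B) * s"
proof -
  have "norm x \<le> (\<Sum>b\<in>Basis. \<bar>x \<bullet> b\<bar>)" by (rule norm_le_l1)
  also have "\<dots> = (\<Sum>b\<in>B. \<bar>x \<bullet> b\<bar>)"
    by (rule sum.mono_neutral_right) (use B x in auto)
  also have "\<dots> \<le> (\<Sum>b\<in>B. s)" by (intro sum_mono s)
  finally show ?thesis by simp
qed

definition coordinate_disc :: "'a::euclidean_space set \<Rightarrow> 'a set"
  where "coordinate_disc B = {x \<in> cball 0 1. \<forall>b\<in>Basis - B. x \<bullet> b = 0}"

lemma hausdorff_outer_coordinate_disc_le:
  fixes B :: "'a::euclidean_space set"
  assumes B: "B \<subseteq> Basis" "card B = d" and d: "0 < d"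
  shows "hausdorff_outer d (coordinate_disc B) \<le> ennreal ((4 * real d) ^ d)"
  unfolding hausdorff_outer_def
proof (rule SUP_least)
  fix \<delta> :: real assume "\<delta> \<in> {0<..}"
  then have \<delta>: "0 < \<delta>" by simp
  obtain m where m: "2 * real d / \<delta> < real m" using reals_Archimedean2 by blast
  define N where "N = Suc m"
  have N: "0 < N" "2 * real d / real N \<le> \<delta>"
    using m \<delta> by (auto simp: N_def field_simps)
  have finB: "finite B" by (rule finite_subset[OF B(1) finite_Basis])
  \<comment> \<open>Indices run up to \<open>N\<close> inclusive, so that the coordinate value 1,
    whose floor is \<open>N\<close>, needs no separate case. The (N + 1)^d cells of diameter at most
    2d/N then sum to at most (4d)^d, since N + 1 \<le> 2N.\<close>
  define I where "I = (\<Pi>\<^sub>E b\<in>B. {..N})"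
  define C where "C k = {x::'a. (\<forall>b\<in>Basis - B. x \<bullet> b = 0) \<and>
      (\<forall>b\<in>B. real (k b) \<le> (x \<bullet> b + 1) * N / 2 \<and> (x \<bullet> b + 1) * N / 2 \<le> real (k b) + 1)}" for k
  have I: "finite I" "card I = (N + 1) ^ d"
    unfolding I_def using finB B(2) by (auto intro: finite_PiE simp: card_PiE)
  have cover: "coordinate_disc B \<subseteq> (\<Union>k\<in>I. C k)"
  proof
    fix x assume x: "x \<in> coordinate_disc B"
    define k where "k = (\<lambda>b\<in>B. nat \<lfloor>(x \<bullet> b + 1) * N / 2\<rfloor>)"
    have xb: "\<bar>x \<bullet> b\<bar> \<le> 1" if "b \<in> B" for b
      using Basis_le_norm[of b x] that B(1) x by (auto simp: coordinate_disc_def)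
    have nn: "0 \<le> (x \<bullet> b + 1) * N / 2" if "b \<in> B" for b
      using xb[OF that] by simp
    have "nat \<lfloor>(x \<bullet> b + 1) * N / 2\<rfloor> \<le> N" if "b \<in> B" for b
    proof -
      have "(x \<bullet> b + 1) * N \<le> 2 * real N" using xb[OF that] by (intro mult_right_mono) auto
      then show ?thesis by (simp add: nat_le_iff floor_le_iff)
    qed
    then have "k \<in> I" unfolding I_def k_def by auto
    moreover have "x \<in> C k"
      unfolding C_def mem_Collect_eq
    proof (intro conjI ballI)
      show "x \<bullet> b = 0" if "b \<in> Basis - B" for b using x that by (simp add: coordinate_disc_def)
      fix b assume b: "b \<in> B"
      have kb: "k b = nat \<lfloor>(x \<bullet> b + 1) * N / 2\<rfloor>" using b by (simp add: k_def)
      have "real (nat \<lfloor>r\<rfloor>) \<le> r \<and> r \<le> real (nat \<lfloor>r\<rfloor>) + 1" if "0 \<le> r" for r :: real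
        using that by simp
      from this[OF nn[OF b]]
      show "real (k b) \<le> (x \<bullet> b + 1) * N / 2" "(x \<bullet> b + 1) * N / 2 \<le> real (k b) + 1"
        unfolding kb by blast+
    qed
    ultimately show "x \<in> (\<Union>k\<in>I. C k)" by blast
  qed
  have close: "norm (x - y) \<le> 2 * real d / real N" if "x \<in> C k" "y \<in> C k" for x y k
  proof -
    have "norm (x - y) \<le> real (card B) * (2 / real N)"
    proof (rule norm_le_coordinate_span[OF B(1)])
      show "(x - y) \<bullet> b = 0" if "b \<in> Basis - B" for b
        using that \<open>x \<in> C k\<close> \<open>y \<in> C k\<close> by (simp add: C_def inner_diff_left)
      fix b assume b: "b \<in> B"
      have "(x \<bullet> b + 1) * N / 2 \<le> (y \<bullet> b + 1) * N / 2 + 1" "(y \<bullet> b + 1) * N / 2 \<le> (x \<bullet> b + 1) * N / 2 + 1"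
        using b that unfolding C_def by fastforce+
      then show "\<bar>(x - y) \<bullet> b\<bar> \<le> 2 / real N"
        using N(1) by (simp add: inner_diff_left abs_le_iff field_simps)
    qed
    then show ?thesis by (simp add: B(2) mult.commute)
  qed
  have bdd: "bounded (C k)" for k
  proof (cases "C k = {}")
    case False
    then obtain x where "x \<in> C k" by blast
    then show ?thesis
      unfolding bounded_def using close
      by (intro exI[of _ x] exI[of _ "2 * real d / real N"]) (auto simp: dist_norm)
  qed simp
  have diam: "diameter (C k) \<le> 2 * real d / real N" for k
    by (rule diameter_le) (use close in auto)
  have "hausdorff_content d \<delta> (coordinate_disc B) \<le> hausdorff_content d (2 * real d / real N) (coordinate_disc B)"
    by (rule hausdorff_content_antimono[OF N(2)])
  also have "\<dots> \<le> (\<Sum>k\<in>I. ennreal (diameter (C k) ^ d))"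
    by (rule hausdorff_content_finite_cover[OF d I(1) cover bdd diam]) simp
  also have "\<dots> \<le> (\<Sum>k\<in>I. ennreal ((2 * real d / real N) ^ d))"
    using bdd diam by (intro sum_mono ennreal_leI power_mono diameter_ge_0)
  also have "\<dots> = ennreal (real ((N + 1) ^ d) * (2 * real d / real N) ^ d)"
    using I(2) by (simp add: ennreal_of_nat_eq_real_of_nat ennreal_mult')
  also have "real ((N + 1) ^ d) * (2 * real d / real N) ^ d = ((real N + 1) * (2 * real d / real N)) ^ d"
    by (simp only: power_mult_distrib of_nat_power of_nat_add of_nat_1)
  also have "\<dots> \<le> (4 * real d) ^ d"
  proof (rule power_mono)
    have "(real N + 1) * (2 * real d / real N) = 2 * real d * ((real N + 1) / real N)" by simp
    also have "\<dots> \<le> 2 * real d * 2" using N(1) by (intro mult_left_mono) (auto simp: field_simps)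
    finally show "(real N + 1) * (2 * real d / real N) \<le> 4 * real d" by simp
  qed simp
  finally show "hausdorff_content d \<delta> (coordinate_disc B) \<le> ennreal ((4 * real d) ^ d)"
    by (simp add: ennreal_leI)
qed

text \<open>Thickening a covering set of diameter \<open>\<rho>\<close> to a box with sides \<open>2 \<rho>\<close> along \<open>B\<close> and \<open>2\<close> along the
  other coordinates compares the Hausdorff content with Lebesgue measure.\<close>

lemma hausdorff_outer_coordinate_disc_pos:
  fixes B :: "'a::euclidean_space set"
  assumes B: "B \<subseteq> Basis" "card B = d" and d: "0 < d"
  shows "0 < hausdorff_outer d (coordinate_disc B)"
proof -
  have finB: "finite B" by (rule finite_subset[OF B(1) finite_Basis])
  define box where "box c \<rho> = cbox (\<Sum>b\<in>Basis. (if b \<in> B then c \<bullet> b - \<rho> else - 1) *\<^sub>R b)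
      (\<Sum>b\<in>Basis. (if b \<in> B then c \<bullet> b + \<rho> else 1) *\<^sub>R b)" for c :: 'a and \<rho>
  have box_iff: "x \<in> box c \<rho> \<longleftrightarrow> (\<forall>b\<in>B. \<bar>(x - c) \<bullet> b\<bar> \<le> \<rho>) \<and> (\<forall>b\<in>Basis - B. \<bar>x \<bullet> b\<bar> \<le> 1)" for x c \<rho>
    unfolding box_def mem_box
    using B(1) by (auto simp: inner_diff_left abs_le_iff)
  have emeasure_box: "emeasure lborel (box c \<rho>) = ennreal (2 ^ DIM('a)) * ennreal (\<rho> ^ d)" if "0 \<le> \<rho>" for c \<rho>
  proof -
    have "emeasure lborel (box c \<rho>) = ennreal (\<Prod>b\<in>Basis. (if b \<in> B then 2 * \<rho> else 2))"
      unfolding box_def emeasure_lborel_cbox_eq using that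
      by (auto simp: inner_diff_left intro!: arg_cong[where f = ennreal] prod.cong)
    also have "(\<Prod>b\<in>Basis. (if b \<in> B then 2 * \<rho> else 2)) = (\<Prod>b\<in>(Basis::'a set). 2 * (if b \<in> B then \<rho> else 1))"
      by (intro prod.cong) auto
    also have "\<dots> = 2 ^ DIM('a) * (\<Prod>b\<in>(Basis::'a set). if b \<in> B then \<rho> else 1)"
      by (simp add: prod.distrib)
    also have "(\<Prod>b\<in>(Basis::'a set). if b \<in> B then \<rho> else 1) = \<rho> ^ d"
      using B by (simp add: prod.If_cases Int_absorb1)
    finally show ?thesis by (simp add: ennreal_mult')
  qed
  \<comment> \<open>A supremum over meshes is bounded below by any single mesh. The half-side 1/d is
    chosen so that the d-dimensional cube fits into the unit disc, by the l1 bound on the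
    norm.\<close>
  have "ennreal ((1 / real d) ^ d) \<le> hausdorff_content d 1 (coordinate_disc B)"
    unfolding hausdorff_content_def
  proof (rule Inf_greatest, clarify)
    fix C :: "nat \<Rightarrow> 'a set"
    assume C: "coordinate_disc B \<subseteq> (\<Union>i. C i)" "\<forall>i. bounded (C i) \<and> diameter (C i) \<le> 1"
    define \<rho> where "\<rho> i = diameter (C i)" for i
    \<comment> \<open>Meaningful when \<open>C i\<close> is nonempty; otherwise
      \<open>\<rho> i = 0\<close> and the degenerate box has measure 0, again because
      \<open>d\<close> is positive.\<close>
    define c where "c i = (SOME x. x \<in> C i)" for i
    have \<rho>: "0 \<le> \<rho> i" for i unfolding \<rho>_def using C(2) by (intro diameter_ge_0) auto
    have "box 0 (1 / real d) \<subseteq> (\<Union>i. box (c i) (\<rho> i))"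
    proof
      fix x assume x: "x \<in> box 0 (1 / real d)"
      define x' where "x' = (\<Sum>b\<in>Basis. (if b \<in> B then x \<bullet> b else 0) *\<^sub>R b)"
      have x'_in: "x' \<bullet> b = (if b \<in> B then x \<bullet> b else 0)" if "b \<in> Basis" for b
        using that by (simp add: x'_def)
      have "norm x' \<le> real (card B) * (1 / real d)"
        by (rule norm_le_coordinate_span[OF B(1)]) (use x'_in x box_iff B(1) in auto)
      then have "x' \<in> coordinate_disc B"
        using B(2) d x'_in by (simp add: coordinate_disc_def)
      then obtain i where i: "x' \<in> C i" using C(1) by blast
      then have "c i \<in> C i" unfolding c_def by (rule someI)
      then have near: "norm (x' - c i) \<le> \<rho> i"
        unfolding \<rho>_def using diameter_bounded_bound[of "C i" x' "c i"] C(2) i by (simp add: dist_norm)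
      have "\<bar>(x - c i) \<bullet> b\<bar> \<le> \<rho> i" if "b \<in> B" for b
      proof -
        have "(x - c i) \<bullet> b = (x' - c i) \<bullet> b"
          using that B(1) x'_in[of b] by (auto simp: inner_diff_left)
        then show ?thesis using near Basis_le_norm[of b "x' - c i"] that B(1) by auto
      qed
      then have "x \<in> box (c i) (\<rho> i)" using x by (simp add: box_iff)
      then show "x \<in> (\<Union>i. box (c i) (\<rho> i))" by blast
    qed
    then have "emeasure lborel (box 0 (1 / real d)) \<le> emeasure lborel (\<Union>i. box (c i) (\<rho> i))"
      by (intro emeasure_mono) (auto simp: box_def)
    also have "\<dots> \<le> (\<Sum>i. emeasure lborel (box (c i) (\<rho> i)))"
      by (rule emeasure_subadditive_countably) (auto simp: box_def)
    also have "\<dots> = (\<Sum>i. ennreal (2 ^ DIM('a)) * ennreal (\<rho> i ^ d))"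
      by (intro suminf_cong emeasure_box \<rho>)
    also have "\<dots> = ennreal (2 ^ DIM('a)) * (\<Sum>i. ennreal (\<rho> i ^ d))"
      by (rule ennreal_suminf_cmult)
    finally have "ennreal (2 ^ DIM('a)) * ennreal ((1 / real d) ^ d) \<le> ennreal (2 ^ DIM('a)) * (\<Sum>i. ennreal (\<rho> i ^ d))"
      by (simp only: emeasure_box[of "1 / real d" 0] zero_le_divide_1_iff of_nat_0_le_iff)
    then show "ennreal ((1 / real d) ^ d) \<le> (\<Sum>i. ennreal (diameter (C i) ^ d))"
      by (subst (asm) ennreal_mult_le_mult_iff) (auto simp: \<rho>_def)
  qed
  also have "\<dots> \<le> hausdorff_outer d (coordinate_disc B)"
    unfolding hausdorff_outer_def by (intro SUP_upper) auto
  finally show ?thesis using d by (metis ennreal_less_zero_iff less_le_trans of_nat_0_less_iff zero_less_divide_1_iff zero_less_power)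
qed


section \<open>Hausdorff measure of submanifolds\<close>

text \<open>Hausdorff measure depends on the metric alone, so discs in an arbitrary d-dimensional
  subspace reduce to coordinate discs, where cells can be counted and boxes measured.\<close>

lemma disc_subspace_isometry:
  fixes S :: "'a::euclidean_space set"
  assumes S: "subspace S" "dim S = d"
  obtains B :: "'a set" and f g :: "'a \<Rightarrow> 'a" where "B \<subseteq> Basis" "card B = d" "linear f" "linear g"
    "\<And>x. x \<in> S \<Longrightarrow> norm (f x) = norm x" "\<And>x. x \<in> S \<Longrightarrow> g (f x) = x"
    "\<And>x. x \<in> coordinate_disc B \<Longrightarrow> g x \<in> S \<and> f (g x) = x \<and> norm (g x) = norm x"
    "\<And>x. x \<in> S \<Longrightarrow> norm x \<le> 1 \<Longrightarrow> f x \<in> coordinate_disc B"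
proof -
  have "d \<le> card (Basis :: 'a set)" using dim_subset_UNIV[of S] S(2) by simp
  then obtain B :: "'a set" where B: "B \<subseteq> Basis" "card B = d"
    by (metis obtain_subset_with_card_n)
  define T where "T = {x::'a. \<forall>b\<in>Basis - B. x \<bullet> b = 0}"
  have T: "subspace T" unfolding T_def by (auto simp: subspace_def inner_add_left)
  have dimT: "dim T = d"
  proof -
    have "T = {x. \<forall>i\<in>Basis. i \<notin> B \<longrightarrow> x \<bullet> i = 0}" by (auto simp: T_def)
    then show ?thesis using dim_substandard[OF B(1)] B(2) by simp
  qed
  have dim: "dim S = dim T" using dimT S(2) by simp
  obtain f g where fg: "linear f" "linear g" "f ` S = T" "g ` T = S"
      "\<And>x. x \<in> S \<Longrightarrow> norm (f x) = norm x" "\<And>x. x \<in> T \<Longrightarrow> norm (g x) = norm x"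
      "\<And>x. x \<in> S \<Longrightarrow> g (f x) = x" "\<And>x. x \<in> T \<Longrightarrow> f (g x) = x"
    using isometries_subspaces[OF S(1) T dim] by metis
  have disc: "x \<in> coordinate_disc B \<longleftrightarrow> x \<in> T \<and> norm x \<le> 1" for x
    by (auto simp: coordinate_disc_def T_def)
  show ?thesis
  proof (rule that[OF B fg(1,2,5,7)])
    show "g x \<in> S \<and> f (g x) = x \<and> norm (g x) = norm x" if "x \<in> coordinate_disc B" for x
      using that disc fg by blast
    show "f x \<in> coordinate_disc B" if "x \<in> S" "norm x \<le> 1" for x
      using that disc fg(3,5) by auto
  qed
qed

lemma hausdorff_outer_disc_le:
  fixes S :: "'a::euclidean_space set"
  assumes S: "subspace S" "dim S = d" and d: "0 < d" and c: "c \<in> S" and R: "0 < R"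
  shows "hausdorff_outer d (S \<inter> cball c R) \<le> ennreal (R ^ d * (4 * real d) ^ d)"
proof -
  obtain B :: "'a set" and f g :: "'a \<Rightarrow> 'a" where B: "B \<subseteq> Basis" "card B = d" and lin: "linear f" "linear g"
    and f: "\<And>x. x \<in> S \<Longrightarrow> norm (f x) = norm x" "\<And>x. x \<in> S \<Longrightarrow> g (f x) = x"
    and g: "\<And>x. x \<in> coordinate_disc B \<Longrightarrow> g x \<in> S \<and> f (g x) = x \<and> norm (g x) = norm x"
    and disc: "\<And>x. x \<in> S \<Longrightarrow> norm x \<le> 1 \<Longrightarrow> f x \<in> coordinate_disc B"
    using disc_subspace_isometry[OF S] by blast
  define h where "h x = c + R *\<^sub>R g x" for x
  have "S \<inter> cball c R \<subseteq> h ` coordinate_disc B"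
  proof
    fix x assume x: "x \<in> S \<inter> cball c R"
    define w where "w = (1 / R) *\<^sub>R (x - c)"
    have w: "w \<in> S" "norm w \<le> 1"
      using x c R S(1) by (auto simp: w_def subspace_diff subspace_scale dist_norm norm_minus_commute)
    have "x = h (f w)" using f(2)[OF w(1)] R by (simp add: h_def w_def)
    then show "x \<in> h ` coordinate_disc B" using disc[OF w] by (rule image_eqI)
  qed
  then have "hausdorff_outer d (S \<inter> cball c R) \<le> hausdorff_outer d (h ` coordinate_disc B)"
    by (rule hausdorff_outer_mono)
  also have "\<dots> \<le> ennreal (R ^ d) * hausdorff_outer d (coordinate_disc B)"
  proof (rule hausdorff_outer_lipschitz[OF d R])
    fix x y assume xy: "x \<in> coordinate_disc B" "y \<in> coordinate_disc B"
    then have gxy: "g x \<in> S" "g y \<in> S" "f (g x) = x" "f (g y) = y" using g by blast+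
    have "norm (g x - g y) = norm (f (g x - g y))" using f(1) gxy S(1) by (simp add: subspace_diff)
    also have "\<dots> = norm (x - y)" using gxy by (simp add: linear_diff[OF lin(1)])
    finally have "norm (g x - g y) = norm (x - y)" .
    then show "norm (h x - h y) \<le> R * norm (x - y)"
      using R by (simp add: h_def flip: scaleR_diff_right)
  qed
  also have "\<dots> \<le> ennreal (R ^ d) * ennreal ((4 * real d) ^ d)"
    by (intro mult_left_mono hausdorff_outer_coordinate_disc_le B d) simp
  also have "\<dots> = ennreal (R ^ d * (4 * real d) ^ d)" using R by (simp add: ennreal_mult')
  finally show ?thesis .
qed

lemma hausdorff_outer_disc_pos:
  fixes S :: "'a::euclidean_space set"
  assumes S: "subspace S" "dim S = d" and d: "0 < d" and c: "c \<in> S" and R: "0 < R"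
  shows "0 < hausdorff_outer d (S \<inter> cball c R)"
proof -
  obtain B :: "'a set" and f g :: "'a \<Rightarrow> 'a" where B: "B \<subseteq> Basis" "card B = d" and lin: "linear f" "linear g"
    and f: "\<And>x. x \<in> S \<Longrightarrow> norm (f x) = norm x" "\<And>x. x \<in> S \<Longrightarrow> g (f x) = x"
    and g: "\<And>x. x \<in> coordinate_disc B \<Longrightarrow> g x \<in> S \<and> f (g x) = x \<and> norm (g x) = norm x"
    and disc: "\<And>x. x \<in> S \<Longrightarrow> norm x \<le> 1 \<Longrightarrow> f x \<in> coordinate_disc B"
    using disc_subspace_isometry[OF S] by blast
  define h where "h x = (1 / R) *\<^sub>R f (x - c)" for x
  have "coordinate_disc B \<subseteq> h ` (S \<inter> cball c R)"
  proof
    fix x assume x: "x \<in> coordinate_disc B"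
    have "norm x \<le> 1" using x by (simp add: coordinate_disc_def)
    have "c + R *\<^sub>R g x \<in> S \<inter> cball c R"
      using g[OF x] \<open>norm x \<le> 1\<close> R c S(1) by (simp add: subspace_add subspace_scale dist_norm)
    moreover have "x = h (c + R *\<^sub>R g x)" using g[OF x] R by (simp add: h_def linear_scale[OF lin(1)])
    ultimately show "x \<in> h ` (S \<inter> cball c R)" by blast
  qed
  then have "hausdorff_outer d (coordinate_disc B) \<le> hausdorff_outer d (h ` (S \<inter> cball c R))"
    by (rule hausdorff_outer_mono)
  also have "\<dots> \<le> ennreal ((1 / R) ^ d) * hausdorff_outer d (S \<inter> cball c R)"
  proof (rule hausdorff_outer_lipschitz[OF d])
    fix x y assume xy: "x \<in> S \<inter> cball c R" "y \<in> S \<inter> cball c R"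
    have "norm (f (x - c) - f (y - c)) = norm (f (x - y))" by (simp flip: linear_diff[OF lin(1)])
    also have "\<dots> = norm (x - y)" using xy S(1) by (intro f subspace_diff) auto
    finally show "norm (h x - h y) \<le> 1 / R * norm (x - y)"
      using R unfolding h_def scaleR_diff_right[symmetric] by simp
  qed (use R in simp)
  finally have "hausdorff_outer d (coordinate_disc B) \<le> ennreal ((1 / R) ^ d) * hausdorff_outer d (S \<inter> cball c R)" .
  with hausdorff_outer_coordinate_disc_pos[OF B d] have "0 < ennreal ((1 / R) ^ d) * hausdorff_outer d (S \<inter> cball c R)"
    by (rule less_le_trans)
  then show ?thesis by (simp add: ennreal_zero_less_mult_iff)
qed

section \<open>Slice charts as bi-Lipschitz maps\<close>

lemma smooth_on_lipschitz_ball: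
  fixes f :: "'a::euclidean_space \<Rightarrow> 'b::euclidean_space"
  assumes f: "smooth_on U f" and U: "open U" "x \<in> U"
  obtains \<rho> L where "0 < \<rho>" "0 < L" "cball x \<rho> \<subseteq> U"
    "\<And>y z. y \<in> cball x \<rho> \<Longrightarrow> z \<in> cball x \<rho> \<Longrightarrow> norm (f y - f z) \<le> L * norm (y - z)"
proof -
  obtain \<rho> where \<rho>: "0 < \<rho>" "cball x \<rho> \<subseteq> U" using U open_contains_cball by blast
  have f1: "ck_on (Suc 0) f U" using f unfolding smooth_on_def by blast
  obtain L where L: "0 < L" "\<forall>y\<in>cball x \<rho>. \<forall>v. norm (frechet_derivative f (at y) v) \<le> L * norm v"
    using ck_on_derivative_bounded[OF f1 compact_cball \<rho>(2)] by blast
  have "norm (f y - f z) \<le> L * norm (y - z)" if "y \<in> cball x \<rho>" "z \<in> cball x \<rho>" for y z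
  proof (rule differentiable_bound[OF convex_cball _ _ that])
    fix w assume w: "w \<in> cball x \<rho>"
    show "(f has_derivative frechet_derivative f (at w)) (at w within cball x \<rho>)"
      using ck_on_Suc_derivative[OF f1] \<rho>(2) w by (blast intro: has_derivative_at_withinI)
    show "onorm (frechet_derivative f (at w)) \<le> L" using L(2) w by (intro onorm_le) blast
  qed
  with \<rho> L(1) that show ?thesis by blast
qed

lemma smooth_submanifold_chart:
  fixes M :: "'a::euclidean_space set"
  assumes "smooth_submanifold d M" "x \<in> M"
  obtains U V \<phi> \<psi> and S :: "'a set" where "open U" "open V" "x \<in> U" "homeomorphism U V \<phi> \<psi>" "smooth_on U \<phi>" "smooth_on V \<psi>"
    "subspace S" "dim S = d" "\<phi> ` (U \<inter> M) = V \<inter> S"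
proof -
  from bspec[OF assms(1)[unfolded smooth_submanifold_def] assms(2)] show ?thesis
    by (elim exE conjE) (rule that; assumption)
qed

text \<open>Near \<open>x\<close> the chart and its inverse are Lipschitz, so a small ball of
  \<open>M\<close> lies in the image of a flat disc of comparable radius. As \<open>K\<close> is
  independent of \<open>\<delta>\<close>, a bump of width \<open>\<delta>\<close> affects mass of
  order \<open>\<delta> ^ d\<close> only.\<close>

lemma hausdorff_outer_manifold_ball:
  fixes M :: "'a::euclidean_space set"
  assumes M: "smooth_submanifold d M" and x: "x \<in> M" and d: "0 < d"
  obtains \<rho> K where "0 < \<rho>" "0 < K"
    "\<And>\<delta>. 0 < \<delta> \<Longrightarrow> \<delta> \<le> \<rho> \<Longrightarrow> hausdorff_outer d (M \<inter> ball x \<delta>) \<le> ennreal (K * \<delta> ^ d)"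
proof -
  obtain U V :: "'a set" and \<phi> \<psi> and S :: "'a set" where ch: "open U" "open V" "x \<in> U" "homeomorphism U V \<phi> \<psi>"
    "smooth_on U \<phi>" "smooth_on V \<psi>" "subspace S" "dim S = d" "\<phi> ` (U \<inter> M) = V \<inter> S"
    using smooth_submanifold_chart[OF M x] .
  have \<phi>x: "\<phi> x \<in> V" "\<phi> x \<in> S" using ch(9) x ch(3) by blast+
  have \<psi>\<phi>: "\<psi> (\<phi> y) = y" if "y \<in> U" for y using ch(4) that by (simp add: homeomorphism_def)
  obtain r1 L1 where 1: "0 < r1" "0 < L1" "cball x r1 \<subseteq> U"
    "\<And>y z. y \<in> cball x r1 \<Longrightarrow> z \<in> cball x r1 \<Longrightarrow> norm (\<phi> y - \<phi> z) \<le> L1 * norm (y - z)"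
    using smooth_on_lipschitz_ball[OF ch(5,1,3)] by blast
  obtain r2 L2 where 2: "0 < r2" "0 < L2" "cball (\<phi> x) r2 \<subseteq> V"
    "\<And>y z. y \<in> cball (\<phi> x) r2 \<Longrightarrow> z \<in> cball (\<phi> x) r2 \<Longrightarrow> norm (\<psi> y - \<psi> z) \<le> L2 * norm (y - z)"
    using smooth_on_lipschitz_ball[OF ch(6,2) \<phi>x(1)] by blast
  define \<rho> where "\<rho> = min r1 (r2 / L1)"
  define K where "K = L2 ^ d * (L1 ^ d * (4 * real d) ^ d)"
  show ?thesis
  proof (rule that[of \<rho> K])
    show "0 < \<rho>" using 1 2 by (simp add: \<rho>_def)
    show "0 < K" using 1 2 d by (simp add: K_def)
    fix \<delta> assume \<delta>: "0 < \<delta>" "\<delta> \<le> \<rho>"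
    then have \<delta>': "\<delta> \<le> r1" "L1 * \<delta> \<le> r2" using 1 by (auto simp: \<rho>_def field_simps)
    have "M \<inter> ball x \<delta> \<subseteq> \<psi> ` (S \<inter> cball (\<phi> x) (L1 * \<delta>))"
    proof
      fix y assume y: "y \<in> M \<inter> ball x \<delta>"
      then have yU: "y \<in> U" "y \<in> cball x r1" using 1(3) \<delta>' by auto
      then have "\<phi> y \<in> S" using ch(9) y by blast
      moreover have "norm (\<phi> y - \<phi> x) \<le> L1 * norm (y - x)" using 1(1) by (intro 1(4) yU) auto
      moreover have "L1 * norm (y - x) \<le> L1 * \<delta>"
        using y 1(2) by (intro mult_left_mono) (auto simp: dist_norm norm_minus_commute)
      ultimately have "\<phi> y \<in> S \<inter> cball (\<phi> x) (L1 * \<delta>)" by (simp add: dist_norm norm_minus_commute)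
      with \<psi>\<phi>[OF yU(1)] show "y \<in> \<psi> ` (S \<inter> cball (\<phi> x) (L1 * \<delta>))" by (metis image_eqI)
    qed
    then have "hausdorff_outer d (M \<inter> ball x \<delta>) \<le> hausdorff_outer d (\<psi> ` (S \<inter> cball (\<phi> x) (L1 * \<delta>)))"
      by (rule hausdorff_outer_mono)
    also have "\<dots> \<le> ennreal (L2 ^ d) * hausdorff_outer d (S \<inter> cball (\<phi> x) (L1 * \<delta>))"
      using \<delta>' by (intro hausdorff_outer_lipschitz[OF d 2(2)] 2(4)) auto
    also have "\<dots> \<le> ennreal (L2 ^ d) * ennreal ((L1 * \<delta>) ^ d * (4 * real d) ^ d)"
      using \<delta> 1 by (intro mult_left_mono hausdorff_outer_disc_le ch(7,8) d \<phi>x) auto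
    also have "\<dots> = ennreal (K * \<delta> ^ d)"
      using 2 by (simp add: K_def ennreal_mult'[symmetric] power_mult_distrib mult_ac)
    finally show "hausdorff_outer d (M \<inter> ball x \<delta>) \<le> ennreal (K * \<delta> ^ d)" .
  qed
qed

text \<open>A Lipschitz chart cannot map a null set onto a flat disc of positive measure. With
  finiteness below, this makes the uniform law on \<open>M\<close> a probability.\<close>

lemma hausdorff_outer_manifold_pos:
  fixes M :: "'a::euclidean_space set"
  assumes M: "smooth_submanifold d M" and x: "x \<in> M" and d: "0 < d"
  shows "0 < hausdorff_outer d M"
proof -
  obtain U V :: "'a set" and \<phi> \<psi> and S :: "'a set" where ch: "open U" "open V" "x \<in> U" "homeomorphism U V \<phi> \<psi>"
    "smooth_on U \<phi>" "smooth_on V \<psi>" "subspace S" "dim S = d" "\<phi> ` (U \<inter> M) = V \<inter> S"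
    using smooth_submanifold_chart[OF M x] .
  have \<phi>x: "\<phi> x \<in> V" "\<phi> x \<in> S" using ch(9) x ch(3) by blast+
  have \<psi>\<phi>: "\<psi> (\<phi> y) = y" if "y \<in> U" for y using ch(4) that by (simp add: homeomorphism_def)
  obtain r1 L1 where 1: "0 < r1" "0 < L1" "cball x r1 \<subseteq> U"
    "\<And>y z. y \<in> cball x r1 \<Longrightarrow> z \<in> cball x r1 \<Longrightarrow> norm (\<phi> y - \<phi> z) \<le> L1 * norm (y - z)"
    using smooth_on_lipschitz_ball[OF ch(5,1,3)] by blast
  obtain r2 L2 where 2: "0 < r2" "0 < L2" "cball (\<phi> x) r2 \<subseteq> V"
    "\<And>y z. y \<in> cball (\<phi> x) r2 \<Longrightarrow> z \<in> cball (\<phi> x) r2 \<Longrightarrow> norm (\<psi> y - \<psi> z) \<le> L2 * norm (y - z)"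
    using smooth_on_lipschitz_ball[OF ch(6,2) \<phi>x(1)] by blast
  \<comment> \<open>Small enough for the inverse chart to land within \<open>r1\<close> of
    \<open>x\<close>, where \<open>\<phi>\<close> is Lipschitz.\<close>
  define \<eta> where "\<eta> = min r2 (r1 / L2)"
  have \<eta>: "0 < \<eta>" "\<eta> \<le> r2" "L2 * \<eta> \<le> r1" using 1 2 by (auto simp: \<eta>_def min_def field_simps)
  have "S \<inter> cball (\<phi> x) \<eta> \<subseteq> \<phi> ` (M \<inter> cball x r1)"
  proof
    fix y assume y: "y \<in> S \<inter> cball (\<phi> x) \<eta>"
    then have y2: "y \<in> cball (\<phi> x) r2" using \<eta> by auto
    then have "y \<in> V \<inter> S" using y 2(3) by blast
    then obtain m where m: "m \<in> U" "m \<in> M" "y = \<phi> m" unfolding ch(9)[symmetric] by blast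
    have "norm (\<psi> y - \<psi> (\<phi> x)) \<le> L2 * norm (y - \<phi> x)" using 2(1) y2 by (intro 2(4)) auto
    also have "\<dots> \<le> L2 * \<eta>"
      using y 2(2) by (intro mult_left_mono) (auto simp: dist_norm norm_minus_commute)
    also have "\<dots> \<le> r1" by (rule \<eta>)
    finally have "m \<in> cball x r1" using m \<psi>\<phi> ch(3) by (simp add: dist_norm norm_minus_commute)
    then show "y \<in> \<phi> ` (M \<inter> cball x r1)" using m by blast
  qed
  then have "hausdorff_outer d (S \<inter> cball (\<phi> x) \<eta>) \<le> hausdorff_outer d (\<phi> ` (M \<inter> cball x r1))"
    by (rule hausdorff_outer_mono)
  also have "\<dots> \<le> ennreal (L1 ^ d) * hausdorff_outer d (M \<inter> cball x r1)"
    by (intro hausdorff_outer_lipschitz[OF d 1(2)] 1(4)) auto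
  finally have "0 < ennreal (L1 ^ d) * hausdorff_outer d (M \<inter> cball x r1)"
    using hausdorff_outer_disc_pos[OF ch(7,8) d \<phi>x(2) \<eta>(1)] by (rule less_le_trans[rotated])
  then have "0 < hausdorff_outer d (M \<inter> cball x r1)" by (simp add: ennreal_zero_less_mult_iff)
  also have "\<dots> \<le> hausdorff_outer d M" by (rule hausdorff_outer_mono) simp
  finally show ?thesis .
qed

lemma hausdorff_outer_finite_union:
  assumes d: "0 < d" and "finite I" "\<And>i. i \<in> I \<Longrightarrow> hausdorff_outer d (A i) < top"
  shows "hausdorff_outer d (\<Union>i\<in>I. A i) < top"
  using assms(2,3)
proof (induction I rule: finite_induct)
  case empty
  then show ?case by (simp add: hausdorff_outer_empty[OF d])
next
  case (insert i I)
  have "hausdorff_outer d (\<Union>i\<in>insert i I. A i) \<le> hausdorff_outer d (A i) + hausdorff_outer d (\<Union>i\<in>I. A i)"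
    using hausdorff_outer_subadditive2[OF d, of "A i" "\<Union>i\<in>I. A i"] by simp
  also have "\<dots> < top" using insert by simp
  finally show ?case .
qed

lemma hausdorff_outer_compact_manifold_finite:
  fixes M :: "'a::euclidean_space set"
  assumes M: "smooth_submanifold d M" "compact M" and d: "0 < d"
  shows "hausdorff_outer d M < top"
proof -
  have "\<exists>\<rho>>0. hausdorff_outer d (M \<inter> ball x \<rho>) < top" if "x \<in> M" for x
    using hausdorff_outer_manifold_ball[OF M(1) that d]
    by (metis order_refl ennreal_less_top le_less_trans)
  then obtain \<rho> where \<rho>: "\<And>x. x \<in> M \<Longrightarrow> 0 < \<rho> x" "\<And>x. x \<in> M \<Longrightarrow> hausdorff_outer d (M \<inter> ball x (\<rho> x)) < top"
    by metis
  obtain T where T: "T \<subseteq> M" "finite T" "M \<subseteq> (\<Union>x\<in>T. ball x (\<rho> x))"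
    by (rule compactE_image[OF M(2), of M "\<lambda>x. ball x (\<rho> x)"]) (use \<rho> in auto)
  have "hausdorff_outer d M \<le> hausdorff_outer d (\<Union>x\<in>T. M \<inter> ball x (\<rho> x))"
    using T(3) by (intro hausdorff_outer_mono) auto
  also have "\<dots> < top"
    using T \<rho> by (intro hausdorff_outer_finite_union d) auto
  finally show ?thesis .
qed

text \<open>A slice chart is a homeomorphism between open sets of the ambient space, so a ball
  inside \<open>M\<close> would have an open image inside a proper subspace.\<close>

lemma smooth_submanifold_not_contains_ball:
  fixes M :: "'a::euclidean_space set"
  assumes M: "smooth_submanifold d M" and d: "d < DIM('a)" and e: "0 < e"
  shows "\<not> ball x e \<subseteq> M"
proof
  assume sub: "ball x e \<subseteq> M"
  then have x: "x \<in> M" using e by auto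
  obtain U V :: "'a set" and \<phi> \<psi> and S :: "'a set" where ch: "open U" "open V" "x \<in> U" "homeomorphism U V \<phi> \<psi>"
    "smooth_on U \<phi>" "smooth_on V \<psi>" "subspace S" "dim S = d" "\<phi> ` (U \<inter> M) = V \<inter> S"
    using smooth_submanifold_chart[OF M x] .
  have "openin (top_of_set V) (\<phi> ` (U \<inter> ball x e))"
    by (rule homeomorphism_imp_open_map[OF ch(4)]) (simp add: openin_open_Int)
  then have "open (\<phi> ` (U \<inter> ball x e))" using ch(2) openin_open_eq by blast
  moreover have "\<phi> ` (U \<inter> ball x e) \<subseteq> S" using sub ch(9) by blast
  ultimately have "\<phi> ` (U \<inter> ball x e) \<subseteq> interior S" by (simp add: interior_maximal)
  moreover have "interior S = {}" by (rule empty_interior_lowdim) (use ch(8) d in simp)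
  ultimately show False using ch(3) e by auto
qed


section \<open>The two-point bound\<close>

text \<open>Fubini replaces one coordinate at a time. The total mass of \<open>N\<close> may be
  below 1, which is the case of a common minorant of two different laws.\<close>

lemma nn_integral_PiM_mono_measure:
  fixes f :: "('i \<Rightarrow> 'a) \<Rightarrow> ennreal"
  assumes N: "finite_measure N" and Q: "finite_measure Q" and sets: "sets N = sets Q" and le: "N \<le> Q"
    and "finite I" and f: "f \<in> borel_measurable (Pi\<^sub>M I (\<lambda>_. Q))"
  shows "(\<integral>\<^sup>+x. f x \<partial>Pi\<^sub>M I (\<lambda>_. N)) \<le> (\<integral>\<^sup>+x. f x \<partial>Pi\<^sub>M I (\<lambda>_. Q))"
  using \<open>finite I\<close> f
proof (induction I arbitrary: f rule: finite_induct)
  case empty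
  then show ?case by (simp add: PiM_empty)
next
  case (insert i I)
  interpret N: finite_measure N by fact
  interpret Q: finite_measure Q by fact
  interpret NN: product_sigma_finite "\<lambda>_::'i. N" by standard
  interpret QQ: product_sigma_finite "\<lambda>_::'i. Q" by standard
  have same: "sets (Pi\<^sub>M J (\<lambda>_::'i. N)) = sets (Pi\<^sub>M J (\<lambda>_. Q))" for J
    by (intro sets_PiM_cong) (auto simp: sets)
  have fN: "f \<in> borel_measurable (Pi\<^sub>M (insert i I) (\<lambda>_. N))"
    using insert.prems by (simp only: measurable_cong_sets[OF same refl])
  have pair: "(\<lambda>(x, y). f (x(i := y))) \<in> borel_measurable (Pi\<^sub>M I (\<lambda>_. Q) \<Otimes>\<^sub>M Q)"
  proof -
    have "(\<lambda>w. (fst w)(i := snd w)) \<in> measurable (Pi\<^sub>M I (\<lambda>_. Q) \<Otimes>\<^sub>M Q) (Pi\<^sub>M (insert i I) (\<lambda>_. Q))"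
      using measurable_add_dim[of i I "\<lambda>_. Q"] by (simp add: case_prod_unfold)
    from measurable_compose[OF this insert.prems] show ?thesis unfolding case_prod_unfold .
  qed
  have g: "(\<lambda>x. \<integral>\<^sup>+y. f (x(i := y)) \<partial>Q) \<in> borel_measurable (Pi\<^sub>M I (\<lambda>_. Q))"
    using Q.borel_measurable_nn_integral[OF pair] .
  have "(\<integral>\<^sup>+x. f x \<partial>Pi\<^sub>M (insert i I) (\<lambda>_. N)) = (\<integral>\<^sup>+x. (\<integral>\<^sup>+y. f (x(i := y)) \<partial>N) \<partial>Pi\<^sub>M I (\<lambda>_. N))"
    by (rule NN.product_nn_integral_insert[OF insert.hyps(1,2) fN])
  also have "\<dots> \<le> (\<integral>\<^sup>+x. (\<integral>\<^sup>+y. f (x(i := y)) \<partial>Q) \<partial>Pi\<^sub>M I (\<lambda>_. N))"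
    by (intro nn_integral_mono nn_integral_mono_measure sets le)
  also have "\<dots> \<le> (\<integral>\<^sup>+x. (\<integral>\<^sup>+y. f (x(i := y)) \<partial>Q) \<partial>Pi\<^sub>M I (\<lambda>_. Q))"
    by (rule insert.IH[OF g])
  also have "\<dots> = (\<integral>\<^sup>+x. f x \<partial>Pi\<^sub>M (insert i I) (\<lambda>_. Q))"
    by (rule QQ.product_nn_integral_insert[OF insert.hyps(1,2) insert.prems, symmetric])
  finally show ?case .
qed

text \<open>The triangle inequality through a point of \<open>B\<close>. It holds for every set
  \<open>B\<close>, hence pointwise for every value of an estimator, and is trivial when one of the
  distances is infinite.\<close>

lemma hausdorff_distance_separation:
  fixes A B C :: "'a::metric_space set"
  assumes p: "p \<in> A" and far: "\<And>c. c \<in> C \<Longrightarrow> \<eta> \<le> dist c p"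
  shows "ennreal (\<eta> / 2) \<le> hausdorff_distance B A + hausdorff_distance B C"
proof (rule ccontr)
  assume "\<not> ?thesis"
  then have lt: "hausdorff_distance B A + hausdorff_distance B C < ennreal (\<eta> / 2)" by simp
  have "hausdorff_distance B A < ennreal (\<eta> / 2)" "hausdorff_distance B C < ennreal (\<eta> / 2)"
    using lt by (rule le_less_trans[rotated], simp)+
  then obtain r s where r: "0 < r" "A \<subseteq> tube B r" "ennreal r < ennreal (\<eta> / 2)"
    and s: "0 < s" "B \<subseteq> tube C s" "ennreal s < ennreal (\<eta> / 2)"
    unfolding hausdorff_distance_def Inf_less_iff by blast
  have rs: "r < \<eta> / 2" "s < \<eta> / 2" using r s by (simp_all add: ennreal_less_iff)
  obtain b where b: "b \<in> B" "dist b p < r" using p r(2) by (auto simp: tube_def)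
  then obtain c where c: "c \<in> C" "dist c b < s" using s(2) by (auto simp: tube_def)
  have "dist c p \<le> dist c b + dist b p" by (rule dist_triangle)
  then show False using far[OF c(1)] b c rs by simp
qed

lemma uniform_in_clutter_model:
  fixes K :: "'a::euclidean_space set"
  assumes M: "M \<in> manifolds_in d \<kappa> K" "M \<in> sets borel" and d: "0 < d"
    and H: "0 < hausdorff_outer d M" "hausdorff_outer d M < top" and b: "b \<le> 1" "1 \<le> B"
  shows "(M, clutter_mixture \<pi> K (uniform_measure (hausdorff_measure d) M)) \<in> clutter_model d \<kappa> K b B \<pi>"
proof -
  let ?G = "uniform_measure (hausdorff_measure d) M"
  have "prob_space ?G"
    by (rule prob_space_uniform_measure) (use H M in \<open>auto simp: emeasure_hausdorff_measure[OF d]\<close>)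
  moreover have "?G = density ?G (\<lambda>y. ennreal 1)" by (simp add: density_1)
  ultimately have "?G \<in> manifold_distributions d b B M"
    unfolding manifold_distributions_def using b by (auto intro!: exI[of _ "\<lambda>_. 1"])
  then show ?thesis unfolding clutter_model_def using M(1) by blast
qed

text \<open>Le Cam's two-point bound with the common part of the two uniform laws, the normalised
  Hausdorff measure on \<open>W\<close>, as a minorant.\<close>

lemma two_point_risk_bound:
  fixes K M0 M1 W :: "'a::euclidean_space set"
  assumes d: "0 < d" and K: "compact K" "interior K \<noteq> {}" and \<pi>: "0 < \<pi>" "\<pi> \<le> 1" and b: "b \<le> 1" "1 \<le> B"
    and M0: "M0 \<in> manifolds_in d \<kappa> K" "M0 \<in> sets borel" and M1: "M1 \<in> manifolds_in d \<kappa> K" "M1 \<in> sets borel"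
    and W: "W \<in> sets borel" "W \<subseteq> M0" "W \<subseteq> M1"
    and m: "hausdorff_outer d M0 \<le> ennreal m" "hausdorff_outer d M1 \<le> ennreal m"
    and w: "0 < w" "w \<le> m" "ennreal w \<le> hausdorff_outer d W"
    and p: "p \<in> M0" "\<And>x. x \<in> M1 \<Longrightarrow> \<eta> \<le> dist x p" and \<eta>: "0 \<le> \<eta>"
    and Mh: "Mh \<in> estimators d \<kappa> K n"
  shows "ennreal (\<eta> / 4 * (1 - \<pi> + \<pi> * (w / m)) ^ n)
    \<le> (SUP (M, Q)\<in>clutter_model d \<kappa> K b B \<pi>. risk n Mh M Q)"
proof -
  let ?H = "hausdorff_measure d :: 'a measure"
  let ?Q = "\<lambda>M. clutter_mixture \<pi> K (uniform_measure ?H M)"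
  \<comment> \<open>A sub-probability below both uniform laws: \<open>m\<close> bounds both total
    masses, and \<open>W\<close> lies in both manifolds.\<close>
  define G where "G = scale_measure (inverse (ennreal m)) (density ?H (indicator W))"
  define N where "N = clutter_mixture \<pi> K G"
  \<comment> \<open>A lower bound for the total mass of \<open>N\<close>, so that
    \<open>q ^ n\<close> bounds the mass of the product from below.\<close>
  define q where "q = 1 - \<pi> + \<pi> * (w / m)"
  have m0: "0 < m" using w by simp
  have q0: "0 \<le> q" using \<pi> w m0 by (simp add: q_def)
  have setsG: "sets G = sets borel" by (simp add: G_def)
  have G: "emeasure G A = inverse (ennreal m) * hausdorff_outer d (W \<inter> A)" if "A \<in> sets borel" for A
    using that W(1) by (simp add: G_def emeasure_restricted emeasure_hausdorff_measure[OF d])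
  have U: "emeasure (uniform_measure lborel K) UNIV = 1"
  proof -
    have "emeasure lborel K < top" 
      using emeasure_bounded_finite[OF compact_imp_bounded[OF K(1)]] by simp
    moreover have "emeasure lborel K \<noteq> 0"
    proof -
      obtain x e where "0 < e" "ball x e \<subseteq> K" using K(2) by (meson all_not_in_conv mem_interior)
      moreover have "emeasure lborel (ball x e) \<noteq> 0"
        using content_ball_pos[OF \<open>0 < e\<close>, of x] by (auto simp: measure_def)
      ultimately show ?thesis
        using emeasure_mono[of "ball x e" K lborel] K(1) by (auto simp: compact_imp_closed)
    qed
    ultimately have "prob_space (uniform_measure lborel K)"
      by (intro prob_space_uniform_measure) auto
    from prob_space.emeasure_space_1[OF this] show ?thesis
      by (simp only: space_uniform_measure space_lborel space_borel)
  qed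
  have Hfin: "hausdorff_outer d M < top" "0 < hausdorff_outer d M" and dom: "N \<le> ?Q M"
    and fin: "finite_measure (?Q M)" and model: "(M, ?Q M) \<in> clutter_model d \<kappa> K b B \<pi>"
    if M: "M \<in> manifolds_in d \<kappa> K" "M \<in> sets borel" "W \<subseteq> M" "hausdorff_outer d M \<le> ennreal m" for M
  proof -
    show H1: "hausdorff_outer d M < top" using M(4) by (rule le_less_trans) simp
    have "ennreal w \<le> hausdorff_outer d M" using w(3) hausdorff_outer_mono[OF M(3)] by (rule order_trans)
    then show H2: "0 < hausdorff_outer d M" using w(1) ennreal_less_zero_iff[of w] by (meson less_le_trans)
    obtain h where h: "hausdorff_outer d M = ennreal h" "0 < h"
      using H1 H2 by (cases "hausdorff_outer d M") auto
    have hm: "h \<le> m" using M(4) h m0 by (simp add: ennreal_le_iff)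
    show "N \<le> ?Q M"
      unfolding N_def
    proof (subst le_measure, simp, intro ballI)
      fix A assume "A \<in> sets (clutter_mixture \<pi> K G)"
      then have A: "A \<in> sets borel" by simp
      have "emeasure G A = inverse (ennreal m) * hausdorff_outer d (W \<inter> A)" by (rule G[OF A])
      also have "\<dots> \<le> inverse (ennreal h) * hausdorff_outer d (M \<inter> A)"
        using hm h(2) m0 M(3)
        by (intro mult_mono hausdorff_outer_mono) (auto simp: inverse_ennreal le_imp_inverse_le ennreal_leI)
      also have "\<dots> = emeasure (uniform_measure ?H M) A"
        using A M(2) h(1) by (simp add: emeasure_hausdorff_measure[OF d] divide_ennreal_def mult.commute)
      finally show "emeasure (clutter_mixture \<pi> K G) A \<le> emeasure (?Q M) A"
        using A by (simp add: emeasure_clutter_mixture setsG) (intro disjI2 mult_left_mono, auto)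
    qed
    show mod: "(M, ?Q M) \<in> clutter_model d \<kappa> K b B \<pi>"
      by (rule uniform_in_clutter_model[OF M(1,2) d H2 H1 b])
    have "prob_space (uniform_measure ?H M)"
      by (rule prob_space_uniform_measure) (use H1 H2 M in \<open>auto simp: emeasure_hausdorff_measure[OF d]\<close>)
    from prob_space.emeasure_space_1[OF this] have "emeasure (uniform_measure ?H M) UNIV = 1"
      by (simp only: space_uniform_measure space_hausdorff_measure)
    then have "emeasure (?Q M) UNIV = ennreal (1 - \<pi>) * 1 + ennreal \<pi> * 1"
      by (simp add: emeasure_clutter_mixture U)
    then show "finite_measure (?Q M)"
      by (intro finite_measureI) simp
  qed
  have N_UNIV: "ennreal q \<le> emeasure N UNIV"
  proof -
    have "ennreal q = ennreal (1 - \<pi>) + ennreal \<pi> * (inverse (ennreal m) * ennreal w)"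
      unfolding q_def using \<pi> w m0
      by (simp add: inverse_ennreal ennreal_mult'[symmetric] ennreal_plus[symmetric] field_simps del: ennreal_plus)
    also have "\<dots> \<le> ennreal (1 - \<pi>) * 1 + ennreal \<pi> * (inverse (ennreal m) * hausdorff_outer d W)"
      by (intro add_mono mult_left_mono w) auto
    also have "\<dots> = emeasure N UNIV"
      by (simp add: N_def emeasure_clutter_mixture setsG U G)
    finally show ?thesis .
  qed
  have setsN: "sets N = sets (?Q M)" for M by (simp add: N_def)
  have finN: "finite_measure N"
  proof -
    interpret Q: finite_measure "?Q M0" by (rule fin[OF M0 W(2) m(1)])
    have "emeasure N UNIV \<le> emeasure (?Q M0) UNIV"
      using dom[OF M0 W(2) m(1)] le_measure[OF setsN, of M0] by (simp add: N_def)
    also have "\<dots> < top" by (rule less_top[THEN iffD1, OF Q.emeasure_finite])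
    finally show ?thesis by (intro finite_measureI) (simp add: N_def)
  qed
  let ?P = "Pi\<^sub>M {..<n} (\<lambda>_. N)"
  let ?loss = "\<lambda>M y. hausdorff_distance (Mh y) M"
  \<comment> \<open>Losses are measurable for the product of Borel algebras. A product algebra
    depends only on the algebras of its factors, so this carries over to \<open>N\<close> and to the
    laws of the model.\<close>
  have meas: "?loss M \<in> borel_measurable (Pi\<^sub>M {..<n} (\<lambda>_. R))"
    if "M \<in> manifolds_in d \<kappa> K" "sets R = sets borel" for M R
  proof -
    have "sets (Pi\<^sub>M {..<n} (\<lambda>_. R)) = sets (Pi\<^sub>M {..<n} (\<lambda>_. borel :: 'a measure))"
      by (intro sets_PiM_cong) (auto simp: that)
    then show ?thesis using Mh that(1) unfolding estimators_def by (simp cong: measurable_cong_sets)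
  qed
  have risk_ge: "(\<integral>\<^sup>+y. ?loss M y \<partial>?P) \<le> (SUP (M, Q)\<in>clutter_model d \<kappa> K b B \<pi>. risk n Mh M Q)"
    if M: "M \<in> manifolds_in d \<kappa> K" "M \<in> sets borel" "W \<subseteq> M" "hausdorff_outer d M \<le> ennreal m" for M
  proof -
    have "(\<integral>\<^sup>+y. ?loss M y \<partial>?P) \<le> risk n Mh M (?Q M)"
      unfolding risk_def
      by (rule nn_integral_PiM_mono_measure[OF finN fin[OF M] setsN dom[OF M]])
         (auto intro: meas M(1))
    also have "\<dots> \<le> (SUP (M, Q)\<in>clutter_model d \<kappa> K b B \<pi>. risk n Mh M Q)"
      by (rule SUP_upper2[OF model[OF M]]) simp
    finally show ?thesis .
  qed
  interpret N: finite_measure N by (rule finN)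
  interpret NN: product_sigma_finite "\<lambda>_::nat. N" by standard
  have spaceP: "emeasure ?P (space ?P) = emeasure N UNIV ^ n"
  proof -
    have "space ?P = (\<Pi>\<^sub>E i\<in>{..<n}. UNIV)" by (simp add: space_PiM N_def)
    moreover have "emeasure ?P (\<Pi>\<^sub>E i\<in>{..<n}. UNIV) = (\<Prod>i\<in>{..<n}. emeasure N UNIV)"
      by (rule NN.emeasure_PiM) (auto simp: N_def)
    ultimately show ?thesis by simp
  qed
  have "ennreal (\<eta> / 2 * q ^ n) = ennreal (\<eta> / 2) * ennreal q ^ n"
    unfolding ennreal_power[OF q0] by (rule ennreal_mult) (use q0 \<eta> in auto)
  also have "\<dots> \<le> ennreal (\<eta> / 2) * emeasure ?P (space ?P)"
    unfolding spaceP by (intro mult_left_mono power_mono N_UNIV) auto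
  also have "\<dots> = (\<integral>\<^sup>+y. ennreal (\<eta> / 2) \<partial>?P)" by simp
  \<comment> \<open>With one measure for both losses, separation is applied sample by
    sample.\<close>
  also have "\<dots> \<le> (\<integral>\<^sup>+y. ?loss M0 y + ?loss M1 y \<partial>?P)"
    by (intro nn_integral_mono hausdorff_distance_separation[OF p])
  also have "\<dots> = (\<integral>\<^sup>+y. ?loss M0 y \<partial>?P) + (\<integral>\<^sup>+y. ?loss M1 y \<partial>?P)"
    by (intro nn_integral_add meas M0 M1) (simp_all add: N_def)
  also have "\<dots> \<le> (SUP (M, Q)\<in>clutter_model d \<kappa> K b B \<pi>. risk n Mh M Q)
      + (SUP (M, Q)\<in>clutter_model d \<kappa> K b B \<pi>. risk n Mh M Q)"
    by (intro add_mono risk_ge M0 M1 W m)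
  finally have sum: "ennreal (\<eta> / 2 * q ^ n) \<le> (SUP (M, Q)\<in>clutter_model d \<kappa> K b B \<pi>. risk n Mh M Q)
      + (SUP (M, Q)\<in>clutter_model d \<kappa> K b B \<pi>. risk n Mh M Q)" .
  \<comment> \<open>The supremum may be infinite, so halving needs a case distinction.\<close>
  have half: "ennreal (a / 4 * x) \<le> s" if "ennreal (a / 2 * x) \<le> s + s" "0 \<le> a" "0 \<le> x" for a x s
  proof (cases s)
    case (real r)
    then have "a / 2 * x \<le> r + r" using that by (simp flip: ennreal_plus)
    then show ?thesis using real by (simp add: ennreal_leI)
  qed simp
  show ?thesis
    using half[OF sum \<eta>] q0 unfolding q_def[symmetric] by simp
qed

text \<open>A point \<open>z\<close> off \<open>M\<close> within \<epsilon>/2 of \<open>p0\<close>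
  has its nearest point \<open>p\<close> within \<epsilon> of \<open>p0\<close>, hence still in the
  interior of \<open>K\<close>. The empty ball about \<open>z\<close> through \<open>p\<close> has
  radius \<open>t\<close>, which gives \<open>C\<close> = 1/(2t): seen along \<open>e\<close>,
  \<open>M\<close> drops below \<open>p\<close> at most quadratically.\<close>

lemma proximal_point_exists:
  fixes M K :: "'a::euclidean_space set"
  assumes M: "closed M" "smooth_submanifold d M" "d < DIM('a)" and p0: "p0 \<in> M" "p0 \<in> interior K"
  obtains p e C where "p \<in> M" "p \<in> interior K" "norm e = 1" "0 < C"
    "\<And>y. y \<in> M \<Longrightarrow> - (C * (norm (y - p))\<^sup>2) \<le> (y - p) \<bullet> e"
proof -
  obtain \<epsilon> where \<epsilon>: "0 < \<epsilon>" "ball p0 \<epsilon> \<subseteq> interior K"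
    using p0(2) open_interior open_contains_ball by blast
  have "\<not> ball p0 (\<epsilon> / 2) \<subseteq> M"
    using smooth_submanifold_not_contains_ball[OF M(2,3)] \<epsilon>(1) by simp
  then obtain z where z: "z \<in> ball p0 (\<epsilon> / 2)" "z \<notin> M" by blast
  obtain p where p: "p \<in> M" "\<And>y. y \<in> M \<Longrightarrow> dist z p \<le> dist z y"
    using distance_attains_inf[OF M(1), of z] p0(1) by blast
  have "dist p0 p \<le> dist p0 z + dist z p" by (rule dist_triangle)
  also have "\<dots> < \<epsilon>" using z(1) p(2)[OF p0(1)] by (simp add: dist_commute)
  finally have pK: "p \<in> interior K" using \<epsilon>(2) by auto
  define t where "t = norm (z - p)"
  have t: "0 < t" using z(2) p(1) by (auto simp: t_def)
  define u where "u = (1 / t) *\<^sub>R (z - p)"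
  have u: "norm u = 1" "z = p + t *\<^sub>R u" using t by (auto simp: u_def t_def)
  show ?thesis
  proof (rule that[of p "- u" "1 / (2 * t)"])
    fix y assume "y \<in> M"
    then have "2 * t * ((y - p) \<bullet> u) \<le> (norm (y - p))\<^sup>2"
      using p(2) closer_iff_proximal[of p t u y] by (simp flip: u(2))
    then show "- (1 / (2 * t) * (norm (y - p))\<^sup>2) \<le> (y - p) \<bullet> (- u)"
      using t by (simp add: field_simps)
  qed (use p(1) pK u t in auto)
qed

text \<open>Points farther than \<open>2 * h p\<close> from \<open>p\<close> move by at most
  \<open>h p\<close> and stay away. Nearer ones keep a height of at least \<open>h p / 2\<close>,
  because \<open>\<epsilon> \<le> 1 / 4\<close>, while the drop along \<open>e\<close> is at most 4
  C (h p)^2, which the constant 16 turns into at most \<open>h p / 4\<close>.\<close>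

lemma push_avoids_center:
  fixes x p e :: "'a::euclidean_space"
  assumes G: "gradient_bound \<epsilon> h G" "\<epsilon> \<le> 1 / 4" and e: "norm e = 1"
    and h: "0 \<le> h x" "h x \<le> h p" "16 * C * h p \<le> 1" "0 < C"
    and prox: "- (C * (norm (x - p))\<^sup>2) \<le> (x - p) \<bullet> e"
  shows "h p / 4 \<le> norm (push h e x - p)"
proof -
  define \<rho> where "\<rho> = norm (x - p)"
  have \<epsilon>0: "0 \<le> \<epsilon>" using G norm_ge_zero unfolding gradient_bound_def by (meson order_trans)
  have eq: "push h e x - p = (x - p) + h x *\<^sub>R e" by (simp add: push_def algebra_simps)
  show ?thesis
  proof (cases "2 * h p \<le> \<rho>")
    case True
    have "\<rho> - h x \<le> norm (push h e x - p)"
      unfolding eq \<rho>_def using norm_diff_ineq[of "x - p" "h x *\<^sub>R e"] e h(1) by simp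
    then show ?thesis using True h by simp
  next
    case False
    have lip: "\<bar>h x - h p\<bar> \<le> \<epsilon> * \<rho>" using G(1) unfolding gradient_bound_def \<rho>_def by blast
    have "\<epsilon> * \<rho> \<le> 1 / 4 * (2 * h p)"
      using False G(2) \<epsilon>0 by (intro mult_mono) (auto simp: \<rho>_def)
    with lip have hx: "h p / 2 \<le> h x" by (simp add: abs_le_iff)
    have "\<rho>\<^sup>2 \<le> (2 * h p)\<^sup>2" using False by (intro power_mono) (auto simp: \<rho>_def)
    then have "C * \<rho>\<^sup>2 \<le> C * (2 * h p)\<^sup>2" using h(4) by (intro mult_left_mono) auto
    also have "\<dots> = (16 * C * h p) * h p / 4" by (simp add: power2_eq_square)
    also have "\<dots> \<le> 1 * h p / 4"
      using h by (intro divide_right_mono mult_right_mono) auto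
    finally have "- (h p / 4) \<le> (x - p) \<bullet> e" using prox by (simp add: \<rho>_def)
    moreover have "(push h e x - p) \<bullet> e = (x - p) \<bullet> e + h x"
      unfolding eq using e by (simp add: inner_add_left norm_eq_1)
    moreover have "(push h e x - p) \<bullet> e \<le> norm (push h e x - p)"
      using norm_cauchy_schwarz[of "push h e x - p" e] e by simp
    ultimately show ?thesis using hx by simp
  qed
qed


section \<open>The perturbed manifold\<close>

text \<open>Points outside the ball are fixed, so by injectivity no point inside can land
  outside.\<close>

lemma push_outside_support:
  assumes g: "\<And>x. g (push h e x) = x" and h: "\<And>x. \<delta> \<le> dist x p \<Longrightarrow> h x = 0"
  shows "push h e ` M - ball p \<delta> = M - ball p \<delta>"
    and "x \<in> ball p \<delta> \<Longrightarrow> push h e x \<in> ball p \<delta>"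
proof -
  have fixed: "push h e x = x" if "x \<notin> ball p \<delta>" for x
    using that h[of x] by (simp add: push_def dist_commute)
  show inside: "push h e x \<in> ball p \<delta>" if x: "x \<in> ball p \<delta>" for x
  proof (rule ccontr)
    assume "push h e x \<notin> ball p \<delta>"
    then have "push h e (push h e x) = push h e x" by (rule fixed)
    then have "push h e x = x" using g by metis
    with x \<open>push h e x \<notin> ball p \<delta>\<close> show False by simp
  qed
  show "push h e ` M - ball p \<delta> = M - ball p \<delta>"
  proof (intro equalityI subsetI)
    fix y assume "y \<in> push h e ` M - ball p \<delta>"
    then obtain x where x: "x \<in> M" "y = push h e x" "y \<notin> ball p \<delta>" by blast
    then have "x \<notin> ball p \<delta>" using inside by blast
    then have "push h e x = x" by (rule fixed)
    then show "y \<in> M - ball p \<delta>" using x by simp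
  next
    fix y assume y: "y \<in> M - ball p \<delta>"
    then have "y \<notin> ball p \<delta>" by blast
    then have "push h e y = y" by (rule fixed)
    then have "y \<in> push h e ` M" using y by (metis DiffD1 imageI)
    with y show "y \<in> push h e ` M - ball p \<delta>" by blast
  qed
qed

lemma ex_small_width:
  fixes a b c :: real
  assumes "0 < \<rho>" "0 < d" "0 < v"
  obtains \<delta> where "0 < \<delta>" "\<delta> \<le> 1" "\<delta> \<le> \<rho>" "a * \<delta>\<^sup>2 \<le> 1" "c * \<delta> ^ d \<le> v"
proof -
  have "((\<lambda>\<delta>. a * \<delta>\<^sup>2) \<longlongrightarrow> a * 0\<^sup>2) (at_right 0)" "((\<lambda>\<delta>. c * \<delta> ^ d) \<longlongrightarrow> c * 0 ^ d) (at_right 0)"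
    by (intro tendsto_intros)+
  then have "\<forall>\<^sub>F \<delta> in at_right 0. a * \<delta>\<^sup>2 < 1" "\<forall>\<^sub>F \<delta> in at_right 0. c * \<delta> ^ d < v"
    using assms by (auto intro: order_tendstoD(2) simp: power_0_left)
  moreover have "\<forall>\<^sub>F \<delta> in at_right 0. \<delta> < min 1 \<rho>" "\<forall>\<^sub>F \<delta> in at_right (0::real). 0 < \<delta>"
    using assms eventually_at_right_real[of 0 "min 1 \<rho>"]
    by (auto simp: eventually_at_right_less elim: eventually_mono)
  ultimately have "\<forall>\<^sub>F \<delta> in at_right 0. 0 < \<delta> \<and> \<delta> \<le> 1 \<and> \<delta> \<le> \<rho> \<and> a * \<delta>\<^sup>2 \<le> 1 \<and> c * \<delta> ^ d \<le> v"
    by eventually_elim auto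
  then have "\<exists>\<delta>. 0 < \<delta> \<and> \<delta> \<le> 1 \<and> \<delta> \<le> \<rho> \<and> a * \<delta>\<^sup>2 \<le> 1 \<and> c * \<delta> ^ d \<le> v"
    by (rule eventually_happens'[rotated]) simp
  with that show ?thesis by blast
qed

lemma powr_root_power:
  assumes "0 < x" "0 < d"
  shows "(x powr (1 / real d)) ^ d = x" "(x powr (1 / real d))\<^sup>2 = x powr (2 / real d)"
  using assms by (simp_all add: powr_power)

text \<open>\<open>b \<le> 1\<close> and \<open>1 \<le> B\<close> make the uniform law admissible;
  for other values no density could integrate to 1 and the model would be empty.
  \<open>nondegenerate\<close> provides room of two kinds: slack in the reach pays for the bump, and
  a point in the interior of \<open>K\<close> can be moved without leaving \<open>K\<close>. For
  fixed \<pi> the order n^(-2/d) is what matters, and \<open>C\<close> depends on \<pi>.\<close>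

theorem theorem4:
  fixes K :: "'a::euclidean_space set" and d :: nat and \<kappa> b B \<pi> :: real
  assumes "1 \<le> d" and "d < DIM('a)" and "0 < \<kappa>"
    and "compact K" and "interior K \<noteq> {}"
    and "0 < b" and "b \<le> 1" and "1 \<le> B"
    and "0 < \<pi>" and "\<pi> \<le> 1"
    and nondegenerate: "\<exists>M\<in>manifolds_in d \<kappa> K. ereal \<kappa> < reach M \<and> M \<inter> interior K \<noteq> {}"
  shows "\<exists>C>0. \<forall>n\<ge>1.
    (INF Mh\<in>estimators d \<kappa> K n. SUP (M, Q)\<in>clutter_model d \<kappa> K b B \<pi>. risk n Mh M Q)
      \<ge> ennreal (C * (1 / (real n * \<pi>)) powr (2 / real d))"
proof -
  have d: "0 < d" using assms(1) by simp
  obtain M p0 where Mm: "M \<in> manifolds_in d \<kappa> K" and reach: "ereal \<kappa> < reach M"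
    and p0: "p0 \<in> M" "p0 \<in> interior K"
    using nondegenerate by blast
  then have smooth: "smooth_submanifold d M" and MK: "M \<subseteq> K"
    by (auto simp: manifolds_in_def manifolds_def)
  obtain r where r: "\<kappa> < r" "unique_projection r M" using less_reachE[OF reach] .
  have r0: "0 < r" using r(1) \<open>0 < \<kappa>\<close> by simp
  have clM: "closed M" by (rule unique_projection_imp_closed[OF r(2) r0])
  have cM: "compact M" using compact_Int_closed[OF \<open>compact K\<close> clM] MK by (simp add: Int_absorb1)
  obtain p e A where p: "p \<in> M" "p \<in> interior K" and e: "norm e = 1" and A: "0 < A"
    and prox: "\<And>y. y \<in> M \<Longrightarrow> - (A * (norm (y - p))\<^sup>2) \<le> (y - p) \<bullet> e"
    using proximal_point_exists[OF clM smooth assms(2) p0] by blast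
  obtain \<rho>1 where \<rho>1: "0 < \<rho>1" "ball p \<rho>1 \<subseteq> K" using p(2) by (auto simp: mem_interior)
  obtain \<rho>2 k where \<rho>2: "0 < \<rho>2" "0 < k"
    "\<And>\<delta>. 0 < \<delta> \<Longrightarrow> \<delta> \<le> \<rho>2 \<Longrightarrow> hausdorff_outer d (M \<inter> ball p \<delta>) \<le> ennreal (k * \<delta> ^ d)"
    using hausdorff_outer_manifold_ball[OF smooth p(1) d] by blast
  obtain h0 where h0: "hausdorff_outer d M = ennreal h0" "0 < h0"
    using hausdorff_outer_manifold_pos[OF smooth p(1) d] hausdorff_outer_compact_manifold_finite[OF smooth cM d]
    by (cases "hausdorff_outer d M") auto
  obtain P where P: "0 < P" "\<And>c \<delta> (p::'a). 0 < c \<Longrightarrow> 0 < \<delta> \<Longrightarrow> \<delta> \<le> 1 \<Longrightarrow>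
       \<exists>G. gradient_bound (c * P) (scaled_bump c \<delta> p) G"
    using scaled_bump_gradient_bound[where 'a = 'a] by blast
  \<comment> \<open>Since (1 - \<epsilon>)^2 \<ge> 1 - 2 \<epsilon>, the curvature assumption of
    \<open>unique_projection_push\<close> follows from its linear part, which reads
    \<open>\<epsilon> * L \<le> r - \<kappa>\<close>. The other bound on \<epsilon>, 1/4, is the one
    that \<open>push_avoids_center\<close> asks for.\<close>
  define L where "L = 2 * r + 2 * r * \<kappa> + \<kappa>"
  have L: "0 < L" using r0 \<open>0 < \<kappa>\<close> by (simp add: L_def add_pos_pos)
  define \<epsilon> where "\<epsilon> = min (1 / 4) ((r - \<kappa>) / L)"
  have \<epsilon>: "0 < \<epsilon>" "\<epsilon> \<le> 1 / 4" "\<epsilon> * L \<le> r - \<kappa>"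
    using r(1) L by (auto simp: \<epsilon>_def min_def field_simps)
  have curv: "(1 + \<epsilon>) * \<kappa> \<le> r * ((1 - \<epsilon>)\<^sup>2 - 2 * \<epsilon> * \<kappa>)"
  proof -
    have "(1 + \<epsilon>) * \<kappa> \<le> r * (1 - 2 * \<epsilon> - 2 * \<epsilon> * \<kappa>)"
      using \<epsilon>(3) by (simp add: L_def algebra_simps)
    also have "\<dots> \<le> r * ((1 - \<epsilon>)\<^sup>2 - 2 * \<epsilon> * \<kappa>)"
      using r0 by (intro mult_left_mono) (auto simp: power2_eq_square algebra_simps)
    finally show ?thesis .
  qed
  define c where "c = \<epsilon> / P"
  have c: "0 < c" "c * P = \<epsilon>" using \<epsilon> P(1) by (auto simp: c_def)
  define \<beta> where "\<beta> = bump (0::'a)"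
  have \<beta>: "0 < \<beta>" unfolding \<beta>_def by (rule bump_0)
  \<comment> \<open>All demands on the width are met once, independently of \<open>n\<close>: at
    most 1 for the bump, a ball inside \<open>K\<close> and within range of the mass bound, the
    constant 16 of \<open>push_avoids_center\<close>, and a mass defect of at most
    \<open>h0 / 2\<close>.\<close>
  obtain \<delta>0 where \<delta>0: "0 < \<delta>0" "\<delta>0 \<le> 1" "\<delta>0 \<le> min \<rho>1 \<rho>2" "(16 * A * c * \<beta>) * \<delta>0\<^sup>2 \<le> 1"
    "((1 + 2 ^ d) * k) * \<delta>0 ^ d \<le> h0 / 2"
    using ex_small_width[of "min \<rho>1 \<rho>2" d "h0 / 2" "16 * A * c * \<beta>" "(1 + 2 ^ d) * k"] \<rho>1(1) \<rho>2(1) d h0(2)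
    by auto
  \<comment> \<open>32 = 4 * 4 * 2: the factors lost in \<open>push_avoids_center\<close> and in the
    two-point bound, and \<open>1 / 2 \<le> q ^ n\<close>. The power of \<pi> cancels the one in the
    claimed rate.\<close>
  define C where "C = c * \<beta> * \<delta>0\<^sup>2 / 32 * \<pi> powr (2 / real d)"
  have bound: "ennreal (C * (1 / (real n * \<pi>)) powr (2 / real d))
      \<le> (SUP (M, Q)\<in>clutter_model d \<kappa> K b B \<pi>. risk n Mh M Q)"
    if n: "1 \<le> n" and Mh: "Mh \<in> estimators d \<kappa> K n" for n Mh
  proof -
    \<comment> \<open>Scaling the width by \<open>s\<close> shrinks the mass bound by exactly 1/n
      and the height by n^(-2/d).\<close>
    define s where "s = (1 / real n) powr (1 / real d)"
    have s: "0 < s" "s \<le> 1" using n by (auto simp: s_def powr_le1)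
    have s_pow: "s ^ d = 1 / real n" "s\<^sup>2 = (1 / real n) powr (2 / real d)"
      unfolding s_def using powr_root_power[of "1 / real n" d] n d by auto
    define \<delta> where "\<delta> = \<delta>0 * s"
    have \<delta>: "0 < \<delta>" "\<delta> \<le> \<delta>0" using s \<delta>0 by (auto simp: \<delta>_def mult_left_le)
    then have \<delta>_le: "\<delta> \<le> 1" "\<delta> \<le> \<rho>1" "\<delta> \<le> \<rho>2" using \<delta>0 by auto
    define h where "h = scaled_bump c \<delta> p"
    obtain G where G: "gradient_bound \<epsilon> h G"
      using P(2)[OF c(1) \<delta>(1) \<delta>_le(1), of p] by (auto simp: c(2) h_def)
    have \<epsilon>1: "\<epsilon> < 1" using \<epsilon> by simp
    have smooth_h: "smooth_on UNIV h" unfolding smooth_on_def h_def using ck_on_scaled_bump by blast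
    obtain g where g: "\<And>x. g (push h e x) = x" "\<And>y. push h e (g y) = y"
      "smooth_on UNIV (push h e)" "smooth_on UNIV g"
      using push_diffeomorphism[OF G \<epsilon>1 e smooth_h] by blast
    have h_out: "h x = 0" if "\<delta> \<le> dist x p" for x
      unfolding h_def using scaled_bump_eq_0[OF \<delta>(1) that] .
    note outside = push_outside_support[of g h e \<delta> p, OF g(1) h_out]
    define M1 where "M1 = push h e ` M"
    define W where "W = M - ball p \<delta>"
    have WM1: "W = M1 - ball p \<delta>" unfolding W_def M1_def using outside(1) by simp
    have M1_sub: "M1 \<subseteq> W \<union> push h e ` (M \<inter> ball p \<delta>)"
    proof
      fix y assume y: "y \<in> M1"
      show "y \<in> W \<union> push h e ` (M \<inter> ball p \<delta>)"
      proof (cases "y \<in> ball p \<delta>")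
        case True
        obtain x where x: "x \<in> M" "y = push h e x" using y by (auto simp: M1_def)
        have "x \<in> ball p \<delta>"
        proof (rule ccontr)
          assume "x \<notin> ball p \<delta>"
          then have "push h e x = x" using h_out[of x] by (simp add: push_def dist_commute)
          then show False using True x \<open>x \<notin> ball p \<delta>\<close> by simp
        qed
        then show ?thesis using x by blast
      next
        case False
        then show ?thesis using y unfolding WM1 by simp
      qed
    qed
    have uniq1: "unique_projection \<kappa> M1"
      unfolding M1_def by (rule unique_projection_push[OF cM r(2) G \<epsilon>1 e \<open>0 < \<kappa>\<close> curv r0])
    have clM1: "closed M1" by (rule unique_projection_imp_closed[OF uniq1 \<open>0 < \<kappa>\<close>])
    have M1m: "M1 \<in> manifolds_in d \<kappa> K"
    proof -
      have "smooth_submanifold d M1" unfolding M1_def by (rule smooth_submanifold_image[OF smooth g])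
      moreover have "ereal \<kappa> \<le> reach M1" using \<open>0 < \<kappa>\<close> uniq1 by (intro le_reachI) auto
      moreover have "M1 \<noteq> {}" using p(1) by (auto simp: M1_def)
      moreover have "M1 \<subseteq> K"
      proof
        fix y assume "y \<in> M1"
        then consider "y \<in> W" | "y \<in> push h e ` (M \<inter> ball p \<delta>)" using M1_sub by blast
        then show "y \<in> K"
        proof cases
          case 2
          then have "y \<in> ball p \<delta>" using outside(2) by blast
          also have "ball p \<delta> \<subseteq> ball p \<rho>1" using \<delta>_le by (intro subset_ball)
          finally show ?thesis using \<rho>1(2) by blast
        qed (use MK W_def in auto)
      qed
      ultimately show ?thesis by (simp add: manifolds_in_def manifolds_def)
    qed
    define \<alpha> where "\<alpha> = k * \<delta> ^ d"
    have \<alpha>0: "0 \<le> \<alpha>" using \<rho>2 \<delta> by (simp add: \<alpha>_def)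
    have \<alpha>: "hausdorff_outer d (M \<inter> ball p \<delta>) \<le> ennreal \<alpha>"
      unfolding \<alpha>_def by (rule \<rho>2(3)[OF \<delta>(1) \<delta>_le(3)])
    have \<alpha>_small: "(1 + 2 ^ d) * \<alpha> \<le> h0 / (2 * real n)"
    proof -
      have "(1 + 2 ^ d) * \<alpha> = (((1 + 2 ^ d) * k) * \<delta>0 ^ d) * (1 / real n)"
        by (simp add: \<alpha>_def \<delta>_def power_mult_distrib s_pow)
      also have "\<dots> \<le> h0 / 2 * (1 / real n)" by (intro mult_right_mono \<delta>0) auto
      finally show ?thesis by simp
    qed
    \<comment> \<open>\<open>m\<close> bounds both total masses and \<open>w\<close> bounds the
      common one from below; their difference is (1 + 2^d) \<alpha>. The factor 2^d comes from the
      crude Lipschitz constant 1 + \<epsilon> \<le> 2 of the push.\<close>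
    define m where "m = h0 + 2 ^ d * \<alpha>"
    define w where "w = h0 - \<alpha>"
    have h0n: "h0 / (2 * real n) \<le> h0 / 2" using n h0(2) by (intro divide_left_mono) auto
    have "\<alpha> \<le> (1 + 2 ^ d) * \<alpha>" using \<alpha>0 by (simp add: distrib_right)
    moreover have "0 \<le> 2 ^ d * \<alpha>" using \<alpha>0 by simp
    ultimately have w: "0 < w" "w \<le> m" 
      using \<alpha>_small h0n h0(2) \<alpha>0 unfolding w_def m_def by linarith+
    have MW: "M = W \<union> (M \<inter> ball p \<delta>)" by (auto simp: W_def)
    have wW: "ennreal w \<le> hausdorff_outer d W"
    proof -
      have "ennreal h0 \<le> hausdorff_outer d W + hausdorff_outer d (M \<inter> ball p \<delta>)"
        using hausdorff_outer_subadditive2[OF d, of W "M \<inter> ball p \<delta>"]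
        unfolding MW[symmetric] h0(1) .
      also have "\<dots> \<le> hausdorff_outer d W + ennreal \<alpha>" by (intro add_left_mono \<alpha>)
      finally have "ennreal h0 - ennreal \<alpha> \<le> hausdorff_outer d W"
        by (simp add: ennreal_minus_le_iff add.commute)
      then show ?thesis using \<alpha>0 by (simp add: w_def ennreal_minus)
    qed
    have mM: "hausdorff_outer d M \<le> ennreal m"
      using h0(1) \<alpha>0 by (simp add: m_def ennreal_leI)
    have mM1: "hausdorff_outer d M1 \<le> ennreal m"
    proof -
      have "hausdorff_outer d M1 \<le> hausdorff_outer d (W \<union> push h e ` (M \<inter> ball p \<delta>))"
        by (rule hausdorff_outer_mono[OF M1_sub])
      also have "\<dots> \<le> hausdorff_outer d W + hausdorff_outer d (push h e ` (M \<inter> ball p \<delta>))"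
        by (rule hausdorff_outer_subadditive2[OF d])
      also have "\<dots> \<le> ennreal h0 + ennreal (2 ^ d) * ennreal \<alpha>"
      proof (rule add_mono)
        show "hausdorff_outer d W \<le> ennreal h0"
          unfolding h0(1)[symmetric] W_def by (rule hausdorff_outer_mono) blast
        have "hausdorff_outer d (push h e ` (M \<inter> ball p \<delta>))
            \<le> ennreal (2 ^ d) * hausdorff_outer d (M \<inter> ball p \<delta>)"
        proof (rule hausdorff_outer_lipschitz[OF d])
          fix x y
          have "norm (push h e x - push h e y) \<le> (1 + \<epsilon>) * norm (x - y)" by (rule push_dist(1)[OF G e])
          also have "\<dots> \<le> 2 * norm (x - y)" using \<epsilon> by (intro mult_right_mono) auto
          finally show "norm (push h e x - push h e y) \<le> 2 * norm (x - y)" .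
        qed simp
        also have "\<dots> \<le> ennreal (2 ^ d) * ennreal \<alpha>" by (intro mult_left_mono \<alpha>) simp
        finally show "hausdorff_outer d (push h e ` (M \<inter> ball p \<delta>)) \<le> ennreal (2 ^ d) * ennreal \<alpha>" .
      qed
      also have "\<dots> = ennreal m"
        using h0(2) \<alpha>0 by (simp add: m_def ennreal_mult')
      finally show ?thesis .
    qed
    define \<eta> where "\<eta> = c * \<beta> * \<delta>\<^sup>2"
    have \<eta>0: "0 \<le> \<eta>" using c \<beta> by (simp add: \<eta>_def)
    have hp: "h p = \<eta>" by (simp add: h_def scaled_bump_center \<eta>_def \<beta>_def mult_ac)
    have far: "\<eta> / 4 \<le> dist y p" if y: "y \<in> M1" for y
    proof -
      obtain x where x: "x \<in> M" "y = push h e x" using y by (auto simp: M1_def)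
      have "16 * A * h p \<le> (16 * A * c * \<beta>) * \<delta>0\<^sup>2"
        unfolding hp \<eta>_def using A c \<beta> \<delta>
        by (simp add: mult.assoc)
      then have hA: "16 * A * h p \<le> 1" using \<delta>0(4) by simp
      have "h p / 4 \<le> norm (push h e x - p)"
        by (rule push_avoids_center[OF G \<epsilon>(2) e _ _ hA A prox[OF x(1)]])
           (use c scaled_bump_nonneg[of c \<delta> p x] scaled_bump_le[of c \<delta> p x] in
             \<open>auto simp: h_def scaled_bump_center\<close>)
      then show ?thesis by (simp add: hp x dist_norm)
    qed
    define q where "q = 1 - \<pi> + \<pi> * (w / m)"
    have q: "1 - 1 / (2 * real n) \<le> q"
    proof -
      have m0: "0 < m" using w by simp
      have "(m - w) / m \<le> (h0 / (2 * real n)) / m"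
        using \<alpha>_small m0 by (intro divide_right_mono) (auto simp: m_def w_def algebra_simps)
      also have "\<dots> \<le> (h0 / (2 * real n)) / h0"
        using h0(2) \<alpha>0 m0 n by (intro divide_left_mono) (auto simp: m_def)
      also have "\<dots> = 1 / (2 * real n)" using h0(2) by simp
      finally have le: "(m - w) / m \<le> 1 / (2 * real n)" .
      have "q = 1 - \<pi> * ((m - w) / m)" using m0 by (simp add: q_def field_simps)
      moreover have "\<pi> * ((m - w) / m) \<le> 1 * (1 / (2 * real n))"
        using \<open>0 < \<pi>\<close> \<open>\<pi> \<le> 1\<close> le w m0 by (intro mult_mono) auto
      ultimately show ?thesis by simp
    qed
    \<comment> \<open>By Bernoulli's inequality, \<open>n\<close> factors of at least 1 - 1/(2n)
      keep their product above 1/2; this fixes how small the mass defect has to be.\<close>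
    have qn: "1 / 2 \<le> q ^ n"
    proof -
      have "1 + real n * (- (1 / (2 * real n))) \<le> (1 + - (1 / (2 * real n))) ^ n"
        using n by (intro Bernoulli_inequality) (auto simp: field_simps)
      also have "\<dots> \<le> q ^ n" using q n by (intro power_mono) (auto simp: field_simps)
      finally show ?thesis using n by simp
    qed
    have "ennreal (\<eta> / 4 / 4 * q ^ n) \<le> (SUP (M, Q)\<in>clutter_model d \<kappa> K b B \<pi>. risk n Mh M Q)"
      unfolding q_def
    proof (rule two_point_risk_bound[OF d \<open>compact K\<close> \<open>interior K \<noteq> {}\<close> \<open>0 < \<pi>\<close> \<open>\<pi> \<le> 1\<close> \<open>b \<le> 1\<close> \<open>1 \<le> B\<close>
          Mm _ M1m _ _ _ _ mM mM1 w wW p(1) far _ Mh])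
      show "M \<in> sets borel" "M1 \<in> sets borel" using clM clM1 by auto
      show "W \<in> sets borel" unfolding W_def using clM by auto
      show "W \<subseteq> M" "W \<subseteq> M1" using W_def WM1 by auto
      show "0 \<le> \<eta> / 4" using \<eta>0 by simp
    qed
    moreover have "C * (1 / (real n * \<pi>)) powr (2 / real d) \<le> \<eta> / 4 / 4 * q ^ n"
    proof -
      have "\<pi> powr (2 / real d) * (1 / (real n * \<pi>)) powr (2 / real d) = (1 / real n) powr (2 / real d)"
        using \<open>0 < \<pi>\<close> n by (simp flip: powr_mult)
      then have "C * (1 / (real n * \<pi>)) powr (2 / real d) = \<eta> / 16 * (1 / 2)"
        by (simp add: C_def \<eta>_def \<delta>_def power_mult_distrib s_pow mult_ac)
      also have "\<dots> \<le> \<eta> / 16 * q ^ n" by (intro mult_left_mono qn) (use \<eta>0 in simp)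
      finally show ?thesis by simp
    qed
    ultimately show ?thesis by (meson ennreal_leI order_trans)
  qed
  have "0 < C" using c \<beta> \<delta>0 \<open>0 < \<pi>\<close> by (simp add: C_def)
  with bound show ?thesis by (intro exI[of _ C] conjI allI impI INF_greatest) auto
qed

end
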